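(* Let $k$ be a field, let $R=k[x_1,x_2,\ldots,x_r]$ be a polynomial ring over $k$, and let $P$ be a homogeneous prime ideal of $R$ such that $\dim(R/P)=2$. Fix a monomial order on $R$, and let $in(P)$ be the initial ideal of $P$ with respect to this order. Assume that $in(P)$ is a Borel-fixed ideal. Then $in(P)$ has the saturated chain property, i.e. for every associated prime ideal $Q$ of $R/in(P)$ that is not minimal over $in(P)$ there exists an associated prime ideal $P'$ of $R/in(P)$ with $P'\subseteq Q$ and $\dim(R/P')=\dim(R/Q)+1$.
   Context: Throughout, $R=k[x_1,\ldots,x_r]$ is a polynomial ring over a field $k$, and $\dim$ denotes Krull dimension. Homogeneous refers to the standard grading, in which each $x_i$ has degree $1$. Monomial order: a total order $\geq$ on the monomials of $R$ such that $m\geq 1$ for each monomial $m$, and such that if $m_1,m_2,n$ are monomials with $m_1\geq m_2$, then $nm_1\geq nm_2$. Initial ideal: for a nonzero $f\in R$, the initial term $in(f)$ is the largest term of $f$ with respect to the fixed monomial order. For an ideal $I$ of $R$, the initial ideal is $in(I)=\langle \{in(f) : f\in I\}\rangle$. Borel-fixed: let $\mathcal G=GL(r,k)$ be the group of invertible $r\times r$ matrices over $k$, and let $B=\{(g_{ij})\in\mathcal G \mid g_{ij}=0 \text{ for } j>i\}$ be the Borel subgroup of lower triangular matrices. A matrix $g=(g_{ij})\in\mathcal G$ acts on $R$ as the $k$-algebra automorphism determined by $g(x_i)=\sum_{j=1}^r g_{ij}x_j$. For an ideal $I$ put $g(I)=\{g(f)\mid f\in I\}$. The ideal $I$ is Borel-fixed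 if $g(I)=I$ for every $g\in B$. Saturated chain property: the associated primes of an ideal $I\subseteq R$ are the associated primes of the $R$-module $R/I$. An ideal $I\subseteq R$ has the saturated chain property if, given any non-minimal associated prime ideal $Q$ of $I$, there exists an associated prime ideal $P'\subseteq Q$ of $I$ such that $\dim(R/P')=\dim(R/Q)+1$. *)

theory Defs
  imports
    "HOL-Library.Extended_Nat"
    "HOL-Library.Poly_Mapping"
    "HOL-Algebra.QuotRing"
    "HOL-Algebra.Module"
    "Jordan_Normal_Form.Matrix"
begin

section \<open>Polynomial rings\<close>

text \<open>
  A monomial is its exponent vector, a polynomial the finitely supported family of its
  coefficients; multiplication of monomials is addition of exponent vectors. The variables
  \<open>x\<^sub>1, \<dots>, x\<^sub>r\<close> are numbered \<open>0, \<dots>, r - 1\<close>, to agree with the indexing of matrices.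
\<close>

type_synonym mon = "nat \<Rightarrow>\<^sub>0 nat"
type_synonym 'k mpol = "mon \<Rightarrow>\<^sub>0 'k"

definition monomials :: "nat \<Rightarrow> mon set" where
  "monomials r = {m. Poly_Mapping.keys m \<subseteq> {..<r}}"

definition poly_ring :: "nat \<Rightarrow> 'k::field mpol ring" where
  "poly_ring r = \<lparr>carrier = {p. Poly_Mapping.keys p \<subseteq> monomials r},
     monoid.mult = (*), one = 1, zero = 0, add = (+)\<rparr>"

definition const :: "'k::field \<Rightarrow> 'k mpol" where
  "const c = Poly_Mapping.single 0 c"

definition var :: "nat \<Rightarrow> 'k::field mpol" where
  "var i = Poly_Mapping.single (Poly_Mapping.single i 1) 1"

definition mon_degree :: "nat \<Rightarrow> mon \<Rightarrow> nat" where
  "mon_degree r m = (\<Sum>i<r. Poly_Mapping.lookup m i)"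

definition homogeneous :: "nat \<Rightarrow> nat \<Rightarrow> 'k::field mpol \<Rightarrow> bool" where
  "homogeneous r d f \<longleftrightarrow> f \<in> carrier (poly_ring r) \<and>
     (\<forall>m \<in> Poly_Mapping.keys f. mon_degree r m = d)"

definition homogeneous_ideal :: "nat \<Rightarrow> 'k::field mpol set \<Rightarrow> bool" where
  "homogeneous_ideal r I \<longleftrightarrow>
     (\<exists>S. (\<forall>f \<in> S. \<exists>d. homogeneous r d f) \<and> I = Idl\<^bsub>poly_ring r\<^esub> S)"


section \<open>Initial ideals\<close>

text \<open>
  A pair \<open>(m, n) \<in> ord\<close> means \<open>m \<le> n\<close>, as usual for \<^const>\<open>linear_order_on\<close>.
\<close>

definition monomial_order :: "nat \<Rightarrow> mon rel \<Rightarrow> bool" where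
  "monomial_order r ord \<longleftrightarrow> linear_order_on (monomials r) ord \<and>
     (\<forall>m \<in> monomials r. (0, m) \<in> ord) \<and>
     (\<forall>m1 \<in> monomials r. \<forall>m2 \<in> monomials r. \<forall>n \<in> monomials r.
        (m2, m1) \<in> ord \<longrightarrow> (n + m2, n + m1) \<in> ord)"

definition initial_monomial :: "mon rel \<Rightarrow> 'k::field mpol \<Rightarrow> mon" where
  "initial_monomial ord f =
     (THE m. m \<in> Poly_Mapping.keys f \<and> (\<forall>m' \<in> Poly_Mapping.keys f. (m', m) \<in> ord))"

definition initial_term :: "mon rel \<Rightarrow> 'k::field mpol \<Rightarrow> 'k mpol" where
  "initial_term ord f = Poly_Mapping.single (initial_monomial ord f)
     (Poly_Mapping.lookup f (initial_monomial ord f))"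

definition initial_ideal :: "nat \<Rightarrow> mon rel \<Rightarrow> 'k::field mpol set \<Rightarrow> 'k mpol set" where
  "initial_ideal r ord I = Idl\<^bsub>poly_ring r\<^esub> {initial_term ord f |f. f \<in> I \<and> f \<noteq> 0}"


section \<open>Borel-fixed ideals\<close>

definition borel_group :: "nat \<Rightarrow> 'k::field mat set" where
  "borel_group r = {g \<in> carrier_mat r r. invertible_mat g \<and>
     (\<forall>i<r. \<forall>j<r. i < j \<longrightarrow> g $$ (i, j) = 0)}"

text \<open>
  The substitution \<open>x\<^sub>i \<mapsto> \<Sum>\<^sub>j g\<^sub>i\<^sub>j x\<^sub>j\<close>, extended to all polynomials as a \<open>k\<close>-algebra homomorphism.
\<close>

definition mat_action :: "nat \<Rightarrow> 'k::field mat \<Rightarrow> 'k mpol \<Rightarrow> 'k mpol" where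
  "mat_action r g f = (\<Sum>m \<in> Poly_Mapping.keys f. const (Poly_Mapping.lookup f m) *
     (\<Prod>i<r. (\<Sum>j<r. const (g $$ (i, j)) * var j) ^ Poly_Mapping.lookup m i))"

definition borel_fixed :: "nat \<Rightarrow> 'k::field mpol set \<Rightarrow> bool" where
  "borel_fixed r I \<longleftrightarrow> (\<forall>g \<in> borel_group r. mat_action r g ` I = I)"


section \<open>Krull dimension and associated primes\<close>

text \<open>The convention for the supremum gives the zero ring dimension \<open>0\<close>.\<close>

definition krull_dim :: "('a, 'm) ring_scheme \<Rightarrow> enat" where
  "krull_dim A = Sup {enat n |n. \<exists>C :: nat \<Rightarrow> 'a set.
     (\<forall>i\<le>n. primeideal (C i) A) \<and> (\<forall>i<n. C i \<subset> C (Suc i))}"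

definition minimal_prime :: "('a, 'm) ring_scheme \<Rightarrow> 'a set \<Rightarrow> 'a set \<Rightarrow> bool" where
  "minimal_prime A I Q \<longleftrightarrow> primeideal Q A \<and> I \<subseteq> Q \<and>
     \<not> (\<exists>Q'. primeideal Q' A \<and> I \<subseteq> Q' \<and> Q' \<subset> Q)"

definition quotient_module :: "('a, 'm) ring_scheme \<Rightarrow> 'a set \<Rightarrow> ('a, 'a set) module" where
  "quotient_module A I = \<lparr>carrier = carrier (A Quot I), monoid.mult = monoid.mult (A Quot I),
     one = monoid.one (A Quot I), zero = ring.zero (A Quot I), add = ring.add (A Quot I),
     smult = (\<lambda>a x. (I +>\<^bsub>A\<^esub> a) \<otimes>\<^bsub>A Quot I\<^esub> x)\<rparr>"

definition module_associated_primes ::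
    "('a, 'm) ring_scheme \<Rightarrow> ('a, 'b, 'n) module_scheme \<Rightarrow> 'a set set" where
  "module_associated_primes A M = {Q. primeideal Q A \<and>
     (\<exists>x \<in> carrier M. Q = {a \<in> carrier A. a \<odot>\<^bsub>M\<^esub> x = \<zero>\<^bsub>M\<^esub>})}"

definition associated_primes :: "('a, 'm) ring_scheme \<Rightarrow> 'a set \<Rightarrow> 'a set set" where
  "associated_primes A I = module_associated_primes A (quotient_module A I)"

definition saturated_chain_property :: "('a, 'm) ring_scheme \<Rightarrow> 'a set \<Rightarrow> bool" where
  "saturated_chain_property A I \<longleftrightarrow>
     (\<forall>Q \<in> associated_primes A I. \<not> minimal_prime A I Q \<longrightarrow>
        (\<exists>P' \<in> associated_primes A I. P' \<subseteq> Q \<and>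
           krull_dim (A Quot P') = krull_dim (A Quot Q) + 1))"


section \<open>Well-formedness\<close>

lemma monomials_add: "m \<in> monomials r \<Longrightarrow> n \<in> monomials r \<Longrightarrow> m + n \<in> monomials r"
  unfolding monomials_def using keys_add[of m n] by blast

lemma cring_poly_ring: "cring (poly_ring r :: 'k::field mpol ring)"
proof (rule cringI)
  show "abelian_group (poly_ring r :: 'k mpol ring)"
  proof (rule abelian_groupI)
    fix x y :: "'k mpol"
    assume "x \<in> carrier (poly_ring r)" "y \<in> carrier (poly_ring r)"
    then show "x \<oplus>\<^bsub>poly_ring r\<^esub> y \<in> carrier (poly_ring r)"
      using keys_add[of x y] by (auto simp: poly_ring_def)
  next
    fix x :: "'k mpol"
    assume "x \<in> carrier (poly_ring r)"
    then show "\<exists>y \<in> carrier (poly_ring r). y \<oplus>\<^bsub>poly_ring r\<^esub> x = \<zero>\<^bsub>poly_ring r\<^esub>"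
      by (intro bexI[of _ "- x"]) (auto simp: poly_ring_def)
  qed (auto simp: poly_ring_def algebra_simps)
  show "comm_monoid (poly_ring r :: 'k mpol ring)"
  proof (rule comm_monoidI)
    fix x y :: "'k mpol"
    assume "x \<in> carrier (poly_ring r)" "y \<in> carrier (poly_ring r)"
    then show "x \<otimes>\<^bsub>poly_ring r\<^esub> y \<in> carrier (poly_ring r)"
      using keys_mult[of x y] monomials_add by (fastforce simp: poly_ring_def)
  qed (auto simp: poly_ring_def algebra_simps monomials_def)
qed (auto simp: poly_ring_def algebra_simps)

lemma module_quotient_module:
  assumes "cring A" and "ideal I A"
  shows "module A (quotient_module A I)"
proof -
  interpret A: cring A by fact
  interpret I: ideal I A by fact
  interpret Q: cring "A Quot I" using I.quotient_is_cring[OF assms(1)] .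
  interpret h: ring_hom_cring A "A Quot I" "(+>\<^bsub>A\<^esub>) I"
    using I.rcos_ring_hom_cring[OF assms(1)] .
  show ?thesis
  proof (rule moduleI)
    show "abelian_group (quotient_module A I)"
    proof (rule abelian_groupI)
      fix x
      assume "x \<in> carrier (quotient_module A I)"
      then show "\<exists>y \<in> carrier (quotient_module A I).
          y \<oplus>\<^bsub>quotient_module A I\<^esub> x = \<zero>\<^bsub>quotient_module A I\<^esub>"
        by (intro bexI[of _ "\<ominus>\<^bsub>A Quot I\<^esub> x"]) (auto simp: quotient_module_def Q.l_neg)
    qed (auto simp: quotient_module_def Q.a_ac)
  qed (auto simp: quotient_module_def Q.l_distr Q.r_distr Q.m_assoc assms)
qed

end

theory Submission
  imports Defs "Jordan_Normal_Form.Gauss_Jordan_Elimination"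
begin

text \<open>
  Write \<open>R\<close> for the polynomial ring, \<open>I = in(P)\<close>, and \<open>Q\<^sub>j\<close> for the ideal generated by the first
  \<open>j\<close> variables. As \<open>I\<close> is a monomial ideal, each associated prime of \<open>I\<close> is generated by variables
  (\<open>associated_prime_of_monomial_ideal\<close>), and since \<open>I\<close> is Borel-fixed these variables form an
  initial segment (\<open>borel_fixed_associated_initial_segment\<close>). So the associated primes are some of
  the \<open>Q\<^sub>j\<close>, and \<open>dim(R/Q\<^sub>j) = r - j\<close> (\<open>krull_dim_var_ideal\<close>). What has to be shown is that
  \<open>Q\<^sub>j\<^sub>-\<^sub>1\<close> is associated whenever \<open>Q\<^sub>j\<close> is associated and not minimal.

  Let \<open>j\<^sub>0\<close> be the least index that occurs; \<open>Q\<^sub>j\<close> for \<open>j = j\<^sub>0\<close> is the radical of \<open>I\<close>. Then \<open>R/P\<close>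
  contains the polynomial ring in the last \<open>r - j\<^sub>0\<close> variables and is a finite module over it, so a
  going-up argument gives \<open>r - j\<^sub>0 \<le> dim(R/P) = 2\<close> (\<open>prime_chain_above_of_pure_powers\<close>). A
  non-minimal \<open>Q\<^sub>j\<close> therefore has \<open>j = j\<^sub>0 + 1\<close>, where nothing is left to prove, or
  \<open>j = j\<^sub>0 + 2 = r\<close>. In the second case suppose that the index \<open>r - 1\<close> does not occur. Let \<open>y\<close>, \<open>z\<close> be
  the last two variables and let \<open>J\<close> be the saturation of \<open>I\<close> with respect to \<open>y z\<close>. The only
  associated prime that contains \<open>y\<close> or \<open>z\<close> is the maximal ideal \<open>Q\<^sub>r\<close>, so a monomial in \<open>J\<close> is
  carried into \<open>I\<close> by a power of each variable; hence \<open>J\<close> and \<open>I\<close> agree in large degrees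
  (\<open>torsion_degree_bounded\<close>). They differ because \<open>Q\<^sub>r\<close> is associated to \<open>I\<close>.

  This is impossible (\<open>saturated_if_saturated_in_large_degree\<close>). Let \<open>f\<close> be a form of degree \<open>d\<close>
  outside \<open>P\<close> and \<open>n\<close> large. Reduce \<open>z\<^sup>n f\<close> and \<open>y\<^sup>n f\<close> modulo \<open>P\<close> to polynomials \<open>s\<close> and \<open>s'\<close> none of
  whose monomials lie in \<open>I\<close>; their leading monomials \<open>v\<close>, \<open>v'\<close> have large degree, so they are not
  in \<open>J\<close> either. Hence \<open>y\<^sup>n v\<close> and \<open>z\<^sup>n v'\<close> are not in \<open>I\<close>. They are the leading monomials of
  \<open>y\<^sup>n s\<close> and \<open>z\<^sup>n s'\<close>, which are congruent modulo \<open>P\<close>, so they are equal. Thus \<open>v = z\<^sup>n w'\<close> for a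
  monomial \<open>w'\<close> of degree \<open>d\<close> outside \<open>J\<close>, and subtracting a multiple of \<open>w'\<close> from \<open>f\<close> makes the
  leading monomial of \<open>s\<close> smaller. Starting with a monomial \<open>f = w\<close> that lies in \<open>J\<close> and not in
  \<open>I\<close>, all the polynomials obtained keep the term \<open>w\<close> and have no monomial in \<open>I\<close>; so they stay
  outside \<open>P\<close>, the process never stops, and this contradicts the well-ordering of the monomials.

  Behind this is a fact on the Groebner degeneration of \<open>R/P\<close> to \<open>R/I\<close>: if the first local
  cohomology of the special fibre vanishes, then multiplication by the parameter is surjective on
  that of the total space, which has finite length, so that it vanishes by Nakayama's lemma; but
  then \<open>R/I\<close> has no element of finite length.
\<close>

section \<open>Monomials and polynomials\<close>

abbreviation supp :: "('a \<Rightarrow>\<^sub>0 'b::zero) \<Rightarrow> 'a set" where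
  "supp \<equiv> Poly_Mapping.keys"

abbreviation coef :: "('a \<Rightarrow>\<^sub>0 'b::zero) \<Rightarrow> 'a \<Rightarrow> 'b" where
  "coef \<equiv> Poly_Mapping.lookup"

abbreviation single :: "'a \<Rightarrow> 'b \<Rightarrow> ('a \<Rightarrow>\<^sub>0 'b::zero)" where
  "single \<equiv> Poly_Mapping.single"

text \<open>
  The polynomials with all monomials in \<open>M\<close>. This one notion covers the ring itself, its subrings
  generated by some of the variables, the monomial ideals and the forms of a fixed degree.
\<close>

definition mspan :: "mon set \<Rightarrow> 'k::field mpol set" where
  "mspan M = {f. supp f \<subseteq> M}"

definition mons_in :: "nat set \<Rightarrow> mon set" where
  "mons_in B = {m. supp m \<subseteq> B}"

lemma monomials_eq: "monomials r = mons_in {..<r}"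
  by (simp add: monomials_def mons_in_def)

lemma zero_in_mons_in [simp]: "0 \<in> mons_in B"
  by (simp add: mons_in_def)

lemma zero_in_monomials [simp]: "0 \<in> monomials r"
  by (simp add: monomials_def)

lemma mons_in_mono: "B \<subseteq> C \<Longrightarrow> mons_in B \<subseteq> mons_in C"
  by (auto simp: mons_in_def)

lemma supp_mon_add: "supp (m + n :: mon) = supp m \<union> supp n"
  by (auto simp: in_keys_iff lookup_add)

lemma mons_in_add_iff [simp]: "m + n \<in> mons_in B \<longleftrightarrow> m \<in> mons_in B \<and> n \<in> mons_in B"
  by (auto simp: mons_in_def supp_mon_add)

lemma mon_diff_add: "(\<And>i. coef m i \<le> coef n i) \<Longrightarrow> (n - m) + m = (n :: mon)"
  by (rule poly_mapping_eqI) (simp add: lookup_add lookup_minus)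

lemma mons_in_single: "single i n \<in> mons_in B \<longleftrightarrow> n = 0 \<or> i \<in> B"
  by (auto simp: mons_in_def)

lemma mons_in_sum: "(\<And>x. x \<in> X \<Longrightarrow> f x \<in> mons_in B) \<Longrightarrow> sum f X \<in> mons_in B"
  by (induction X rule: infinite_finite_induct) auto

lemma supp_mon_diff: "supp (m - n :: mon) \<subseteq> supp m"
  by (auto simp: in_keys_iff lookup_minus)

lemma monomials_diff: "m \<in> monomials r \<Longrightarrow> m - n \<in> monomials r"
  using supp_mon_diff[of m n] by (auto simp: monomials_def)

lemma mon_peel:
  assumes "i \<in> supp (m :: mon)"
  shows "single i 1 + (m - single i 1) = m"
  using assms by (intro poly_mapping_eqI) (auto simp: lookup_add lookup_minus lookup_single when_def in_keys_iff)

lemma mon_split: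
  obtains m1 m2 :: mon where "m = m1 + m2" "supp m1 \<subseteq> A" "supp m2 \<subseteq> supp m - A"
proof -
  define m1 where "m1 = Abs_poly_mapping (\<lambda>i. coef m i when i \<in> A)"
  have "finite {i. (coef m i when i \<in> A) \<noteq> 0}"
    by (rule finite_subset[OF _ finite_keys[of m]]) (auto simp: in_keys_iff when_def split: if_splits)
  then have m1: "coef m1 i = (coef m i when i \<in> A)" for i
    by (simp add: m1_def)
  show ?thesis
  proof
    show "m = m1 + (m - m1)"
      by (rule poly_mapping_eqI) (simp add: lookup_add lookup_minus m1 when_def)
    show "supp m1 \<subseteq> A" "supp (m - m1) \<subseteq> supp m - A"
      by (auto simp: in_keys_iff lookup_minus m1 when_def split: if_splits)
  qed
qed

lemma mon_degree_add: "mon_degree r (m + n) = mon_degree r m + mon_degree r n"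
  by (simp add: mon_degree_def lookup_add sum.distrib)

lemma mon_degree_peel:
  assumes "m \<in> monomials r" "i \<in> supp m"
  shows "mon_degree r (m - single i 1) < mon_degree r m"
proof -
  have "i < r"
    using assms by (auto simp: monomials_def)
  then have "mon_degree r (single i 1) = 1"
    by (simp add: mon_degree_def lookup_single when_def)
  then show ?thesis
    using mon_degree_add[of r "single i 1" "m - single i 1"] unfolding mon_peel[OF assms(2)] by simp
qed

lemma mspanD: "f \<in> mspan M \<Longrightarrow> m \<in> supp f \<Longrightarrow> m \<in> M"
  by (auto simp: mspan_def)

lemma mspan_mono: "M \<subseteq> N \<Longrightarrow> mspan M \<subseteq> mspan N"
  by (auto simp: mspan_def)

lemma mspan_0 [simp]: "0 \<in> mspan M"
  by (simp add: mspan_def)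

lemma mspan_1 [simp]: "1 \<in> mspan M \<longleftrightarrow> 0 \<in> M"
  by (simp add: mspan_def)

lemma mspan_add: "f \<in> mspan M \<Longrightarrow> g \<in> mspan M \<Longrightarrow> f + g \<in> mspan M"
  using keys_add[of f g] by (auto simp: mspan_def)

lemma supp_uminus [simp]: "supp (- f :: 'a \<Rightarrow>\<^sub>0 'k::ab_group_add) = supp f"
  by (auto simp: in_keys_iff)

lemma mspan_uminus [simp]: "- f \<in> mspan M \<longleftrightarrow> f \<in> mspan M"
  by (simp add: mspan_def)

lemma mspan_diff: "f \<in> mspan M \<Longrightarrow> g \<in> mspan M \<Longrightarrow> f - g \<in> mspan M"
  using mspan_add[of f M "- g"] by simp

lemma mspan_sum: "(\<And>x. x \<in> X \<Longrightarrow> f x \<in> mspan M) \<Longrightarrow> sum f X \<in> mspan M"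
  by (induction X rule: infinite_finite_induct) (auto intro: mspan_add)

lemma mspan_mult:
  assumes "f \<in> mspan M" "g \<in> mspan N" "\<And>m n. m \<in> M \<Longrightarrow> n \<in> N \<Longrightarrow> m + n \<in> K"
  shows "f * g \<in> mspan K"
  using keys_mult[of f g] assms by (fastforce simp: mspan_def)

lemma mspan_single [simp]: "single m c \<in> mspan M \<longleftrightarrow> c = 0 \<or> m \<in> M"
  by (simp add: mspan_def)

lemma mspan_mons_in_mult:
  "f \<in> mspan (mons_in B) \<Longrightarrow> g \<in> mspan (mons_in B) \<Longrightarrow> f * g \<in> mspan (mons_in B)"
  by (rule mspan_mult) auto

lemma mspan_mons_in_prod:
  "(\<And>x. x \<in> X \<Longrightarrow> f x \<in> mspan (mons_in B)) \<Longrightarrow> prod f X \<in> mspan (mons_in B)"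
  by (induction X rule: infinite_finite_induct) (auto intro: mspan_mons_in_mult)

lemma mspan_mons_in_power: "f \<in> mspan (mons_in B) \<Longrightarrow> f ^ n \<in> mspan (mons_in B)"
  by (induction n) (auto intro: mspan_mons_in_mult)

lemma poly_sum_terms: "(\<Sum>m\<in>supp f. single m (coef f m)) = f"
proof (rule poly_mapping_eqI)
  fix k
  have "coef (\<Sum>m\<in>supp f. single m (coef f m)) k = (\<Sum>m\<in>supp f. if m = k then coef f k else 0)"
    unfolding lookup_sum by (intro sum.cong) (auto simp: lookup_single when_def)
  also have "\<dots> = coef f k"
    by (simp add: in_keys_iff)
  finally show "coef (\<Sum>m\<in>supp f. single m (coef f m)) k = coef f k" .
qed

lemma coef_single_mult [simp]:
  "coef (single u c * f) (u + m) = c * coef (f :: 'k::field mpol) m"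
proof -
  have "coef (single u c * f) (u + m) = (\<Sum>l. (c when u = l) * (\<Sum>q. coef f q when u + m = l + q))"
    by (simp add: lookup_mult lookup_single)
  also have "\<dots> = (\<Sum>l. (c * (\<Sum>q. coef f q when u + m = u + q) when u = l))"
    by (intro Sum_any.cong) (auto simp: when_def)
  also have "\<dots> = c * coef f m"
    by simp
  finally show ?thesis .
qed

lemma supp_single_mult:
  "c \<noteq> 0 \<Longrightarrow> supp (single u c * (f :: 'k::field mpol)) = (+) u ` supp f"
proof (intro equalityI subsetI)
  fix k assume k: "k \<in> supp (single u c * f)" "c \<noteq> 0"
  then show "k \<in> (+) u ` supp f"
    using keys_mult[of "single u c" f] by auto
qed (auto simp: in_keys_iff)

section \<open>Ideals of the polynomial ring\<close>

lemma carrier_poly_ring: "carrier (poly_ring r) = mspan (monomials r)"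
  by (simp add: poly_ring_def mspan_def)

lemma poly_ring_simps [simp]:
  "monoid.mult (poly_ring r) = (*)" "one (poly_ring r) = 1"
  "zero (poly_ring r) = 0" "add (poly_ring r) = (+)"
  by (simp_all add: poly_ring_def)

text \<open>
  Ideals and primes of \<open>poly_ring r\<close> in terms of the ring operations of the type of polynomials, so that
  its algebraic identities and integrality can be used directly.
\<close>

definition is_ideal :: "nat \<Rightarrow> 'k::field mpol set \<Rightarrow> bool" where
  "is_ideal r I \<longleftrightarrow> I \<subseteq> mspan (monomials r) \<and> 0 \<in> I \<and> (\<forall>a\<in>I. \<forall>b\<in>I. a + b \<in> I) \<and>
     (\<forall>a\<in>I. \<forall>x\<in>mspan (monomials r). x * a \<in> I)"

definition is_prime :: "nat \<Rightarrow> 'k::field mpol set \<Rightarrow> bool" where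
  "is_prime r Q \<longleftrightarrow> is_ideal r Q \<and> 1 \<notin> Q \<and>
     (\<forall>a\<in>mspan (monomials r). \<forall>b\<in>mspan (monomials r). a * b \<in> Q \<longrightarrow> a \<in> Q \<or> b \<in> Q)"

lemma one_poly [simp]: "1 \<in> mspan (monomials r)"
  by (simp add: monomials_def)

lemma mspan_monomials_mult:
  "f \<in> mspan (monomials r) \<Longrightarrow> g \<in> mspan (monomials r) \<Longrightarrow> f * g \<in> mspan (monomials r)"
  unfolding monomials_eq by (rule mspan_mons_in_mult)

lemma mspan_monomials_power: "f \<in> mspan (monomials r) \<Longrightarrow> f ^ n \<in> mspan (monomials r)"
  unfolding monomials_eq by (rule mspan_mons_in_power)

lemma is_idealD:
  assumes "is_ideal r I"
  shows "\<And>a. a \<in> I \<Longrightarrow> a \<in> mspan (monomials r)" "0 \<in> I"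
    "\<And>a b. a \<in> I \<Longrightarrow> b \<in> I \<Longrightarrow> a + b \<in> I"
    "\<And>a x. a \<in> I \<Longrightarrow> x \<in> mspan (monomials r) \<Longrightarrow> x * a \<in> I"
    "\<And>a b. a \<in> I \<Longrightarrow> b \<in> I \<Longrightarrow> a - b \<in> I"
proof -
  show *: "\<And>a. a \<in> I \<Longrightarrow> a \<in> mspan (monomials r)" "0 \<in> I"
    "\<And>a b. a \<in> I \<Longrightarrow> b \<in> I \<Longrightarrow> a + b \<in> I"
    "\<And>a x. a \<in> I \<Longrightarrow> x \<in> mspan (monomials r) \<Longrightarrow> x * a \<in> I"
    using assms by (auto simp: is_ideal_def)
  show "\<And>a b. a \<in> I \<Longrightarrow> b \<in> I \<Longrightarrow> a - b \<in> I"
    using *(3)[of _ "- _"] *(4)[of _ "-1"] by (metis diff_conv_add_uminus mspan_uminus mult_minus1 one_poly)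
qed

lemma is_ideal_sum: "is_ideal r I \<Longrightarrow> (\<And>x. x \<in> X \<Longrightarrow> f x \<in> I) \<Longrightarrow> sum f X \<in> I"
  by (induction X rule: infinite_finite_induct) (auto simp: is_idealD)

lemma is_primeD:
  assumes "is_prime r Q"
  shows "is_ideal r Q" "1 \<notin> Q"
    "\<And>a b. a \<in> mspan (monomials r) \<Longrightarrow> b \<in> mspan (monomials r) \<Longrightarrow> a * b \<in> Q \<Longrightarrow> a \<in> Q \<or> b \<in> Q"
  using assms by (auto simp: is_prime_def)

lemma is_prime_power:
  assumes "is_prime r Q" "a \<in> mspan (monomials r)" "a ^ n \<in> Q"
  shows "a \<in> Q"
  using assms(3)
proof (induction n)
  case 0
  then show ?case using is_primeD(2)[OF assms(1)] by simp
next
  case (Suc n)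
  then show ?case
    using is_primeD(3)[OF assms(1,2) mspan_monomials_power[OF assms(2), of n]] by auto
qed

lemma is_prime_const:
  assumes "is_prime r Q" "single 0 c \<in> Q"
  shows "c = 0"
proof (rule ccontr)
  assume "c \<noteq> 0"
  then have "single 0 (inverse c) * single 0 c = (1 :: 'a mpol)"
    by (simp add: mult_single)
  moreover have "single 0 (inverse c) * single 0 c \<in> Q"
    by (rule is_idealD(4)[OF is_primeD(1)[OF assms(1)] assms(2)]) (simp add: monomials_def)
  ultimately show False
    using is_primeD(2)[OF assms(1)] by simp
qed

lemma ideal_poly_ring_iff: "ideal I (poly_ring r) \<longleftrightarrow> is_ideal r (I :: 'k::field mpol set)"
proof
  assume "ideal I (poly_ring r)"
  then interpret ideal I "poly_ring r" .
  show "is_ideal r I"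
    using a_subset additive_subgroup.zero_closed[OF is_additive_subgroup]
      additive_subgroup.a_closed[OF is_additive_subgroup] I_l_closed
    by (auto simp: is_ideal_def carrier_poly_ring)
next
  assume I: "is_ideal r I"
  interpret cring "poly_ring r :: 'k mpol ring" by (rule cring_poly_ring)
  show "ideal I (poly_ring r)"
  proof (rule idealI)
    show "subgroup I (add_monoid (poly_ring r))"
    proof (rule group.subgroupI[OF add.is_group])
      fix a assume a: "a \<in> I"
      have "\<ominus>\<^bsub>poly_ring r\<^esub> a = - a"
        using is_idealD[OF I] a by (intro minus_equality) (auto simp: carrier_poly_ring)
      then show "inv\<^bsub>add_monoid (poly_ring r)\<^esub> a \<in> I"
        using is_idealD(5)[OF I is_idealD(2)[OF I] a] by (simp add: a_inv_def)
    qed (use is_idealD[OF I] in \<open>auto simp: carrier_poly_ring\<close>)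
  qed (use is_idealD[OF I] in \<open>auto simp: carrier_poly_ring mult.commute local.ring_axioms\<close>)
qed

lemma primeideal_poly_ring_iff: "primeideal Q (poly_ring r) \<longleftrightarrow> is_prime r (Q :: 'k::field mpol set)"
proof
  assume "primeideal Q (poly_ring r)"
  then interpret primeideal Q "poly_ring r" .
  have "is_ideal r Q"
    using ideal_poly_ring_iff is_ideal by blast
  then show "is_prime r Q"
    using I_prime I_notcarr one_imp_carrier by (force simp: is_prime_def carrier_poly_ring)
next
  assume "is_prime r Q"
  then show "primeideal Q (poly_ring r)"
    by (intro primeidealI) (use one_poly in \<open>auto simp: ideal_poly_ring_iff is_prime_def cring_poly_ring carrier_poly_ring\<close>)
qed

lemma associated_primes_poly_ring:
  assumes "is_ideal r I"
  shows "Q \<in> associated_primes (poly_ring r) I \<longleftrightarrow> is_prime r (Q :: 'k::field mpol set) \<and>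
    (\<exists>f\<in>mspan (monomials r). Q = {a \<in> mspan (monomials r). a * f \<in> I})"
proof -
  interpret cring "poly_ring r :: 'k mpol ring" by (rule cring_poly_ring)
  interpret I: ideal I "poly_ring r" using assms by (simp add: ideal_poly_ring_iff)
  let ?M = "quotient_module (poly_ring r) I"
  have c: "carrier ?M = (+>\<^bsub>poly_ring r\<^esub>) I ` mspan (monomials r)"
    by (auto simp: quotient_module_def FactRing_def A_RCOSETS_defs a_r_coset_def carrier_poly_ring)
  have "a \<odot>\<^bsub>?M\<^esub> (I +>\<^bsub>poly_ring r\<^esub> f) = \<zero>\<^bsub>?M\<^esub> \<longleftrightarrow> a * f \<in> I"
    if "a \<in> mspan (monomials r)" "f \<in> mspan (monomials r)" for a f :: "'k mpol"
  proof -
    have "I +>\<^bsub>poly_ring r\<^esub> (a * f) = I \<longleftrightarrow> a * f \<in> I"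
      using I.a_rcos_const I.a_rcos_self[of "a * f"] mspan_monomials_mult[OF that]
      by (auto simp: carrier_poly_ring)
    then show ?thesis
      using that I.rcoset_mult_add[of a f]
      by (simp add: quotient_module_def FactRing_def carrier_poly_ring)
  qed
  then show ?thesis
    unfolding associated_primes_def module_associated_primes_def c primeideal_poly_ring_iff carrier_poly_ring
    by (auto 0 4 simp: conj_commute cong: conj_cong)
qed

section \<open>Krull dimension of a quotient\<close>

lemma (in ideal) rcos_eq_iff:
  assumes "a \<in> carrier R" "b \<in> carrier R"
  shows "I +> a = I +> b \<longleftrightarrow> a \<ominus> b \<in> I"
  using assms quotient_eq_iff_same_a_r_cos[OF is_ideal] by auto

text \<open>
  Taking preimages and images under the projection matches the primes of \<open>A/I\<close> with the primes of
  \<open>A\<close> that contain \<open>I\<close>, so that only chains in \<open>A\<close> itself need to be considered.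
\<close>

lemma krull_dim_Quot:
  fixes A (structure)
  assumes "cring A" "ideal I A"
  shows "krull_dim (A Quot I) = Sup {enat n |n. \<exists>C. (\<forall>i\<le>n. primeideal (C i) A) \<and>
    I \<subseteq> C 0 \<and> (\<forall>i<n. C i \<subset> C (Suc i))}"
proof -
  interpret cring A by fact
  interpret I: ideal I A by fact
  interpret Q: cring "A Quot I" using I.quotient_is_cring[OF assms(1)] .
  interpret h: ring_hom_cring A "A Quot I" "(+>) I" using I.rcos_ring_hom_cring[OF assms(1)] .
  have surj: "carrier (A Quot I) = (+>) I ` carrier A"
    by (auto simp: FactRing_def A_RCOSETS_defs a_r_coset_def)
  have "(\<exists>C. (\<forall>i\<le>n. primeideal (C i) (A Quot I)) \<and> (\<forall>i<n. C i \<subset> C (Suc i))) \<longleftrightarrow>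
     (\<exists>C. (\<forall>i\<le>n. primeideal (C i) A) \<and> I \<subseteq> C 0 \<and> (\<forall>i<n. C i \<subset> C (Suc i)))" for n
  proof (intro iffI; elim exE conjE)
    fix C assume C: "\<forall>i\<le>n. primeideal (C i) (A Quot I)" "\<forall>i<n. C i \<subset> C (Suc i)"
    \<comment> \<open>The inclusions of the preimages are strict because the projection is surjective.\<close>
    define D where "D i = {a \<in> carrier A. I +> a \<in> C i}" for i
    have pr: "primeideal (D i) A" if "i \<le> n" for i
    proof (rule primeidealI)
      interpret Ci: primeideal "C i" "A Quot I" using C that by auto
      show "ideal (D i) A"
        unfolding D_def by (rule h.ring.ideal_vimage) (rule Ci.is_ideal)
      show "carrier A \<noteq> D i"
        proof
        assume "carrier A = D i"
        then have "\<one> \<in> D i"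
          using one_closed by blast
        then have "I +> \<one> \<in> C i"
          by (simp add: D_def)
        then show False
          using Ci.I_notcarr Ci.one_imp_carrier by simp
      qed
      show "a \<in> D i \<or> b \<in> D i" if "a \<in> carrier A" "b \<in> carrier A" "a \<otimes> b \<in> D i" for a b
        using that Ci.I_prime[of "I +> a" "I +> b"] by (auto simp: D_def)
    qed (rule assms)
    have st: "D i \<subset> D (Suc i)" if i: "i < n" for i
    proof -
      obtain x where x: "x \<in> C (Suc i)" "x \<notin> C i"
        using C(2) i by blast
      interpret Ci: primeideal "C (Suc i)" "A Quot I" using C i by auto
      have "x \<in> carrier (A Quot I)"
        using x Ci.a_subset by auto
      then obtain a where "a \<in> carrier A" "x = I +> a"
        unfolding surj by auto
      then have "a \<in> D (Suc i)" "a \<notin> D i"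
        using x by (simp_all add: D_def)
      moreover have "D i \<subseteq> D (Suc i)"
        using C(2) i by (auto simp: D_def)
      ultimately show ?thesis
        by blast
    qed
    have I0: "I \<subseteq> D 0"
    proof
      fix a assume a: "a \<in> I"
      interpret C0: primeideal "C 0" "A Quot I" using C by auto
      have "I +> a = \<zero>\<^bsub>A Quot I\<^esub>"
        unfolding FactRing_def using I.a_rcos_const[OF a] by simp
      moreover have "a \<in> carrier A"
        using a I.a_subset by blast
      ultimately show "a \<in> D 0"
        using C0.zero_closed by (simp only: D_def mem_Collect_eq)
    qed
    show "\<exists>C. (\<forall>i\<le>n. primeideal (C i) A) \<and> I \<subseteq> C 0 \<and> (\<forall>i<n. C i \<subset> C (Suc i))"
      by (intro exI[of _ D] conjI allI impI pr st I0)
  next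
    fix C assume C: "\<forall>i\<le>n. primeideal (C i) A" "I \<subseteq> C 0" "\<forall>i<n. C i \<subset> C (Suc i)"
    have IC: "I \<subseteq> C i" if "i \<le> n" for i
      using that
    proof (induction i)
      case (Suc i)
      then show ?case
        using C(3) by (meson Suc_le_lessD Suc_leD psubset_imp_subset subset_trans)
    qed (rule C)
    \<comment> \<open>An ideal above \<open>I\<close> is a union of cosets of \<open>I\<close>, so it can be recovered from its image.\<close>
    have mem: "I +> a \<in> (+>) I ` C i \<longleftrightarrow> a \<in> C i" if i: "i \<le> n" and a: "a \<in> carrier A" for i a
    proof
      interpret Ci: primeideal "C i" A using C i by auto
      assume "I +> a \<in> (+>) I ` C i"
      then obtain b where b: "b \<in> C i" "I +> a = I +> b" by auto
      then have bc: "b \<in> carrier A" and "a \<ominus> b \<in> C i"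
        using Ci.a_Hcarr I.rcos_eq_iff[OF a] IC[OF i] by auto
      then have "(a \<ominus> b) \<oplus> b \<in> C i"
        using b Ci.a_closed by auto
      then show "a \<in> C i"
        using a bc by (simp add: a_minus_def a_assoc l_neg)
    qed (rule imageI)
    have pr: "primeideal ((+>) I ` C i) (A Quot I)" if i: "i \<le> n" for i
    proof (rule primeidealI)
      interpret Ci: primeideal "C i" A using C i by auto
      show "ideal ((+>) I ` C i) (A Quot I)"
        by (rule ring_ideal_imp_quot_ideal[OF assms(2) Ci.is_ideal])
      have "\<one> \<notin> C i"
        using Ci.I_notcarr Ci.one_imp_carrier by auto
      then have "I +> \<one> \<notin> (+>) I ` C i"
        using mem[OF i one_closed] by metis
      then show "carrier (A Quot I) \<noteq> (+>) I ` C i"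
        by (metis Q.one_closed h.hom_one)
      show "a \<in> (+>) I ` C i \<or> b \<in> (+>) I ` C i" if ab: "a \<in> carrier (A Quot I)"
        "b \<in> carrier (A Quot I)" "a \<otimes>\<^bsub>A Quot I\<^esub> b \<in> (+>) I ` C i" for a b
      proof -
        obtain x y where xy: "x \<in> carrier A" "y \<in> carrier A" "a = I +> x" "b = I +> y"
          using ab(1,2) unfolding surj by auto
        then have "I +> (x \<otimes> y) \<in> (+>) I ` C i"
          using ab(3) by simp
        then have "x \<otimes> y \<in> C i"
          using mem[OF i, of "x \<otimes> y"] xy(1,2) by blast
        then show ?thesis
          using Ci.I_prime xy by auto
      qed
    qed (rule Q.cring_axioms)
    have st: "(+>) I ` C i \<subset> (+>) I ` C (Suc i)" if i: "i < n" for i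
    proof -
      obtain x where x: "x \<in> C (Suc i)" "x \<notin> C i"
        using C(3) i by blast
      interpret Ci: primeideal "C (Suc i)" A using C i by auto
      have "I +> x \<notin> (+>) I ` C i"
        using mem[of i x] x i Ci.a_Hcarr[OF x(1)] by simp
      moreover have "(+>) I ` C i \<subseteq> (+>) I ` C (Suc i)"
        using C(3) i by (intro image_mono) blast
      moreover have "I +> x \<in> (+>) I ` C (Suc i)"
        using x(1) by (rule imageI)
      ultimately show ?thesis
        by blast
    qed
    show "\<exists>C. (\<forall>i\<le>n. primeideal (C i) (A Quot I)) \<and> (\<forall>i<n. C i \<subset> C (Suc i))"
      by (intro exI[of _ "\<lambda>i. (+>) I ` C i"] conjI allI impI pr st)
  qed
  then show ?thesis
    by (simp add: krull_dim_def)
qed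

definition prime_chain_above :: "nat \<Rightarrow> 'k::field mpol set \<Rightarrow> nat \<Rightarrow> bool" where
  "prime_chain_above r I n \<longleftrightarrow>
     (\<exists>C. (\<forall>i\<le>n. is_prime r (C i)) \<and> I \<subseteq> C 0 \<and> (\<forall>i<n. C i \<subset> C (Suc i)))"

lemma krull_dim_poly_Quot:
  assumes "is_ideal r I"
  shows "krull_dim (poly_ring r Quot I) = Sup {enat n |n. prime_chain_above r I n}"
  using krull_dim_Quot[OF cring_poly_ring, of I r] assms
  by (simp add: ideal_poly_ring_iff primeideal_poly_ring_iff prime_chain_above_def)

section \<open>Associated primes of monomial ideals\<close>

definition part :: "mon set \<Rightarrow> 'k::field mpol \<Rightarrow> 'k mpol" where
  "part M f = (\<Sum>m\<in>supp f \<inter> M. single m (coef f m))"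

lemma coef_part: "coef (part M f) m = (if m \<in> M then coef f m else 0)"
proof -
  have "coef (part M f) m = (\<Sum>k\<in>supp f \<inter> M. if k = m then coef f m else 0)"
    unfolding part_def lookup_sum by (intro sum.cong) (auto simp: lookup_single when_def)
  also have "\<dots> = (if m \<in> M then coef f m else 0)"
    by (simp add: in_keys_iff)
  finally show ?thesis .
qed

lemma supp_part: "supp (part M f) = supp f \<inter> M"
  by (auto simp: in_keys_iff coef_part split: if_splits)

lemma supp_diff_part: "supp (f - part M f) = supp f - M"
  by (auto simp: in_keys_iff lookup_minus coef_part split: if_splits)

definition upclosed :: "nat \<Rightarrow> mon set \<Rightarrow> bool" where
  "upclosed r U \<longleftrightarrow> U \<subseteq> monomials r \<and> (\<forall>u\<in>U. \<forall>m\<in>monomials r. m + u \<in> U)"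

lemma upclosedD:
  assumes "upclosed r U"
  shows "\<And>u. u \<in> U \<Longrightarrow> u \<in> monomials r"
    "\<And>u m. u \<in> U \<Longrightarrow> m \<in> monomials r \<Longrightarrow> m + u \<in> U"
  using assms by (auto simp: upclosed_def)

lemma upclosed_le:
  assumes "upclosed r U" "u \<in> U" "v \<in> monomials r" "\<And>i. coef u i \<le> coef v i"
  shows "v \<in> U"
proof -
  have "v - u \<in> monomials r"
    using assms(3) by (rule monomials_diff)
  then have "(v - u) + u \<in> U"
    using upclosedD(2)[OF assms(1,2)] by blast
  then show ?thesis
    using mon_diff_add[OF assms(4)] by simp
qed

lemma is_ideal_mspan:
  assumes "upclosed r U"
  shows "is_ideal r (mspan U :: 'k::field mpol set)"
  unfolding is_ideal_def
proof (intro conjI ballI)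
  show "mspan U \<subseteq> (mspan (monomials r) :: 'k mpol set)"
    using assms by (intro mspan_mono) (auto simp: upclosed_def)
  show "x * a \<in> mspan U" if "a \<in> mspan U" "x \<in> mspan (monomials r)" for a x :: "'k mpol"
    using that(2,1) by (rule mspan_mult) (use assms in \<open>auto simp: upclosed_def\<close>)
qed (auto intro: mspan_add)

definition var_ideal :: "nat \<Rightarrow> nat set \<Rightarrow> 'k::field mpol set" where
  "var_ideal r A = mspan {m \<in> monomials r. supp m \<inter> A \<noteq> {}}"

lemma var_in_polys: "i < r \<Longrightarrow> var i \<in> mspan (monomials r)"
  by (simp add: var_def monomials_def)

lemma var_in_var_ideal_iff: "i < r \<Longrightarrow> var i \<in> var_ideal r A \<longleftrightarrow> i \<in> A"
  by (simp add: var_ideal_def var_def monomials_def)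

lemma is_ideal_var_ideal: "is_ideal r (var_ideal r A)"
  unfolding var_ideal_def
  by (rule is_ideal_mspan) (auto simp: upclosed_def supp_mon_add monomials_eq)

text \<open>
  The quotient by \<open>A\<close> is the polynomial ring in the other variables, a domain: dropping all
  monomials that meet \<open>A\<close> reduces the claim to two polynomials in those variables.
\<close>

lemma is_prime_var_ideal: "is_prime r (var_ideal r A :: 'k::field mpol set)"
  unfolding is_prime_def
proof (intro conjI ballI impI)
  show I: "is_ideal r (var_ideal r A :: 'k mpol set)"
    by (rule is_ideal_var_ideal)
  show "1 \<notin> (var_ideal r A :: 'k mpol set)"
    by (simp add: var_ideal_def)
  fix a b :: "'k mpol"
  assume ab: "a \<in> mspan (monomials r)" "b \<in> mspan (monomials r)" "a * b \<in> var_ideal r A"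
  let ?N = "mons_in (- A)"
  have diff: "f - part ?N f \<in> var_ideal r A" if "f \<in> mspan (monomials r)" for f :: "'k mpol"
    using that by (auto simp: var_ideal_def mspan_def supp_diff_part mons_in_def)
  have part: "part ?N f \<in> mspan (monomials r)" if "f \<in> mspan (monomials r)" for f :: "'k mpol"
    using that by (auto simp: mspan_def supp_part)
  have "part ?N a * part ?N b = a * b - (a * (b - part ?N b) + part ?N b * (a - part ?N a))"
    by (simp add: algebra_simps)
  moreover have "\<dots> \<in> var_ideal r A"
    by (rule is_idealD(5)[OF I ab(3) is_idealD(3)[OF I is_idealD(4)[OF I diff[OF ab(2)] ab(1)]
      is_idealD(4)[OF I diff[OF ab(1)] part[OF ab(2)]]]])
  ultimately have "part ?N a * part ?N b \<in> var_ideal r A"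
    by simp
  moreover have "part ?N a * part ?N b \<in> mspan ?N"
    by (rule mspan_mons_in_mult) (auto simp: mspan_def supp_part)
  ultimately have "supp (part ?N a * part ?N b) = {}"
    unfolding var_ideal_def mspan_def mons_in_def by blast
  then have "part ?N a = 0 \<or> part ?N b = 0"
    by simp
  then show "a \<in> var_ideal r A \<or> b \<in> var_ideal r A"
  proof
    assume "part ?N a = 0"
    then show ?thesis
      using diff[OF ab(1)] by simp
  next
    assume "part ?N b = 0"
    then show ?thesis
      using diff[OF ab(2)] by simp
  qed
qed

text \<open>
  The monomial \<open>w\<close> witnesses that the variables in \<open>A\<close> generate an associated prime of the monomial
  ideal with set of monomials \<open>U\<close>: the condition says that this prime is the annihilator of the
  class of \<open>w\<close>.
\<close>

definition ann_witness :: "nat \<Rightarrow> mon set \<Rightarrow> nat set \<Rightarrow> mon \<Rightarrow> bool" where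
  "ann_witness r U A w \<longleftrightarrow>
     w \<in> monomials r \<and> (\<forall>m\<in>monomials r. m + w \<in> U \<longleftrightarrow> supp m \<inter> A \<noteq> {})"

lemma associated_of_ann_witness:
  assumes "upclosed r U" "ann_witness r U A w"
  shows "var_ideal r A \<in> associated_primes (poly_ring r) (mspan U :: 'k::field mpol set)"
proof -
  have "(var_ideal r A :: 'k mpol set) = {a \<in> mspan (monomials r). a * single w 1 \<in> mspan U}"
  proof -
    have "a \<in> var_ideal r A \<longleftrightarrow> a * single w 1 \<in> mspan U" if "a \<in> mspan (monomials r)" for a :: "'k mpol"
    proof -
      have "a \<in> var_ideal r A \<longleftrightarrow> (\<forall>m\<in>supp a. supp m \<inter> A \<noteq> {})"
        using that by (auto simp: var_ideal_def mspan_def)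
      also have "\<dots> \<longleftrightarrow> (\<forall>m\<in>supp a. m + w \<in> U)"
        using that assms(2) by (intro ball_cong) (auto simp: ann_witness_def mspan_def)
      also have "\<dots> \<longleftrightarrow> a * single w 1 \<in> mspan U"
        by (simp add: mspan_def mult.commute[of a] supp_single_mult image_subset_iff add.commute[of w])
      finally show ?thesis .
    qed
    moreover have "var_ideal r A \<subseteq> (mspan (monomials r) :: 'k mpol set)"
      unfolding var_ideal_def by (rule mspan_mono) auto
    ultimately show ?thesis
      by blast
  qed
  moreover have "single w 1 \<in> (mspan (monomials r) :: 'k mpol set)"
    using assms(2) by (simp add: ann_witness_def)
  ultimately show ?thesis
    unfolding associated_primes_poly_ring[OF is_ideal_mspan[OF assms(1)]]
    using is_prime_var_ideal by blast
qed

text \<open>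
  Any linear order compatible with multiplication separates the leading term of a product; here it is
  the linear order of the type of exponent vectors.
\<close>

lemma coef_mult_Max:
  fixes f g :: "'k::field mpol"
  assumes "f \<noteq> 0" "g \<noteq> 0"
  shows "coef (f * g) (Max (supp f) + Max (supp g)) = coef f (Max (supp f)) * coef g (Max (supp g))"
proof -
  let ?a = "Max (supp f)" and ?b = "Max (supp g)"
  have "coef (f * g) (?a + ?b) = coef ((\<Sum>m\<in>supp f. single m (coef f m)) * g) (?a + ?b)"
    by (simp add: poly_sum_terms)
  also have "\<dots> = (\<Sum>m\<in>supp f. coef (single m (coef f m) * g) (?a + ?b))"
    by (simp add: sum_distrib_right lookup_sum)
  also have "\<dots> = (\<Sum>m\<in>supp f. if m = ?a then coef f ?a * coef g ?b else 0)"
  proof (intro sum.cong refl)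
    fix m assume m: "m \<in> supp f"
    show "coef (single m (coef f m) * g) (?a + ?b) = (if m = ?a then coef f ?a * coef g ?b else 0)"
    proof (cases "m = ?a")
      case False
      have "?a + ?b \<notin> supp (single m (coef f m) * g)"
      proof
        assume "?a + ?b \<in> supp (single m (coef f m) * g)"
        then obtain n where n: "n \<in> supp g" "?a + ?b = m + n"
          using keys_mult[of "single m (coef f m)" g] by (auto split: if_splits)
        have "m < ?a"
          using False m by (simp add: order.not_eq_order_implies_strict)
        moreover have "n \<le> ?b"
          using n by simp
        ultimately have "m + n < ?a + ?b"
          by (rule add_less_le_mono)
        then show False
          using n by simp
      qed
      then show ?thesis
        using False by (simp add: in_keys_iff)
    qed simp
  qed
  also have "\<dots> = coef f ?a * coef g ?b"
    using assms(1) by (simp add: Max_in)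
  finally show ?thesis .
qed

lemma var_ideal_subset:
  assumes I: "is_ideal r I" and A: "\<And>i. i \<in> A \<Longrightarrow> i < r \<Longrightarrow> var i \<in> I"
  shows "var_ideal r A \<subseteq> (I :: 'k::field mpol set)"
proof
  fix g :: "'k mpol" assume g: "g \<in> var_ideal r A"
  have "(\<Sum>m\<in>supp g. single m (coef g m)) \<in> I"
  proof (rule is_ideal_sum[OF I])
    fix m assume "m \<in> supp g"
    then have m: "m \<in> monomials r" "supp m \<inter> A \<noteq> {}"
      using g by (auto simp: var_ideal_def mspan_def)
    then obtain i where i: "i \<in> supp m" "i \<in> A"
      by auto
    have "var i \<in> I"
      using A i m(1) by (auto simp: monomials_def)
    moreover have "single (m - single i 1) (coef g m) \<in> mspan (monomials r)"
      using monomials_diff[OF m(1)] by simp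
    ultimately have "single (m - single i 1) (coef g m) * var i \<in> I"
      by (rule is_idealD(4)[OF I])
    then show "single m (coef g m) \<in> I"
      using mon_peel[OF i(1)] by (simp add: var_def mult_single add.commute)
  qed
  then show "g \<in> I"
    by (simp add: poly_sum_terms)
qed

lemma prime_monomial:
  assumes "is_prime r Q" "m \<in> monomials r" "single m 1 \<in> (Q :: 'k::field mpol set)"
  shows "\<exists>i\<in>supp m. var i \<in> Q"
  using assms(2,3)
proof (induction "mon_degree r m" arbitrary: m rule: less_induct)
  case less
  have "m \<noteq> 0"
    using less.prems is_primeD(2)[OF assms(1)] by auto
  then obtain i where i: "i \<in> supp m"
    by (metis keys_eq_empty ex_in_conv)
  let ?n = "m - single i 1"
  have ir: "i < r"
    using i less.prems by (auto simp: monomials_def)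
  have n: "?n \<in> monomials r"
    using less.prems(1) by (rule monomials_diff)
  have sub: "supp ?n \<subseteq> supp m"
    by (rule supp_mon_diff)
  have "var i * single ?n 1 = (single m 1 :: 'k mpol)"
    unfolding var_def mult_single using mon_peel[OF i] by simp
  then have "var i \<in> Q \<or> single ?n 1 \<in> Q"
    using is_primeD(3)[OF assms(1), of "var i" "single ?n 1"] less.prems n var_in_polys[OF ir] by simp
  moreover have "mon_degree r ?n < mon_degree r m"
    by (rule mon_degree_peel[OF less.prems(1) i])
  ultimately show ?case
    using less.hyps[OF _ n] i sub by blast
qed

text \<open>
  Let \<open>Q\<close> be the annihilator of \<open>f\<close> modulo the ideal, where \<open>f\<close> has as few terms as possible, and
  let \<open>g \<in> Q\<close>. If the leading monomial of \<open>g\<close> were not in \<open>Q\<close>, then multiplying \<open>f\<close> by it would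
  not change the annihilator, but it would move the leading monomial of \<open>f\<close> into the ideal and
  leave a representative with fewer terms. So \<open>Q\<close> contains the leading monomial of each of its
  elements, and then all monomials of each of its elements. The annihilator of one of the terms of
  \<open>f\<close> is already \<open>Q\<close>: otherwise, by primality, the product of monomials outside \<open>Q\<close> that kill the
  individual terms would kill \<open>f\<close>.
\<close>

lemma associated_prime_of_monomial_ideal:
  assumes U: "upclosed r U"
    and Q: "Q \<in> associated_primes (poly_ring r) (mspan U :: 'k::field mpol set)"
  shows "\<exists>A\<subseteq>{..<r}. \<exists>w. ann_witness r U A w \<and> Q = var_ideal r A"
proof -
  let ?R = "mspan (monomials r) :: 'k mpol set"
  note I = is_ideal_mspan[OF U, where 'k = 'k]
  have Qp: "is_prime r Q" and ex: "\<exists>f\<in>?R. Q = {a \<in> ?R. a * f \<in> mspan U}"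
    using Q by (auto simp: associated_primes_poly_ring[OF I])
  note QI = is_primeD(1)[OF Qp]
  define F where "F = {f \<in> ?R. Q = {a \<in> ?R. a * f \<in> mspan U}}"
  have drop: "part (- U) f \<in> F" if f: "f \<in> F" for f
  proof -
    have "f - part (- U) f \<in> mspan U"
      by (auto simp: mspan_def supp_diff_part)
    then have d: "a * (f - part (- U) f) \<in> mspan U" if "a \<in> ?R" for a
      using is_idealD(4)[OF I] that by blast
    have "a * f \<in> mspan U \<longleftrightarrow> a * part (- U) f \<in> mspan U" if "a \<in> ?R" for a
      using is_idealD(3)[OF I, OF _ d[OF that], of "a * part (- U) f"]
        is_idealD(5)[OF I, OF _ d[OF that], of "a * f"] by (auto simp: algebra_simps)
    moreover have "part (- U) f \<in> ?R"
      using f by (auto simp: F_def mspan_def supp_part)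
    ultimately show ?thesis
      using f unfolding F_def by blast
  qed
  obtain f where f: "f \<in> F" and min: "\<And>g. g \<in> F \<Longrightarrow> card (supp f) \<le> card (supp g)"
  proof -
    obtain f0 where "f0 \<in> F"
      using ex by (auto simp: F_def)
    then show ?thesis
      using ex_has_least_nat[of "\<lambda>f. f \<in> F" f0 "\<lambda>f. card (supp f)"] that by blast
  qed
  have fR: "f \<in> ?R" and fQ: "a \<in> Q \<longleftrightarrow> a * f \<in> mspan U" if "a \<in> ?R" for a
    using f that by (auto simp: F_def)
  have f0: "f \<noteq> 0"
    using fQ[of 1] is_primeD(2)[OF Qp] by auto
  have lead: "single (Max (supp g)) 1 \<in> Q" if g: "g \<in> Q" "g \<noteq> 0" for g
  proof (rule ccontr)
    assume n: "single (Max (supp g)) 1 \<notin> Q"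
    let ?t = "single (Max (supp g)) 1 :: 'k mpol"
    have gR: "g \<in> ?R"
      using is_idealD(1)[OF QI g(1)] .
    have tR: "?t \<in> ?R"
      using gR g(2) by (auto simp: mspan_def)
    have "?t * f \<in> F"
    proof -
      have "a \<in> Q \<longleftrightarrow> a * (?t * f) \<in> mspan U" if a: "a \<in> ?R" for a
      proof -
        have "a \<in> Q \<longleftrightarrow> ?t * a \<in> Q"
          using is_primeD(3)[OF Qp tR a] n is_idealD(4)[OF QI _ tR, of a] by blast
        also have "\<dots> \<longleftrightarrow> ?t * a * f \<in> mspan U"
          by (rule fQ) (rule mspan_monomials_mult[OF tR a])
        also have "?t * a * f = a * (?t * f)"
          by (simp only: mult.assoc mult.left_commute[of ?t a f])
        finally show ?thesis .
      qed
      then show ?thesis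
        unfolding F_def using is_idealD(1)[OF QI] mspan_monomials_mult[OF tR fR[OF one_poly]] by blast
    qed
    then have "card (supp f) \<le> card (supp (part (- U) (?t * f)))"
      using min drop by blast
    also have "\<dots> < card (supp (?t * f))"
    proof (rule psubset_card_mono)
      have "Max (supp g) + Max (supp f) \<in> supp (g * f)"
        using coef_mult_Max[OF g(2) f0] Max_in[of "supp g"] Max_in[of "supp f"] g(2) f0
        by (simp add: in_keys_iff)
      moreover have "g * f \<in> mspan U"
        using fQ gR g by blast
      ultimately have "Max (supp g) + Max (supp f) \<in> U"
        by (auto simp: mspan_def)
      moreover have "Max (supp g) + Max (supp f) \<in> supp (?t * f)"
        using f0 by (simp add: supp_single_mult)
      ultimately show "supp (part (- U) (?t * f)) \<subset> supp (?t * f)"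
        by (auto simp: supp_part)
    qed simp
    also have "\<dots> = card (supp f)"
      by (simp add: supp_single_mult card_image)
    finally show False
      by simp
  qed
  have terms: "\<forall>m\<in>supp g. single m 1 \<in> Q" if "g \<in> Q" for g
    using that
  proof (induction "card (supp g)" arbitrary: g rule: less_induct)
    case less
    show ?case
    proof (cases "g = 0")
      case False
      let ?m = "Max (supp g)" and ?c = "coef g (Max (supp g))"
      let ?h = "g - single ?m ?c"
      have m: "?m \<in> supp g"
        using False by simp
      have "single ?m ?c = single 0 ?c * single ?m 1"
        by (simp add: mult_single)
      then have "single ?m ?c \<in> Q"
        using is_idealD(4)[OF QI lead[OF less.prems False], of "single 0 ?c"] by simp
      then have hQ: "?h \<in> Q"
        using is_idealD(5)[OF QI less.prems] by blast
      have s: "supp ?h = supp g - {?m}"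
        by (auto simp: in_keys_iff lookup_minus lookup_single when_def split: if_splits)
      then have "card (supp ?h) < card (supp g)"
        using m card_Diff1_less[of "supp g"] by simp
      then have "\<forall>m\<in>supp ?h. single m 1 \<in> Q"
        using less.hyps hQ by blast
      then show ?thesis
        using s lead[OF less.prems False] by auto
    qed simp
  qed
  define A where "A = {i. i < r \<and> var i \<in> Q}"
  have VQ: "var_ideal r A \<subseteq> Q"
    using var_ideal_subset[OF QI, of A] by (simp add: A_def)
  have mon: "single m 1 \<in> Q \<longleftrightarrow> supp m \<inter> A \<noteq> {}" if m: "m \<in> monomials r" for m
  proof
    assume "single m 1 \<in> Q"
    then show "supp m \<inter> A \<noteq> {}"
      using prime_monomial[OF Qp m] m by (auto simp: A_def monomials_def)
  next
    assume "supp m \<inter> A \<noteq> {}"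
    then have "single m 1 \<in> (var_ideal r A :: 'k mpol set)"
      using m by (simp add: var_ideal_def)
    then show "single m 1 \<in> Q"
      using VQ by blast
  qed
  have "Q \<subseteq> var_ideal r A"
  proof
    fix g assume g: "g \<in> Q"
    then show "g \<in> var_ideal r A"
      using terms[OF g] mon is_idealD(1)[OF QI g] by (auto simp: var_ideal_def mspan_def)
  qed
  then have QA: "Q = var_ideal r A"
    using VQ by blast
  have "\<exists>w\<in>supp f. ann_witness r U A w"
  proof (rule ccontr)
    assume no: "\<not> (\<exists>w\<in>supp f. ann_witness r U A w)"
    have up: "m + w \<in> U" if "w \<in> supp f" "m \<in> monomials r" "supp m \<inter> A \<noteq> {}" for w m
    proof -
      have "single m 1 * f \<in> mspan U"
        using fQ[of "single m 1"] mon that by auto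
      moreover have "m + w \<in> supp (single m 1 * f)"
        using that by (simp add: supp_single_mult)
      ultimately show ?thesis
        by (auto simp: mspan_def)
    qed
    have "\<exists>m\<in>monomials r. supp m \<inter> A = {} \<and> m + w \<in> U" if "w \<in> supp f" for w
      using no up that fR[of 1] unfolding ann_witness_def mspan_def by fastforce
    then obtain M where M: "\<And>w. w \<in> supp f \<Longrightarrow> M w \<in> monomials r \<and> supp (M w) \<inter> A = {} \<and> M w + w \<in> U"
      by metis
    let ?S = "\<Sum>w\<in>supp f. M w"
    have in_sum: "sum M X \<in> mons_in ({..<r} - A)" if "X \<subseteq> supp f" for X
      using that M by (intro mons_in_sum) (fastforce simp: mons_in_def monomials_def)
    have "?S + w \<in> U" if w: "w \<in> supp f" for w
    proof -
      have "?S = M w + sum M (supp f - {w})"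
        using w by (simp add: sum.remove)
      moreover have "sum M (supp f - {w}) \<in> monomials r"
        using in_sum[of "supp f - {w}"] mons_in_mono[of "{..<r} - A" "{..<r}"] by (auto simp: monomials_eq)
      moreover from this have "sum M (supp f - {w}) + (M w + w) \<in> U"
        using upclosedD(2)[OF U, of "M w + w"] M[OF w] by blast
      ultimately show ?thesis
        by (simp add: ac_simps)
    qed
    then have "single ?S 1 * f \<in> mspan U"
      by (auto simp: mspan_def supp_single_mult)
    moreover have S: "?S \<in> monomials r" "supp ?S \<inter> A = {}"
      using in_sum[of "supp f"] by (auto simp: mons_in_def monomials_def)
    ultimately have "single ?S 1 \<in> Q"
      using fQ[of "single ?S 1"] by simp
    then show False
      using mon S by blast
  qed
  then obtain w where "ann_witness r U A w"
    by blast
  moreover have "A \<subseteq> {..<r}"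
    unfolding A_def by blast
  ultimately show ?thesis
    using QA by blast
qed

text \<open>
  Say that \<open>m\<close> kills \<open>u\<close> if \<open>m + u \<in> U\<close>. Choose a maximal set \<open>B \<supseteq> B0\<close> such that some multiple of
  \<open>u\<close> is killed by no monomial in \<open>B\<close>. By maximality, after multiplication by a monomial in \<open>B\<close>, a
  power of each variable outside \<open>B\<close> kills this multiple. Hence its multiples by monomials in the
  variables outside \<open>B\<close> that are still killed by no monomial in \<open>B\<close> are finite in number, and one of
  largest degree yields the witness. The set \<open>B0\<close> serves to find associated primes that avoid a given
  variable.
\<close>

lemma exists_ann_witness:
  assumes U: "upclosed r U" and u: "u \<in> monomials r" and B0: "B0 \<subseteq> {..<r}"
    and avoid: "\<And>m. m \<in> mons_in B0 \<Longrightarrow> m + u \<notin> U"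
  shows "\<exists>B t. B0 \<subseteq> B \<and> B \<subseteq> {..<r} \<and> t \<in> monomials r \<and> ann_witness r U ({..<r} - B) (t + u)"
proof -
  define av where "av B v \<longleftrightarrow> (\<forall>m\<in>mons_in B. m + v \<notin> U)" for B v
  define Bs where "Bs = {B. B0 \<subseteq> B \<and> B \<subseteq> {..<r} \<and> (\<exists>t\<in>monomials r. av B (t + u))}"
  have "av B0 (0 + u)"
    using avoid by (simp add: av_def)
  then have "B0 \<in> Bs"
    using B0 zero_in_monomials[of r] unfolding Bs_def by blast
  moreover have "\<forall>B. B \<in> Bs \<longrightarrow> card B < Suc r"
    using card_mono[of "{..<r}"] by (auto simp: Bs_def less_Suc_eq_le)
  ultimately have "\<exists>B. B \<in> Bs \<and> (\<forall>B'. B' \<in> Bs \<longrightarrow> card B' \<le> card B)"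
    by (rule Lattices_Big.ex_has_greatest_nat)
  then obtain B where B: "B \<in> Bs" and Bmax: "\<And>B'. B' \<in> Bs \<Longrightarrow> card B' \<le> card B"
    by auto
  have Br: "B0 \<subseteq> B" "B \<subseteq> {..<r}"
    using B by (auto simp: Bs_def)
  have finB: "finite B"
    using Br(2) finite_subset by blast
  obtain t1 where t1: "t1 \<in> monomials r" "av B (t1 + u)"
    using B by (auto simp: Bs_def)
  let ?C = "{..<r} - B"
  have monB: "mons_in B \<subseteq> monomials r"
    unfolding monomials_eq using Br by (intro mons_in_mono)
  have sumB: "sum b X \<in> mons_in B" if "\<And>l. l \<in> X \<Longrightarrow> b l \<in> mons_in B" for b :: "nat \<Rightarrow> mon" and X
    using that by (rule mons_in_sum)
  have avB: "av B (b + v)" if "b \<in> mons_in B" "av B v" for b v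
    using that unfolding av_def by (metis add.assoc mons_in_add_iff)
  have "\<exists>b\<in>mons_in B. \<exists>e. b + single l e + (t1 + u) \<in> U" if l: "l \<in> ?C" for l
  proof -
    have "insert l B \<notin> Bs"
      using Bmax[of "insert l B"] l finB by auto
    then have "\<not> av (insert l B) (t1 + u)"
      using l Br t1 by (auto simp: Bs_def)
    then obtain m where m: "m \<in> mons_in (insert l B)" "m + (t1 + u) \<in> U"
      by (auto simp: av_def)
    let ?b = "m - single l (coef m l)"
    have "?b + single l (coef m l) = m"
      by (rule mon_diff_add) (simp add: lookup_single when_def)
    moreover have "?b \<in> mons_in B"
    proof -
      have "supp ?b \<subseteq> supp m - {l}"
        by (auto simp: in_keys_iff lookup_minus lookup_single when_def split: if_splits)
      then show ?thesis
        using m(1) by (auto simp: mons_in_def)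
    qed
    ultimately show ?thesis
      using m(2) by metis
  qed
  then obtain b e where b: "\<And>l. l \<in> ?C \<Longrightarrow> b l \<in> mons_in B"
    and be: "\<And>l. l \<in> ?C \<Longrightarrow> b l + single l (e l) + (t1 + u) \<in> U"
    by metis
  \<comment> \<open>After multiplication by all the \<open>b l\<close>, pure powers of the variables outside \<open>B\<close> kill the monomial.\<close>
  define t2 where "t2 = (\<Sum>l\<in>?C. b l) + t1"
  have t2: "t2 \<in> monomials r" "av B (t2 + u)"
    using t1 sumB[of ?C b] b monB avB[of "\<Sum>l\<in>?C. b l" "t1 + u"]
    by (auto simp: t2_def monomials_eq add.assoc)
  have upB: "sum b' ?C + v \<in> U" if "l \<in> ?C" "b' l + v \<in> U" "\<And>l. l \<in> ?C \<Longrightarrow> b' l \<in> mons_in B" for b' l v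
  proof -
    have "sum b' ?C = sum b' (?C - {l}) + b' l"
      using that(1) by (simp add: sum.remove add.commute)
    moreover have "sum b' (?C - {l}) \<in> monomials r"
      using sumB[of "?C - {l}" b'] that monB by auto
    ultimately show ?thesis
      using upclosedD(2)[OF U that(2)] by (simp add: add.assoc)
  qed
  have big: "single l (e l) + (t2 + u) \<in> U" if "l \<in> ?C" for l
    using upB[of l b "single l (e l) + (t1 + u)"] be[OF that] b that by (simp add: t2_def ac_simps)
  define V where "V = {v \<in> mons_in ?C. av B (v + (t2 + u))}"
  have V0: "0 \<in> V"
    using t2 by (simp add: V_def)
  have Ve: "coef v l < e l" if v: "v \<in> V" and l: "l \<in> ?C" for v l
  proof (rule ccontr)
    assume "\<not> coef v l < e l"
    then have "(v - single l (e l)) + single l (e l) = v"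
      by (intro mon_diff_add) (auto simp: lookup_single when_def not_less)
    moreover have "v - single l (e l) \<in> monomials r"
      using v by (intro monomials_diff) (auto simp: V_def mons_in_def monomials_def)
    ultimately have "v + (t2 + u) \<in> U"
      using upclosedD(2)[OF U big[OF l], of "v - single l (e l)"] by (simp flip: add.assoc)
    then show False
      using v by (auto simp: V_def av_def dest: bspec[of _ _ 0])
  qed
  have "\<forall>v. v \<in> V \<longrightarrow> mon_degree r v < Suc (\<Sum>l<r. e l)"
  proof (intro allI impI)
    fix v assume v: "v \<in> V"
    have "coef v l \<le> e l" if "l < r" for l
    proof (cases "l \<in> B")
      case True
      then have "l \<notin> supp v"
        using v by (auto simp: V_def mons_in_def)
      then show ?thesis
        by (simp add: in_keys_iff)
    qed (use Ve[OF v, of l] that in auto)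
    then show "mon_degree r v < Suc (\<Sum>l<r. e l)"
      unfolding mon_degree_def less_Suc_eq_le by (intro sum_mono) auto
  qed
  with V0 have "\<exists>v. v \<in> V \<and> (\<forall>v'. v' \<in> V \<longrightarrow> mon_degree r v' \<le> mon_degree r v)"
    by (rule Lattices_Big.ex_has_greatest_nat)
  then obtain v where v: "v \<in> V" and vmax: "\<And>v'. v' \<in> V \<Longrightarrow> mon_degree r v' \<le> mon_degree r v"
    by auto
  \<comment> \<open>One more variable outside \<open>B\<close> contradicts the choice of \<open>v\<close>, so some monomial in \<open>B\<close> kills.\<close>
  have "\<exists>b\<in>mons_in B. b + (single l 1 + (v + (t2 + u))) \<in> U" if l: "l \<in> ?C" for l
  proof -
    have "mon_degree r (single l 1 + v) = mon_degree r (single l 1) + mon_degree r v"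
      by (simp add: mon_degree_def lookup_add sum.distrib)
    moreover have "mon_degree r (single l 1) = 1"
      using l by (simp add: mon_degree_def lookup_single when_def)
    ultimately have "single l 1 + v \<notin> V"
      using vmax[of "single l 1 + v"] by auto
    then show ?thesis
      using l v by (auto simp: V_def av_def mons_in_single add.assoc)
  qed
  then obtain b' where b': "\<And>l. l \<in> ?C \<Longrightarrow> b' l \<in> mons_in B"
    and b'U: "\<And>l. l \<in> ?C \<Longrightarrow> b' l + (single l 1 + (v + (t2 + u))) \<in> U"
    by metis
  define t where "t = sum b' ?C + (v + t2)"
  have vm: "v \<in> monomials r"
    using v by (auto simp: V_def mons_in_def monomials_def)
  have tm: "t \<in> monomials r"
    using vm t2 sumB[of ?C b'] b' monB by (auto simp: t_def monomials_eq)
  have "ann_witness r U ?C (t + u)"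
    unfolding ann_witness_def
  proof (intro conjI ballI iffI)
    show "t + u \<in> monomials r"
      using tm u by (simp add: monomials_eq)
    fix m assume m: "m \<in> monomials r"
    show "supp m \<inter> ?C \<noteq> {}" if "m + (t + u) \<in> U"
    proof
      assume "supp m \<inter> ?C = {}"
      then have "m \<in> mons_in B"
        using m by (auto simp: mons_in_def monomials_def)
      then have "m + sum b' ?C \<in> mons_in B"
        using sumB[of ?C b'] b' by simp
      then have "(m + sum b' ?C) + (v + (t2 + u)) \<notin> U"
        using v by (auto simp: V_def av_def)
      then show False
        using that by (simp add: t_def add.assoc)
    qed
    show "m + (t + u) \<in> U" if meet: "supp m \<inter> ?C \<noteq> {}"
    proof -
      obtain l where l: "l \<in> supp m" "l \<in> ?C"
        using meet by auto
      have "sum b' ?C + (single l 1 + (v + (t2 + u))) \<in> U"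
        by (rule upB[OF l(2)]) (use b'U b' l in auto)
      moreover have "m - single l 1 \<in> monomials r"
        using m by (rule monomials_diff)
      ultimately have "(m - single l 1) + (sum b' ?C + (single l 1 + (v + (t2 + u)))) \<in> U"
        using upclosedD(2)[OF U] by blast
      also have "(m - single l 1) + (sum b' ?C + (single l 1 + (v + (t2 + u))))
          = (single l 1 + (m - single l 1)) + (t + u)"
        by (simp add: t_def ac_simps)
      also have "\<dots> = m + (t + u)"
        using mon_peel[OF l(1)] by simp
      finally show ?thesis .
    qed
  qed
  then show ?thesis
    using Br tm by blast
qed

text \<open>
  Dickson's lemma in the form of a subsequence: pass to a monotone subsequence for one exponent after
  the other.
\<close>

lemma monotone_subsequence:
  fixes s :: "nat \<Rightarrow> mon"
  shows "\<exists>\<phi>. strict_mono \<phi> \<and> (\<forall>i<k. incseq (\<lambda>n. coef (s (\<phi> n)) i))"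
proof (induction k)
  case 0
  then show ?case
    by (intro exI[of _ id]) (auto simp: strict_mono_def)
next
  case (Suc k)
  then obtain \<phi> where \<phi>: "strict_mono \<phi>" "\<And>i. i < k \<Longrightarrow> incseq (\<lambda>n. coef (s (\<phi> n)) i)"
    by auto
  obtain \<psi> where \<psi>: "strict_mono \<psi>" "monoseq (\<lambda>n. coef (s (\<phi> (\<psi> n))) k)"
    using seq_monosub[of "\<lambda>n. coef (s (\<phi> n)) k"] by auto
  have "\<exists>\<chi>. strict_mono \<chi> \<and> incseq (\<lambda>n. coef (s (\<phi> (\<psi> (\<chi> n)))) k)"
  proof (cases "incseq (\<lambda>n. coef (s (\<phi> (\<psi> n))) k)")
    case True
    then show ?thesis
      by (intro exI[of _ id]) (auto simp: strict_mono_def)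
  next
    case False
    let ?a = "\<lambda>n. coef (s (\<phi> (\<psi> n))) k"
    have dec: "decseq ?a"
      using \<psi>(2) False by (auto simp: monoseq_iff)
    \<comment> \<open>A decreasing sequence of natural numbers is constant from its least value on.\<close>
    obtain n0 where n0: "\<And>n. ?a n0 \<le> ?a n"
      using ex_has_least_nat[of "\<lambda>_. True" 0 ?a] by auto
    then have "?a (n0 + n) = ?a n0" for n
      using decseqD[OF dec, of n0 "n0 + n"] by (simp add: antisym)
    then show ?thesis
      by (intro exI[of _ "\<lambda>n. n0 + n"]) (auto simp: strict_mono_def incseq_def)
  qed
  then obtain \<chi> where \<chi>: "strict_mono \<chi>" "incseq (\<lambda>n. coef (s (\<phi> (\<psi> (\<chi> n)))) k)"
    by auto
  have "strict_mono (\<lambda>n. \<phi> (\<psi> (\<chi> n)))"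
    using \<phi>(1) \<psi>(1) \<chi>(1) by (simp add: strict_mono_def)
  moreover have "incseq (\<lambda>n. coef (s (\<phi> (\<psi> (\<chi> n)))) i)" if "i < Suc k" for i
  proof (cases "i = k")
    case False
    then have "incseq (\<lambda>n. coef (s (\<phi> n)) i)"
      using \<phi>(2) that by simp
    moreover have "mono (\<lambda>n. \<psi> (\<chi> n))"
      using \<psi>(1) \<chi>(1) by (simp add: strict_mono_def strict_mono_mono[unfolded strict_mono_def])
    ultimately show ?thesis
      by (auto simp: incseq_def monotone_def)
  qed (use \<chi> in simp)
  ultimately show ?case
    by blast
qed

text \<open>
  This is the finite generation of a monomial ideal in the form used below. If there were a
  counterexample for every \<open>N\<close>, then in a subsequence with monotone exponents a late truncation bound
  would exceed all exponents of the first member, which would therefore divide a truncation that was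
  assumed to lie outside.
\<close>

lemma upclosed_truncation:
  assumes U: "upclosed r U"
  shows "\<exists>N. \<forall>u\<in>U. \<forall>v\<in>monomials r. (\<forall>i. min N (coef u i) \<le> coef v i) \<longrightarrow> v \<in> U"
proof (rule ccontr)
  assume "\<not> ?thesis"
  then have "\<forall>N. \<exists>u v. u \<in> U \<and> v \<in> monomials r \<and> v \<notin> U \<and> (\<forall>i. min N (coef u i) \<le> coef v i)"
    by blast
  then obtain u v where uv: "\<And>N. u N \<in> U" "\<And>N. v N \<in> monomials r" "\<And>N. v N \<notin> U"
    "\<And>N i. min N (coef (u N) i) \<le> coef (v N) i"
    by metis
  obtain \<phi> where \<phi>: "strict_mono \<phi>" "\<And>i. i < r \<Longrightarrow> incseq (\<lambda>n. coef (u (\<phi> n)) i)"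
    using monotone_subsequence[of r u] by auto
  define n where "n = (\<Sum>i<r. coef (u (\<phi> 0)) i)"
  have "coef (u (\<phi> 0)) i \<le> coef (v (\<phi> n)) i" for i
  proof (cases "i < r")
    case True
    have "coef (u (\<phi> 0)) i \<le> n"
      unfolding n_def using True by (intro member_le_sum) auto
    also have "n \<le> \<phi> n"
      using \<phi>(1) by (rule strict_mono_imp_increasing)
    finally have "coef (u (\<phi> 0)) i \<le> min (\<phi> n) (coef (u (\<phi> n)) i)"
      using \<phi>(2)[OF True] by (simp add: incseq_def)
    also have "\<dots> \<le> coef (v (\<phi> n)) i"
      by (rule uv)
    finally show ?thesis .
  next
    case False
    then have "i \<notin> supp (u (\<phi> 0))"
      using upclosedD(1)[OF U uv(1)[of "\<phi> 0"]] by (auto simp: monomials_def)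
    then show ?thesis
      by (simp add: in_keys_iff)
  qed
  then have "v (\<phi> n) \<in> U"
    using upclosed_le[OF U uv(1) uv(2)] by blast
  then show False
    using uv(3) by blast
qed

section \<open>Associated primes of Borel-fixed monomial ideals\<close>

definition subst :: "nat \<Rightarrow> (nat \<Rightarrow> 'k::field mpol) \<Rightarrow> 'k mpol \<Rightarrow> 'k mpol" where
  "subst r \<sigma> f = (\<Sum>m\<in>supp f. const (coef f m) * (\<Prod>i<r. \<sigma> i ^ coef m i))"

lemma mat_action_eq_subst: "mat_action r g = subst r (\<lambda>i. \<Sum>j<r. const (g $$ (i, j)) * var j)"
  by (simp add: fun_eq_iff mat_action_def subst_def)

lemma const_0 [simp]: "const 0 = 0"
  by (simp add: const_def)

lemma const_1 [simp]: "const 1 = 1"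
  by (simp add: const_def)

lemma const_add: "const (a + b) = const a + const b"
  by (simp add: const_def single_add)

lemma const_mult: "const (a * b) = const a * const b"
  by (simp add: const_def mult_single)

lemma const_uminus: "const (- a) = - const a"
  by (simp add: const_def single_uminus)

lemma const_in_mspan: "0 \<in> M \<Longrightarrow> const c \<in> mspan M"
  by (simp add: const_def)

lemma subst_superset:
  assumes "finite S" "supp f \<subseteq> S"
  shows "subst r \<sigma> f = (\<Sum>m\<in>S. const (coef f m) * (\<Prod>i<r. \<sigma> i ^ coef m i))"
  unfolding subst_def
  by (rule sum.mono_neutral_left[OF assms]) (auto simp: in_keys_iff)

lemma subst_add: "subst r \<sigma> (f + g) = subst r \<sigma> f + subst r \<sigma> g"
proof -
  let ?S = "supp f \<union> supp g"
  have "subst r \<sigma> (f + g) = (\<Sum>m\<in>?S. const (coef (f + g) m) * (\<Prod>i<r. \<sigma> i ^ coef m i))"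
    by (rule subst_superset) (auto simp: keys_add)
  also have "\<dots> = (\<Sum>m\<in>?S. const (coef f m) * (\<Prod>i<r. \<sigma> i ^ coef m i))
      + (\<Sum>m\<in>?S. const (coef g m) * (\<Prod>i<r. \<sigma> i ^ coef m i))"
    by (simp add: lookup_add const_add distrib_right sum.distrib)
  also have "\<dots> = subst r \<sigma> f + subst r \<sigma> g"
    by (simp add: subst_superset[of ?S])
  finally show ?thesis .
qed

lemma subst_0 [simp]: "subst r \<sigma> 0 = 0"
  by (simp add: subst_def)

lemma subst_uminus: "subst r \<sigma> (- f) = - subst r \<sigma> f"
  using subst_add[of r \<sigma> f "- f"] by (simp add: add_eq_0_iff)

lemma subst_sum: "subst r \<sigma> (\<Sum>x\<in>X. f x) = (\<Sum>x\<in>X. subst r \<sigma> (f x))"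
  by (induction X rule: infinite_finite_induct) (simp_all add: subst_add)

lemma subst_single: "subst r \<sigma> (single m c) = const c * (\<Prod>i<r. \<sigma> i ^ coef m i)"
  by (subst subst_superset[of "{m}"]) auto

lemma subst_mult: "subst r \<sigma> (f * g) = subst r \<sigma> f * subst r \<sigma> g"
proof -
  have one: "subst r \<sigma> (single m c * single n d) = subst r \<sigma> (single m c) * subst r \<sigma> (single n d)"
    for m n c d
    by (simp add: mult_single subst_single const_mult lookup_add power_add prod.distrib ac_simps)
  have "subst r \<sigma> (f * g) =
      subst r \<sigma> ((\<Sum>m\<in>supp f. single m (coef f m)) * (\<Sum>n\<in>supp g. single n (coef g n)))"
    by (simp only: poly_sum_terms)
  also have "\<dots> = (\<Sum>m\<in>supp f. \<Sum>n\<in>supp g. subst r \<sigma> (single m (coef f m) * single n (coef g n)))"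
    by (simp only: sum_product subst_sum)
  also have "\<dots> = (\<Sum>m\<in>supp f. subst r \<sigma> (single m (coef f m))) * (\<Sum>n\<in>supp g. subst r \<sigma> (single n (coef g n)))"
    by (simp only: sum_product one)
  also have "\<dots> = subst r \<sigma> f * subst r \<sigma> g"
    by (simp only: flip: subst_sum) (simp only: poly_sum_terms)
  finally show ?thesis .
qed

lemma subst_const: "subst r \<sigma> (const c) = const c"
  unfolding const_def subst_single by (simp add: const_def)

lemma subst_1 [simp]: "subst r \<sigma> 1 = 1"
  using subst_const[of r \<sigma> 1] by simp

lemma subst_power: "subst r \<sigma> (f ^ n) = subst r \<sigma> f ^ n"
  by (induction n) (simp_all add: subst_mult)

lemma subst_prod: "subst r \<sigma> (\<Prod>x\<in>X. f x) = (\<Prod>x\<in>X. subst r \<sigma> (f x))"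
  by (induction X rule: infinite_finite_induct) (simp_all add: subst_mult)

lemma subst_var: "i < r \<Longrightarrow> subst r \<sigma> (var i) = \<sigma> i"
proof -
  assume i: "i < r"
  have "(\<Prod>l<r. \<sigma> l ^ coef (single i 1) l) = (\<Prod>l\<in>{..<r}. if l = i then \<sigma> i else 1)"
    by (rule prod.cong) (auto simp: lookup_single when_def)
  then show ?thesis
    using i by (simp add: var_def subst_single)
qed

lemma prod_var:
  assumes "m \<in> monomials r"
  shows "(\<Prod>i<r. var i ^ coef m i) = (single m 1 :: 'k::field mpol)"
  using assms
proof (induction "mon_degree r m" arbitrary: m rule: less_induct)
  case less
  show ?case
  proof (cases "m = 0")
    case False
    then obtain i where i: "i \<in> supp m"
      by (metis keys_eq_empty ex_in_conv)
    let ?n = "m - single i 1"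
    have ir: "i < r"
      using i less.prems by (auto simp: monomials_def)
    have deg: "mon_degree r ?n < mon_degree r m"
      by (rule mon_degree_peel[OF less.prems i])
    have "(\<Prod>l<r. var l ^ coef m l) = (\<Prod>l<r. var l ^ coef (single i 1 + ?n) l :: 'k mpol)"
      by (simp only: mon_peel[OF i])
    also have "\<dots> = (\<Prod>l<r. var l ^ coef (single i 1) l) * (\<Prod>l<r. var l ^ coef ?n l)"
      by (simp only: lookup_add power_add prod.distrib)
    also have "(\<Prod>l<r. var l ^ coef ?n l :: 'k mpol) = single ?n 1"
      by (rule less.hyps[OF deg monomials_diff[OF less.prems]])
    also have "(\<Prod>l<r. var l ^ coef (single i 1) l) = (\<Prod>l\<in>{..<r}. if l = i then var i else (1 :: 'k mpol))"
      by (rule prod.cong) (auto simp: lookup_single when_def)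
    also have "\<dots> * single ?n 1 = single m 1"
      using ir mon_peel[OF i] by (simp add: var_def mult_single)
    finally show ?thesis .
  qed simp
qed

lemma subst_id:
  assumes "f \<in> mspan (monomials r)" "\<And>i. i < r \<Longrightarrow> \<sigma> i = var i"
  shows "subst r \<sigma> f = f"
proof -
  have "subst r \<sigma> f = (\<Sum>m\<in>supp f. single m (coef f m))"
    unfolding subst_def
  proof (rule sum.cong)
    fix m assume "m \<in> supp f"
    then have "m \<in> monomials r"
      using assms(1) by (rule mspanD[rotated])
    then show "const (coef f m) * (\<Prod>i<r. \<sigma> i ^ coef m i) = single m (coef f m)"
      using assms(2) by (simp add: const_def mult_single prod_var)
  qed simp
  then show ?thesis
    by (simp add: poly_sum_terms)
qed

lemma subst_subst: "subst r \<sigma> (subst r \<tau> f) = subst r (\<lambda>i. subst r \<sigma> (\<tau> i)) f"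
  by (subst (2 3) subst_def) (simp add: subst_sum subst_mult subst_const subst_prod subst_power)

lemma subst_in_polys:
  assumes "\<And>i. i < r \<Longrightarrow> \<sigma> i \<in> mspan (monomials r)"
  shows "subst r \<sigma> f \<in> mspan (monomials r)"
  unfolding subst_def
proof (rule mspan_sum)
  fix m
  show "const (coef f m) * (\<Prod>i<r. \<sigma> i ^ coef m i) \<in> mspan (monomials r)"
    unfolding monomials_eq
    by (rule mspan_mons_in_mult[OF const_in_mspan mspan_mons_in_prod[OF mspan_mons_in_power]])
      (use assms in \<open>auto simp: monomials_eq\<close>)
qed

definition transvection :: "nat \<Rightarrow> nat \<Rightarrow> 'k::field \<Rightarrow> nat \<Rightarrow> 'k mpol" where
  "transvection p q c = (\<lambda>i. var i + (if i = p then const c * var q else 0))"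

lemma addrow_mat_in_borel_group:
  assumes "q < p" "p < r"
  shows "addrow_mat r (c :: 'k::field) p q \<in> borel_group r"
proof -
  have "invertible_mat (addrow_mat r c p q)"
    unfolding invertible_mat_def inverts_mat_def
    using addrow_mat_inv[of p r q c] addrow_mat_inv[of p r q "- c"] assms
    by (auto intro!: exI[of _ "addrow_mat r (- c) p q"])
  moreover have "addrow_mat r c p q $$ (i, j) = 0" if "i < r" "j < r" "i < j" for i j
    using that assms by auto
  ultimately show ?thesis
    by (simp add: borel_group_def)
qed

lemma mat_action_addrow_mat:
  assumes "q < p" "p < r"
  shows "mat_action r (addrow_mat r c p q) f = subst r (transvection p q c) f"
proof -
  have "(\<Sum>j<r. const (addrow_mat r c p q $$ (i, j)) * var j) = transvection p q c i" if i: "i < r" for i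
  proof -
    have "(\<Sum>j<r. const (addrow_mat r c p q $$ (i, j)) * var j)
        = (\<Sum>j<r. (if j = i then var i else 0) + (if j = q then if i = p then const c * var q else 0 else 0))"
      by (rule sum.cong) (use i assms in \<open>auto simp: const_add\<close>)
    also have "\<dots> = transvection p q c i"
      using i assms by (simp add: sum.distrib transvection_def)
    finally show ?thesis .
  qed
  then show ?thesis
    unfolding mat_action_eq_subst subst_def by (intro sum.cong arg_cong2[of _ _ _ _ "(*)"] prod.cong) auto
qed

lemma transvection_inverse:
  assumes "q < p" "p < r" "f \<in> mspan (monomials r)"
  shows "subst r (transvection p q c) (subst r (transvection p q (- c)) f) = f"
  unfolding subst_subst
proof (rule subst_id[OF assms(3)])
  fix i assume "i < r"
  then show "subst r (transvection p q c) (transvection p q (- c) i) = var i"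
    using assms(1,2)
    by (simp add: transvection_def subst_add subst_uminus subst_mult subst_const subst_var const_uminus)
qed

lemma transvection_in_polys:
  assumes "q < r" "i < r"
  shows "transvection p q c i \<in> mspan (monomials r)"
  using assms
  by (auto simp: transvection_def intro!: mspan_add mspan_monomials_mult var_in_polys const_in_mspan)

lemma is_prime_subst_vimage:
  assumes Q: "is_prime r Q" and \<sigma>: "\<And>i. i < r \<Longrightarrow> \<sigma> i \<in> mspan (monomials r)"
  shows "is_prime r {a \<in> mspan (monomials r). subst r \<sigma> a \<in> Q}"
proof -
  note QI = is_idealD[OF is_primeD(1)[OF Q]]
  have s: "subst r \<sigma> a \<in> mspan (monomials r)" for a
    using \<sigma> by (rule subst_in_polys)
  show ?thesis
    unfolding is_prime_def is_ideal_def
  proof (intro conjI ballI impI subsetI)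
    fix a b :: "'a mpol" assume "a \<in> {a \<in> mspan (monomials r). subst r \<sigma> a \<in> Q}"
      "b \<in> {a \<in> mspan (monomials r). subst r \<sigma> a \<in> Q}"
    then show "a + b \<in> {a \<in> mspan (monomials r). subst r \<sigma> a \<in> Q}"
      using QI(3) by (simp add: subst_add mspan_add)
  next
    fix a x :: "'a mpol" assume "a \<in> {a \<in> mspan (monomials r). subst r \<sigma> a \<in> Q}" "x \<in> mspan (monomials r)"
    then show "x * a \<in> {a \<in> mspan (monomials r). subst r \<sigma> a \<in> Q}"
      using QI(4)[OF _ s] by (simp add: subst_mult mspan_monomials_mult)
  next
    fix a b :: "'a mpol" assume "a \<in> mspan (monomials r)" "b \<in> mspan (monomials r)"
      "a * b \<in> {a \<in> mspan (monomials r). subst r \<sigma> a \<in> Q}"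
    then show "a \<in> {a \<in> mspan (monomials r). subst r \<sigma> a \<in> Q} \<or>
        b \<in> {a \<in> mspan (monomials r). subst r \<sigma> a \<in> Q}"
      using is_primeD(3)[OF Q s[of a] s[of b]] by (simp add: subst_mult)
  qed (use QI(2) is_primeD(2)[OF Q] in simp_all)
qed

text \<open>
  The substitution \<open>g\<close> that sends the variable \<open>x\<^sub>p\<close> to \<open>x\<^sub>p + x\<^sub>q\<close> is in the Borel group for
  \<open>q < p\<close>. It permutes the associated primes, so the image of a prime \<open>Q\<close> that contains \<open>x\<^sub>p\<close> is
  again a monomial ideal. The image contains \<open>x\<^sub>p + x\<^sub>q\<close>, hence \<open>x\<^sub>q\<close>, and \<open>g\<close> fixes \<open>x\<^sub>q\<close>.
\<close>

lemma borel_fixed_associated_initial_segment: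
  fixes U :: "mon set"
  assumes U: "upclosed r U" and B: "borel_fixed r (mspan U :: 'k::field mpol set)"
    and A: "var_ideal r A \<in> associated_primes (poly_ring r) (mspan U :: 'k mpol set)"
    and p: "p \<in> A" "p < r" and q: "q < p"
  shows "q \<in> A"
proof -
  let ?I = "mspan U :: 'k mpol set" and ?R = "mspan (monomials r) :: 'k mpol set"
  let ?g = "subst r (transvection p q (1 :: 'k))" and ?h = "subst r (transvection p q (- 1 :: 'k))"
  note I = is_ideal_mspan[OF U, where 'k = 'k]
  have qr: "q < r"
    using p q by simp
  have pol: "subst r (transvection p q c) a \<in> ?R" for c a
    using transvection_in_polys[OF qr] by (rule subst_in_polys)
  have gh: "?g (?h a) = a" and hg: "?h (?g a) = a" if "a \<in> ?R" for a
    using transvection_inverse[OF q p(2) that, of 1] transvection_inverse[OF q p(2) that, of "- 1"] by simp_all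
  have fixed: "subst r (transvection p q c) a \<in> ?I" if "a \<in> ?I" for c a
  proof -
    have "mat_action r (addrow_mat r c p q) ` ?I = ?I"
      using B addrow_mat_in_borel_group[OF q p(2), of c] by (simp add: borel_fixed_def)
    then have "mat_action r (addrow_mat r c p q) a \<in> ?I"
      using that by blast
    then show ?thesis
      by (simp only: mat_action_addrow_mat[OF q p(2)])
  qed
  obtain f where f: "f \<in> ?R" "var_ideal r A = {a \<in> ?R. a * f \<in> ?I}"
    using A by (auto simp: associated_primes_poly_ring[OF I])
  \<comment> \<open>The image of the prime under \<open>?g\<close>, written as the preimage under the inverse \<open>?h\<close>.\<close>
  define Q' where "Q' = {a \<in> ?R. ?h a \<in> var_ideal r A}"
  have "a * ?g f \<in> ?I \<longleftrightarrow> ?h a * f \<in> ?I" if a: "a \<in> ?R" for a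
  proof
    assume "a * ?g f \<in> ?I"
    then have "?h (a * ?g f) \<in> ?I"
      by (rule fixed)
    then show "?h a * f \<in> ?I"
      using hg[OF f(1)] by (simp add: subst_mult)
  next
    assume "?h a * f \<in> ?I"
    then have "?g (?h a * f) \<in> ?I"
      by (rule fixed)
    then show "a * ?g f \<in> ?I"
      using gh[OF a] by (simp add: subst_mult)
  qed
  then have "Q' = {a \<in> ?R. a * ?g f \<in> ?I}"
    using pol by (auto simp: Q'_def f(2))
  moreover have "is_prime r Q'"
    unfolding Q'_def by (rule is_prime_subst_vimage[OF is_prime_var_ideal transvection_in_polys[OF qr]])
  ultimately have "Q' \<in> associated_primes (poly_ring r) ?I"
    using pol by (auto simp: associated_primes_poly_ring[OF I])
  then obtain A' where A': "Q' = var_ideal r A'"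
    using associated_prime_of_monomial_ideal[OF U] by blast
  have "?h (var p + var q) = var p"
    using p q qr by (simp add: subst_add subst_var transvection_def const_uminus)
  moreover have "var p \<in> (var_ideal r A :: 'k mpol set)"
    using p by (simp add: var_in_var_ideal_iff)
  moreover have "var p + var q \<in> ?R"
    using p qr by (intro mspan_add var_in_polys)
  ultimately have "var p + var q \<in> (var_ideal r A' :: 'k mpol set)"
    unfolding A'[symmetric] Q'_def by simp
  moreover have "single q 1 \<in> supp (var p + var q :: 'k mpol)"
    using q by (auto simp: in_keys_iff lookup_add var_def lookup_single when_def dest!: arg_cong[of _ _ "\<lambda>m. coef m p"])
  ultimately have "q \<in> A'"
    by (auto simp: var_ideal_def mspan_def)
  then have "var q \<in> Q'"
    unfolding A' by (simp add: var_in_var_ideal_iff[OF qr])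
  then have "?h (var q) \<in> var_ideal r A"
    by (simp add: Q'_def)
  moreover have "?h (var q) = var q"
    using q qr by (simp add: subst_var transvection_def)
  ultimately show "q \<in> A"
    by (simp add: var_in_var_ideal_iff[OF qr])
qed

section \<open>An upper bound for chains of primes\<close>

text \<open>
  Gaussian elimination: solve the equation \<open>e\<close> for an unknown \<open>x0\<close> that occurs in it.
\<close>

lemma homogeneous_system_nontrivial:
  fixes a :: "'x \<Rightarrow> 'e \<Rightarrow> 'k::field"
  assumes "finite E" "finite X" "card E < card X"
  shows "\<exists>c. (\<exists>x\<in>X. c x \<noteq> 0) \<and> (\<forall>e\<in>E. (\<Sum>x\<in>X. c x * a x e) = 0)"
  using assms
proof (induction E arbitrary: X a rule: finite_induct)
  case empty
  then have "X \<noteq> {}"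
    by auto
  then show ?case
    by (intro exI[of _ "\<lambda>_. 1"]) auto
next
  case (insert e E)
  show ?case
  proof (cases "\<forall>x\<in>X. a x e = 0")
    case True
    have "card E < card X"
      using insert by simp
    then obtain c where "\<exists>x\<in>X. c x \<noteq> 0" "\<forall>e\<in>E. (\<Sum>x\<in>X. c x * a x e) = 0"
      using insert.IH[OF insert.prems(1), of a] by blast
    then show ?thesis
      using True by (intro exI[of _ c]) auto
  next
    case False
    then obtain x0 where x0: "x0 \<in> X" "a x0 e \<noteq> 0"
      by blast
    let ?X = "X - {x0}"
    have "finite ?X" "card E < card ?X"
      using insert.prems insert.hyps x0 by auto
    from insert.IH[OF this, of "\<lambda>x e'. a x e' - a x e / a x0 e * a x0 e'"]
    obtain c where c: "\<exists>x\<in>?X. c x \<noteq> 0"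
      "\<forall>e'\<in>E. (\<Sum>x\<in>?X. c x * (a x e' - a x e / a x0 e * a x0 e')) = 0"
      by blast
    define d where "d = c(x0 := - (\<Sum>x\<in>?X. c x * (a x e / a x0 e)))"
    have sum: "(\<Sum>x\<in>X. d x * a x e') = (\<Sum>x\<in>?X. c x * (a x e' - a x e / a x0 e * a x0 e'))" for e'
    proof -
      have "(\<Sum>x\<in>X. d x * a x e') = d x0 * a x0 e' + (\<Sum>x\<in>?X. d x * a x e')"
        using insert.prems(1) x0(1) by (rule sum.remove)
      also have "(\<Sum>x\<in>?X. d x * a x e') = (\<Sum>x\<in>?X. c x * a x e')"
        by (rule sum.cong) (auto simp: d_def)
      also have "d x0 * a x0 e' = - (\<Sum>x\<in>?X. c x * (a x e / a x0 e * a x0 e'))"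
        by (simp add: d_def sum_distrib_right mult.assoc)
      finally show ?thesis
        by (simp add: right_diff_distrib sum_subtractf)
    qed
    have "(\<Sum>x\<in>X. d x * a x e) = 0"
      unfolding sum using x0(2) by simp
    moreover have "\<forall>e'\<in>E. (\<Sum>x\<in>X. d x * a x e') = 0"
      unfolding sum by (rule c(2))
    moreover have "\<exists>x\<in>X. d x \<noteq> 0"
      using c(1) by (auto simp: d_def)
    ultimately show ?thesis
      by (intro exI[of _ d]) simp
  qed
qed

definition box :: "nat set \<Rightarrow> nat \<Rightarrow> mon set" where
  "box B L = {m \<in> mons_in B. \<forall>i. coef m i \<le> L}"

lemma card_box:
  assumes "finite B"
  shows "finite (box B L)" "card (box B L) \<le> Suc L ^ card B"
proof -
  let ?F = "B \<rightarrow>\<^sub>E {..L}" and ?r = "\<lambda>m :: mon. restrict (coef m) B"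
  have sub: "?r ` box B L \<subseteq> ?F"
    by (auto simp: box_def)
  have inj: "inj_on ?r (box B L)"
  proof (rule inj_onI, rule poly_mapping_eqI)
    fix m n :: mon and i
    assume mn: "m \<in> box B L" "n \<in> box B L" "?r m = ?r n"
    show "coef m i = coef n i"
    proof (cases "i \<in> B")
      case True
      then show ?thesis
        using fun_cong[OF mn(3), of i] by simp
    next
      case False
      then have "i \<notin> supp m" "i \<notin> supp n"
        using mn(1,2) by (auto simp: box_def mons_in_def)
      then show ?thesis
        by (simp add: in_keys_iff)
    qed
  qed
  have fin: "finite ?F"
    using assms by (intro finite_PiE) auto
  show "finite (box B L)"
    using inj_on_finite[OF inj sub fin] .
  have "card (box B L) \<le> card ?F"
    using card_inj_on_le[OF inj sub fin] .
  also have "card ?F = Suc L ^ card B"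
    using assms by (simp add: card_PiE)
  finally show "card (box B L) \<le> Suc L ^ card B" .
qed

lemma mspan_box_mult:
  "f \<in> mspan (box B a) \<Longrightarrow> g \<in> mspan (box B b) \<Longrightarrow> f * g \<in> mspan (box B (a + b))"
  by (rule mspan_mult) (auto simp: box_def lookup_add add_mono)

lemma mspan_box_power: "f \<in> mspan (box B a) \<Longrightarrow> f ^ n \<in> mspan (box B (n * a))"
proof (induction n)
  case 0
  then show ?case by (simp add: box_def)
next
  case (Suc n)
  then show ?case
    using mspan_box_mult[of f B a "f ^ n" "n * a"] by simp
qed

lemma mspan_box_prod:
  assumes "finite X" "\<And>i. i \<in> X \<Longrightarrow> f i \<in> mspan (box B (a i))"
  shows "prod f X \<in> mspan (box B (sum a X))"
  using assms
proof (induction X rule: finite_induct)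
  case (insert x X)
  then show ?case
    using mspan_box_mult[of "f x" B "a x" "prod f X" "sum a X"] by simp
qed (simp add: box_def)

lemma mspan_box_mono: "a \<le> b \<Longrightarrow> mspan (box B a) \<subseteq> mspan (box B b)"
  by (rule mspan_mono) (auto simp: box_def intro: order_trans)

lemma poly_in_box:
  assumes "f \<in> mspan (mons_in B)"
  shows "\<exists>e. f \<in> mspan (box B e)"
proof -
  have "coef m i \<le> (\<Sum>m\<in>supp f. \<Sum>i\<in>supp m. coef m i)" if m: "m \<in> supp f" for m i
  proof (cases "i \<in> supp m")
    case True
    then have "coef m i \<le> (\<Sum>i\<in>supp m. coef m i)"
      by (intro member_le_sum) auto
    also have "\<dots> \<le> (\<Sum>m\<in>supp f. \<Sum>i\<in>supp m. coef m i)"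
      by (rule member_le_sum[OF m]) auto
    finally show ?thesis .
  qed (simp add: in_keys_iff)
  then show ?thesis
    using assms by (intro exI[of _ "\<Sum>m\<in>supp f. \<Sum>i\<in>supp m. coef m i"]) (auto simp: mspan_def box_def)
qed

text \<open>
  There are \<open>D\<^sup>n\<close> products of powers of the given polynomials with exponents below \<open>D\<close>, but they lie
  in a space whose dimension grows only like \<open>D\<close> to the power \<open>card B\<close>.
\<close>

lemma algebraically_dependent:
  fixes f :: "nat \<Rightarrow> 'k::field mpol"
  assumes B: "finite B" "card B < n" and f: "\<And>i. i < n \<Longrightarrow> f i \<in> mspan (mons_in B)"
  shows "\<exists>\<Lambda> c. finite \<Lambda> \<and> \<Lambda> \<noteq> {} \<and> \<Lambda> \<subseteq> {..<n} \<rightarrow>\<^sub>E UNIV \<and> (\<forall>\<alpha>\<in>\<Lambda>. c \<alpha> \<noteq> 0) \<and>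
    (\<Sum>\<alpha>\<in>\<Lambda>. const (c \<alpha>) * (\<Prod>i<n. f i ^ \<alpha> i)) = 0"
proof -
  have "\<forall>i<n. \<exists>e. f i \<in> mspan (box B e)"
    using f poly_in_box by blast
  then obtain e where e: "\<And>i. i < n \<Longrightarrow> f i \<in> mspan (box B (e i))"
    by metis
  define E where "E = (\<Sum>i<n. e i)"
  \<comment> \<open>Each product of powers has exponents at most \<open>D * E\<close>, where \<open>E\<close> adds up exponent bounds of the
    given polynomials; this \<open>D\<close> makes the number of products exceed the number of monomials.\<close>
  define D where "D = Suc (Suc E ^ card B)"
  let ?X = "{..<n} \<rightarrow>\<^sub>E {..<D}" and ?M = "box B (D * E)"
  let ?p = "\<lambda>\<alpha>. \<Prod>i<n. f i ^ \<alpha> i"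
  have finX: "finite ?X"
    by (intro finite_PiE) auto
  have p: "?p \<alpha> \<in> mspan ?M" if "\<alpha> \<in> ?X" for \<alpha>
  proof -
    have "?p \<alpha> \<in> mspan (box B (\<Sum>i<n. \<alpha> i * e i))"
      by (rule mspan_box_prod) (auto intro: mspan_box_power e)
    moreover have "(\<Sum>i<n. \<alpha> i * e i) \<le> D * E"
      unfolding E_def sum_distrib_left
      using that by (intro sum_mono mult_right_mono) (auto simp: PiE_def Pi_def intro: less_imp_le)
    ultimately show ?thesis
      using mspan_box_mono by blast
  qed
  have "card ?M \<le> Suc (D * E) ^ card B"
    using card_box(2)[OF B(1)] .
  also have "\<dots> \<le> (D * Suc E) ^ card B"
    by (intro power_mono) (auto simp: D_def)
  also have "\<dots> = D ^ card B * Suc E ^ card B"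
    by (rule power_mult_distrib)
  also have "\<dots> < D ^ card B * D"
    by (rule mult_strict_left_mono) (simp_all add: D_def)
  also have "\<dots> \<le> D ^ n"
    using B(2) power_increasing[of "Suc (card B)" n D] by (simp add: D_def mult.commute)
  also have "\<dots> = card ?X"
    by (simp add: card_PiE)
  finally have "card ?M < card ?X" .
  from homogeneous_system_nontrivial[OF card_box(1)[OF B(1)] finX this, of "\<lambda>\<alpha>. coef (?p \<alpha>)"]
  obtain c where c: "\<exists>\<alpha>\<in>?X. c \<alpha> \<noteq> 0" "\<forall>m\<in>?M. (\<Sum>\<alpha>\<in>?X. c \<alpha> * coef (?p \<alpha>) m) = 0"
    by blast
  define \<Lambda> where "\<Lambda> = {\<alpha> \<in> ?X. c \<alpha> \<noteq> 0}"
  have "coef (\<Sum>\<alpha>\<in>?X. const (c \<alpha>) * ?p \<alpha>) m = 0" for m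
  proof (cases "m \<in> ?M")
    case True
    have "coef (const (c \<alpha>) * ?p \<alpha>) m = c \<alpha> * coef (?p \<alpha>) m" for \<alpha>
      using coef_single_mult[of 0 "c \<alpha>" "?p \<alpha>" m] by (simp add: const_def)
    then show ?thesis
      using c(2) True by (simp add: lookup_sum)
  next
    case False
    have "(\<Sum>\<alpha>\<in>?X. const (c \<alpha>) * ?p \<alpha>) \<in> mspan ?M"
    proof (rule mspan_sum)
      fix \<alpha> assume "\<alpha> \<in> ?X"
      then show "const (c \<alpha>) * ?p \<alpha> \<in> mspan ?M"
        using mspan_box_mult[of "const (c \<alpha>)" B 0 "?p \<alpha>" "D * E"] p by (simp add: const_in_mspan box_def)
    qed
    then show ?thesis
      using False by (auto simp: mspan_def in_keys_iff)
  qed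
  then have "(\<Sum>\<alpha>\<in>?X. const (c \<alpha>) * ?p \<alpha>) = 0"
    by (intro poly_mapping_eqI) simp
  moreover have "(\<Sum>\<alpha>\<in>?X. const (c \<alpha>) * ?p \<alpha>) = (\<Sum>\<alpha>\<in>\<Lambda>. const (c \<alpha>) * ?p \<alpha>)"
    unfolding \<Lambda>_def by (rule sum.mono_neutral_right[OF finX]) auto
  moreover have "finite \<Lambda>" "\<Lambda> \<noteq> {}" "\<forall>\<alpha>\<in>\<Lambda>. c \<alpha> \<noteq> 0"
    using finX c(1) by (auto simp: \<Lambda>_def)
  moreover have "\<Lambda> \<subseteq> {..<n} \<rightarrow>\<^sub>E UNIV"
    by (auto simp: \<Lambda>_def PiE_def)
  ultimately show ?thesis
    by (intro exI[of _ \<Lambda>] exI[of _ c]) simp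
qed

text \<open>
  Cancel from a relation between the \<open>x i\<close> the highest power of \<open>x k\<close> that divides it, which is
  possible since \<open>x k\<close> is not in the prime \<open>C k\<close>. The terms still divisible by \<open>x k\<close> vanish modulo the
  next prime, and the others form a nontrivial relation between the later elements modulo that prime.
  At the end of the chain a nonzero constant would lie in a prime.
\<close>

lemma prime_chain_algebraically_independent:
  fixes x :: "nat \<Rightarrow> 'k::field mpol"
  assumes C: "\<And>i. i \<le> n \<Longrightarrow> is_prime r (C i)"
    and x: "\<And>i. i < n \<Longrightarrow> x i \<in> C (Suc i)" "\<And>i. i < n \<Longrightarrow> x i \<notin> C i"
    and mono: "\<And>i. i < n \<Longrightarrow> C i \<subseteq> C (Suc i)"
    and k: "k \<le> n"
    and \<Lambda>: "finite \<Lambda>" "\<Lambda> \<noteq> {}" "\<And>\<alpha>. \<alpha> \<in> \<Lambda> \<Longrightarrow> c \<alpha> \<noteq> 0"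
      "\<And>\<alpha> \<beta>. \<alpha> \<in> \<Lambda> \<Longrightarrow> \<beta> \<in> \<Lambda> \<Longrightarrow> (\<And>i. k \<le> i \<Longrightarrow> i < n \<Longrightarrow> \<alpha> i = \<beta> i) \<Longrightarrow> \<alpha> = \<beta>"
  shows "(\<Sum>\<alpha>\<in>\<Lambda>. const (c \<alpha>) * (\<Prod>i\<in>{k..<n}. x i ^ \<alpha> i)) \<notin> C k"
  using k \<Lambda>
proof (induction k arbitrary: \<Lambda> rule: inc_induct)
  case base
  obtain \<alpha> where "\<Lambda> = {\<alpha>}"
    using base.prems(2,4) by (metis not_le ex_in_conv is_singletonI' is_singleton_the_elem)
  then show ?case
    using is_prime_const[OF C[of n], of "c \<alpha>"] base.prems(3) by (auto simp: const_def)
next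
  case (step k)
  let ?p = "\<lambda>k \<alpha>. \<Prod>i\<in>{k..<n}. x i ^ \<alpha> i :: 'k mpol"
  let ?R = "mspan (monomials r) :: 'k mpol set"
  note Ck = C[of k] and Ck1 = C[of "Suc k"]
  have I1: "is_ideal r (C (Suc k))"
    using Ck1 step by (simp add: is_primeD)
  have xR: "x i \<in> ?R" if "i < n" for i
    using that C[of "Suc i"] x(1) is_idealD(1)[OF is_primeD(1)] by (metis Suc_leI)
  have pR: "?p j \<alpha> \<in> ?R" for j \<alpha>
    unfolding monomials_eq using xR 
    by (intro mspan_mons_in_prod mspan_mons_in_power) (auto simp: monomials_eq)
  define a where "a = Min ((\<lambda>\<alpha>. \<alpha> k) ` \<Lambda>)"
  have a: "a \<le> \<alpha> k" if "\<alpha> \<in> \<Lambda>" for \<alpha>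
    using that step.prems by (simp add: a_def)
  have "a \<in> (\<lambda>\<alpha>. \<alpha> k) ` \<Lambda>"
    unfolding a_def using step.prems by (intro Min_in) auto
  define \<Lambda>' where "\<Lambda>' = {\<alpha> \<in> \<Lambda>. \<alpha> k = a}"
  have ne: "\<Lambda>' \<noteq> {}"
    using \<open>a \<in> _\<close> by (auto simp: \<Lambda>'_def)
  define S where "S = (\<Sum>\<alpha>\<in>\<Lambda>. const (c \<alpha>) * (x k ^ (\<alpha> k - a) * ?p (Suc k) \<alpha>))"
  have SR: "S \<in> ?R"
    unfolding S_def using xR[OF step.hyps(2)] pR
    by (intro mspan_sum mspan_monomials_mult mspan_monomials_power const_in_mspan) auto
  have eq: "(\<Sum>\<alpha>\<in>\<Lambda>. const (c \<alpha>) * ?p k \<alpha>) = x k ^ a * S"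
  proof -
    have "const (c \<alpha>) * ?p k \<alpha> = x k ^ a * (const (c \<alpha>) * (x k ^ (\<alpha> k - a) * ?p (Suc k) \<alpha>))" if "\<alpha> \<in> \<Lambda>" for \<alpha>
    proof -
      have "?p k \<alpha> = x k ^ \<alpha> k * ?p (Suc k) \<alpha>"
        using step.hyps(2) by (simp add: prod.atLeast_Suc_lessThan)
      also have "x k ^ \<alpha> k = x k ^ a * x k ^ (\<alpha> k - a)"
        using a[OF that] by (simp flip: power_add)
      finally show ?thesis
        by (simp add: ac_simps)
    qed
    then show ?thesis
      unfolding S_def sum_distrib_left by (rule sum.cong[OF refl])
  qed
  show ?case
  proof
    assume "(\<Sum>\<alpha>\<in>\<Lambda>. const (c \<alpha>) * ?p k \<alpha>) \<in> C k"
    then have "x k ^ a \<in> C k \<or> S \<in> C k"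
      unfolding eq using Ck step.hyps
      by (intro is_primeD(3)[OF _ mspan_monomials_power[OF xR] SR]) auto
    moreover have "x k ^ a \<notin> C k"
      using is_prime_power[OF Ck xR] x(2) step.hyps by (metis less_imp_le)
    ultimately have SC: "S \<in> C (Suc k)"
      using mono step.hyps by blast
    have "const (c \<alpha>) * (x k ^ (\<alpha> k - a) * ?p (Suc k) \<alpha>) \<in> C (Suc k)" if "\<alpha> \<in> \<Lambda> - \<Lambda>'" for \<alpha>
    proof -
      have "a < \<alpha> k"
        using a[of \<alpha>] that by (auto simp: \<Lambda>'_def)
      then obtain b where b: "\<alpha> k - a = Suc b"
        by (metis Suc_diff_Suc)
      have "(const (c \<alpha>) * x k ^ b * ?p (Suc k) \<alpha>) * x k \<in> C (Suc k)"
        using x(1) step.hyps xR pR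
        by (intro is_idealD(4)[OF I1] mspan_monomials_mult mspan_monomials_power const_in_mspan) auto
      then show ?thesis
        by (simp add: b ac_simps)
    qed
    then have rest: "(\<Sum>\<alpha>\<in>\<Lambda> - \<Lambda>'. const (c \<alpha>) * (x k ^ (\<alpha> k - a) * ?p (Suc k) \<alpha>)) \<in> C (Suc k)"
      by (rule is_ideal_sum[OF I1])
    moreover have "S = (\<Sum>\<alpha>\<in>\<Lambda> - \<Lambda>'. const (c \<alpha>) * (x k ^ (\<alpha> k - a) * ?p (Suc k) \<alpha>))
        + (\<Sum>\<alpha>\<in>\<Lambda>'. const (c \<alpha>) * (x k ^ (\<alpha> k - a) * ?p (Suc k) \<alpha>))"
      unfolding S_def by (rule sum.subset_diff) (use step.prems in \<open>auto simp: \<Lambda>'_def\<close>)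
    ultimately have "(\<Sum>\<alpha>\<in>\<Lambda>'. const (c \<alpha>) * (x k ^ (\<alpha> k - a) * ?p (Suc k) \<alpha>)) \<in> C (Suc k)"
      using is_idealD(5)[OF I1 SC rest] by simp
    moreover have "(\<Sum>\<alpha>\<in>\<Lambda>'. const (c \<alpha>) * (x k ^ (\<alpha> k - a) * ?p (Suc k) \<alpha>))
        = (\<Sum>\<alpha>\<in>\<Lambda>'. const (c \<alpha>) * ?p (Suc k) \<alpha>)"
      by (rule sum.cong) (auto simp: \<Lambda>'_def)
    moreover have "(\<Sum>\<alpha>\<in>\<Lambda>'. const (c \<alpha>) * ?p (Suc k) \<alpha>) \<notin> C (Suc k)"
    proof (rule step.IH)
      fix \<alpha> \<beta> assume ab: "\<alpha> \<in> \<Lambda>'" "\<beta> \<in> \<Lambda>'" "\<And>i. Suc k \<le> i \<Longrightarrow> i < n \<Longrightarrow> \<alpha> i = \<beta> i"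
      show "\<alpha> = \<beta>"
      proof (rule step.prems(4))
        fix i assume i: "k \<le> i" "i < n"
        show "\<alpha> i = \<beta> i"
        proof (cases "i = k")
          case True
          then show ?thesis
            using ab(1,2) by (simp add: \<Lambda>'_def)
        next
          case False
          then show ?thesis
            using ab(3)[of i] i by simp
        qed
      qed (use ab(1,2) in \<open>simp_all add: \<Lambda>'_def\<close>)
    qed (use step.prems ne in \<open>auto simp: \<Lambda>'_def\<close>)
    ultimately show False
      by simp
  qed
qed

text \<open>
  This bounds the dimension of a polynomial ring by its number of variables: a longer chain of primes
  would produce too many algebraically independent polynomials.
\<close>

lemma prime_chain_above_var_ideal_le:
  assumes A: "A \<subseteq> {..<r}" and ch: "prime_chain_above r (var_ideal r A :: 'k::field mpol set) n"
  shows "n \<le> r - card A"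
proof (rule ccontr)
  assume n: "\<not> n \<le> r - card A"
  let ?B = "{..<r} - A"
  have B: "card ?B < n"
    using n A by (simp add: card_Diff_subset finite_subset)
  obtain C :: "nat \<Rightarrow> 'k mpol set" where "(\<forall>i\<le>n. is_prime r (C i)) \<and> var_ideal r A \<subseteq> C 0 \<and> (\<forall>i<n. C i \<subset> C (Suc i))"
    using ch unfolding prime_chain_above_def ..
  then have C: "\<And>i. i \<le> n \<Longrightarrow> is_prime r (C i)" "var_ideal r A \<subseteq> C 0"
    "\<And>i. i < n \<Longrightarrow> C i \<subset> C (Suc i)"
    by simp_all
  have AC: "var_ideal r A \<subseteq> C i" if "i \<le> n" for i
    using that
  proof (induction i)
    case (Suc i)
    then show ?case
      using C(3)[of i] by auto
  qed (rule C)
  have "\<forall>i<n. \<exists>x. x \<in> C (Suc i) \<and> x \<notin> C i"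
    using C(3) by blast
  then obtain x where x: "\<And>i. i < n \<Longrightarrow> x i \<in> C (Suc i)" "\<And>i. i < n \<Longrightarrow> x i \<notin> C i"
    by metis
  \<comment> \<open>Modulo the ideal of the variables in \<open>A\<close> only the remaining variables matter.\<close>
  define y where "y i = part (mons_in ?B) (x i)" for i
  have xy: "x i - y i \<in> var_ideal r A" if "i < n" for i
  proof -
    have "x i \<in> mspan (monomials r)"
      using C(1)[of "Suc i"] x(1)[OF that] that is_idealD(1)[OF is_primeD(1)] by (metis Suc_leI)
    then have "supp (x i - y i) \<subseteq> {m \<in> monomials r. supp m \<inter> A \<noteq> {}}"
      unfolding y_def supp_diff_part by (auto simp: mspan_def monomials_def mons_in_def)
    then show ?thesis
      by (simp add: var_ideal_def mspan_def)
  qed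
  have y: "y i \<in> C (Suc i)" "y i \<notin> C i" if i: "i < n" for i
  proof -
    have "x i - y i \<in> C (Suc i)" "x i - y i \<in> C i"
      using AC[of "Suc i"] AC[of i] xy[OF i] i by auto
    moreover have "y i = x i - (x i - y i)" "x i = (x i - y i) + y i"
      by simp_all
    ultimately show "y i \<in> C (Suc i)" "y i \<notin> C i"
      using is_idealD(5)[OF is_primeD(1)[OF C(1)[of "Suc i"]] x(1)[OF i], of "x i - y i"]
        is_idealD(3)[OF is_primeD(1)[OF C(1)[of i]], of "x i - y i" "y i"] x(2)[OF i] i by auto
  qed
  have "y i \<in> mspan (mons_in ?B)" for i
    by (auto simp: y_def mspan_def supp_part)
  then obtain \<Lambda> c where \<Lambda>: "finite \<Lambda>" "\<Lambda> \<noteq> {}" "\<Lambda> \<subseteq> {..<n} \<rightarrow>\<^sub>E UNIV" "\<forall>\<alpha>\<in>\<Lambda>. c \<alpha> \<noteq> 0"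
    "(\<Sum>\<alpha>\<in>\<Lambda>. const (c \<alpha>) * (\<Prod>i<n. y i ^ \<alpha> i)) = 0"
    using algebraically_dependent[of ?B n y] B by auto
  have "(\<Sum>\<alpha>\<in>\<Lambda>. const (c \<alpha>) * (\<Prod>i\<in>{0..<n}. y i ^ \<alpha> i)) \<notin> C 0"
  proof (rule prime_chain_algebraically_independent[where r = r and C = C])
    fix \<alpha> \<beta> assume ab: "\<alpha> \<in> \<Lambda>" "\<beta> \<in> \<Lambda>" "\<And>i. 0 \<le> i \<Longrightarrow> i < n \<Longrightarrow> \<alpha> i = \<beta> i"
    then show "\<alpha> = \<beta>"
      using \<Lambda>(3) by (intro PiE_ext[of \<alpha> "{..<n}" "\<lambda>_. UNIV" \<beta>]) auto
  qed (use C y \<Lambda> in auto)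
  then show False
    using \<Lambda>(5) is_idealD(2)[OF is_primeD(1)[OF C(1)[of 0]]] by (simp add: lessThan_atLeast0)
qed

section \<open>A lower bound for chains of primes\<close>

definition adjoin :: "nat \<Rightarrow> 'k::field mpol set \<Rightarrow> 'k mpol \<Rightarrow> 'k mpol set" where
  "adjoin r I a = {q + x * a |q x. q \<in> I \<and> x \<in> mspan (monomials r)}"

lemma adjoinI: "q \<in> I \<Longrightarrow> x \<in> mspan (monomials r) \<Longrightarrow> q + x * a \<in> adjoin r I a"
  by (auto simp: adjoin_def)

lemma adjoin:
  assumes I: "is_ideal r I" and a: "a \<in> mspan (monomials r)"
  shows "is_ideal r (adjoin r I a)" "I \<subseteq> adjoin r I a" "a \<in> adjoin r I a"
proof -
  show "I \<subseteq> adjoin r I a"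
    using adjoinI[of _ I 0 r a] by auto
  show "a \<in> adjoin r I a"
    using adjoinI[of 0 I 1 r a] is_idealD(2)[OF I] by simp
  show "is_ideal r (adjoin r I a)"
    unfolding is_ideal_def
  proof (intro conjI ballI subsetI)
    show "0 \<in> adjoin r I a"
      using adjoinI[of 0 I 0 r a] is_idealD(2)[OF I] by simp
  next
    fix f assume "f \<in> adjoin r I a"
    then show "f \<in> mspan (monomials r)"
      using is_idealD(1)[OF I] a by (auto simp: adjoin_def intro!: mspan_add mspan_monomials_mult)
  next
    fix f g assume "f \<in> adjoin r I a" "g \<in> adjoin r I a"
    then obtain q x p y where *: "f = q + x * a" "g = p + y * a" "q \<in> I" "p \<in> I"
      "x \<in> mspan (monomials r)" "y \<in> mspan (monomials r)"
      by (auto simp: adjoin_def)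
    have "f + g = (q + p) + (x + y) * a"
      by (simp add: * algebra_simps)
    then show "f + g \<in> adjoin r I a"
      using adjoinI[of "q + p" I "x + y" r a] is_idealD(3)[OF I] * mspan_add by metis
  next
    fix f z :: "'a mpol" assume f: "f \<in> adjoin r I a" and z: "z \<in> mspan (monomials r)"
    then obtain q x where *: "f = q + x * a" "q \<in> I" "x \<in> mspan (monomials r)"
      by (auto simp: adjoin_def)
    have "z * f = z * q + (z * x) * a"
      by (simp add: * algebra_simps)
    then show "z * f \<in> adjoin r I a"
      using adjoinI[OF is_idealD(4)[OF I *(2) z] mspan_monomials_mult[OF z *(3)]] by simp
  qed
qed

text \<open>
  By Zorn's lemma there is an ideal that is maximal among those containing \<open>J\<close> and disjoint from
  \<open>S\<close>; adjoining an outside element makes it meet \<open>S\<close>, and \<open>S\<close> is closed under products.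
\<close>

lemma prime_avoiding:
  fixes J :: "'k::field mpol set"
  assumes J: "is_ideal r J" and S: "1 \<in> S" "\<And>a b. a \<in> S \<Longrightarrow> b \<in> S \<Longrightarrow> a * b \<in> S"
    and disj: "J \<inter> S = {}"
  shows "\<exists>Q. is_prime r Q \<and> J \<subseteq> Q \<and> Q \<inter> S = {}"
proof -
  define F where "F = {I. is_ideal r I \<and> J \<subseteq> I \<and> I \<inter> S = {}}"
  have "J \<in> F"
    using J disj by (simp add: F_def)
  have "\<Union> C \<in> F" if C: "C \<noteq> {}" "subset.chain F C" for C
  proof -
    have CF: "I \<in> F" if "I \<in> C" for I
      using C(2) that by (auto simp: subset.chain_def)
    have id: "is_ideal r I" if "I \<in> C" for I
      using CF[OF that] by (simp add: F_def)
    obtain I0 where I0: "I0 \<in> C"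
      using C(1) by auto
    have "is_ideal r (\<Union> C)"
      unfolding is_ideal_def
    proof (intro conjI ballI subsetI)
      show "0 \<in> \<Union> C"
        using is_idealD(2)[OF id[OF I0]] I0 by blast
    next
      fix a assume "a \<in> \<Union> C"
      then show "a \<in> mspan (monomials r)"
        using is_idealD(1)[OF id] by blast
    next
      fix a b assume "a \<in> \<Union> C" "b \<in> \<Union> C"
      then obtain I I' where I: "a \<in> I" "b \<in> I'" "I \<in> C" "I' \<in> C"
        by blast
      then have "I \<subseteq> I' \<or> I' \<subseteq> I"
        using C(2) by (auto simp: subset_chain_def)
      then show "a + b \<in> \<Union> C"
        using is_idealD(3)[OF id[OF I(3)], of a b] is_idealD(3)[OF id[OF I(4)], of a b] I by blast
    next
      fix a x :: "'k mpol" assume "a \<in> \<Union> C" "x \<in> mspan (monomials r)"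
      then show "x * a \<in> \<Union> C"
        using is_idealD(4)[OF id] by blast
    qed
    moreover have "J \<subseteq> \<Union> C" "\<Union> C \<inter> S = {}"
      using CF I0 by (auto simp: F_def)
    ultimately show ?thesis
      by (simp add: F_def)
  qed
  then obtain Q where Q: "Q \<in> F" and max: "\<And>X. X \<in> F \<Longrightarrow> Q \<subseteq> X \<Longrightarrow> X = Q"
    using subset_Zorn_nonempty[of F] \<open>J \<in> F\<close> by blast
  have QI: "is_ideal r Q" and JQ: "J \<subseteq> Q" and QS: "Q \<inter> S = {}"
    using Q by (auto simp: F_def)
  have meet: "\<exists>q x. q \<in> Q \<and> x \<in> mspan (monomials r) \<and> q + x * a \<in> S"
    if a: "a \<in> mspan (monomials r)" "a \<notin> Q" for a
  proof -
    have "adjoin r Q a \<notin> F"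
      using max[of "adjoin r Q a"] adjoin[OF QI a(1)] a(2) by auto
    then have "adjoin r Q a \<inter> S \<noteq> {}"
      using adjoin[OF QI a(1)] JQ by (auto simp: F_def)
    then show ?thesis
      by (auto simp: adjoin_def)
  qed
  have "is_prime r Q"
    unfolding is_prime_def
  proof (intro conjI ballI impI QI)
    show "1 \<notin> Q"
      using S(1) QS by auto
    fix a b assume ab: "a \<in> mspan (monomials r)" "b \<in> mspan (monomials r)" "a * b \<in> Q"
    show "a \<in> Q \<or> b \<in> Q"
    proof (rule ccontr)
      assume "\<not> (a \<in> Q \<or> b \<in> Q)"
      then obtain q x p y where *: "q \<in> Q" "x \<in> mspan (monomials r)" "q + x * a \<in> S"
        "p \<in> Q" "y \<in> mspan (monomials r)" "p + y * b \<in> S"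
        using meet[OF ab(1)] meet[OF ab(2)] by blast
      have "(p + y * b) * q + ((x * a) * p + (x * y) * (a * b)) \<in> Q"
      proof (intro is_idealD(3)[OF QI])
        have "q + x * a \<in> mspan (monomials r)" "p + y * b \<in> mspan (monomials r)"
          using ab * is_idealD(1)[OF QI] by (auto intro: mspan_add mspan_monomials_mult)
        then show "(p + y * b) * q \<in> Q"
          using *(1) by (intro is_idealD(4)[OF QI])
        show "(x * a) * p \<in> Q"
          by (rule is_idealD(4)[OF QI *(4) mspan_monomials_mult[OF *(2) ab(1)]])
        show "(x * y) * (a * b) \<in> Q"
          by (rule is_idealD(4)[OF QI ab(3) mspan_monomials_mult[OF *(2,5)]])
      qed
      also have "(p + y * b) * q + ((x * a) * p + (x * y) * (a * b)) = (q + x * a) * (p + y * b)"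
        by (simp add: algebra_simps)
      finally show False
        using S(2)[OF *(3,6)] QS by blast
    qed
  qed
  then show ?thesis
    using JQ QS by blast
qed

text \<open>
  If all of the ring is \<open>in_span (mons_in B) Q T\<close> for a finite \<open>T\<close>, then \<open>R/Q\<close> is a finite module over the
  polynomial ring in the variables \<open>B\<close>.
\<close>

definition in_span :: "mon set \<Rightarrow> 'k::field mpol set \<Rightarrow> 'k mpol set \<Rightarrow> 'k mpol \<Rightarrow> bool" where
  "in_span K Q W g \<longleftrightarrow> (\<exists>s. (\<forall>\<omega>\<in>W. s \<omega> \<in> mspan K) \<and> g - (\<Sum>\<omega>\<in>W. s \<omega> * \<omega>) \<in> Q)"

definition independent_mod :: "mon set \<Rightarrow> 'k::field mpol set \<Rightarrow> 'k mpol set \<Rightarrow> bool" where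
  "independent_mod K Q W \<longleftrightarrow> (\<forall>s. (\<forall>\<omega>\<in>W. s \<omega> \<in> mspan K) \<longrightarrow>
     (\<Sum>\<omega>\<in>W. s \<omega> * \<omega>) \<in> Q \<longrightarrow> (\<forall>\<omega>\<in>W. s \<omega> = 0))"

lemma in_span_add:
  assumes "is_ideal r Q" "in_span K Q W f" "in_span K Q W g"
  shows "in_span K Q W (f + g)"
proof -
  obtain s t where "\<forall>\<omega>\<in>W. s \<omega> \<in> mspan K" "f - (\<Sum>\<omega>\<in>W. s \<omega> * \<omega>) \<in> Q"
    "\<forall>\<omega>\<in>W. t \<omega> \<in> mspan K" "g - (\<Sum>\<omega>\<in>W. t \<omega> * \<omega>) \<in> Q"
    using assms(2,3) by (auto simp: in_span_def)
  moreover from this have "f - (\<Sum>\<omega>\<in>W. s \<omega> * \<omega>) + (g - (\<Sum>\<omega>\<in>W. t \<omega> * \<omega>)) \<in> Q"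
    using is_idealD(3)[OF assms(1)] by blast
  ultimately show ?thesis
    unfolding in_span_def
    by (intro exI[of _ "\<lambda>\<omega>. s \<omega> + t \<omega>"]) (auto simp: algebra_simps sum.distrib intro: mspan_add)
qed

lemma in_span_ideal: "is_ideal r Q \<Longrightarrow> q \<in> Q \<Longrightarrow> in_span K Q W q"
  unfolding in_span_def by (intro exI[of _ "\<lambda>_. 0"]) auto

lemma in_span_member:
  assumes "is_ideal r Q" "finite W" "\<tau> \<in> W" "0 \<in> K"
  shows "in_span K Q W \<tau>"
proof -
  have "(\<Sum>\<omega>\<in>W. (if \<omega> = \<tau> then 1 else 0) * \<omega>) = (\<Sum>\<omega>\<in>W. if \<omega> = \<tau> then \<tau> else 0)"
    by (rule sum.cong) auto
  also have "\<dots> = \<tau>"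
    using assms(2,3) by simp
  finally show ?thesis
    unfolding in_span_def using is_idealD(2)[OF assms(1)] assms(4)
    by (intro exI[of _ "\<lambda>\<omega>. if \<omega> = \<tau> then 1 else 0"]) auto
qed

lemma in_span_sum:
  assumes "is_ideal r Q" "\<And>x. x \<in> X \<Longrightarrow> in_span K Q W (f x)"
  shows "in_span K Q W (sum f X)"
  using assms(2)
  by (induction X rule: infinite_finite_induct)
    (auto intro: in_span_add[OF assms(1)] in_span_ideal[OF assms(1)] is_idealD(2)[OF assms(1)])

lemma in_span_mult:
  assumes Q: "is_ideal r Q" and B: "B \<subseteq> {..<r}" and c: "c \<in> mspan (mons_in B)"
    and g: "in_span (mons_in B) Q W g"
  shows "in_span (mons_in B) Q W (c * g)"
proof -
  obtain s where s: "\<forall>\<omega>\<in>W. s \<omega> \<in> mspan (mons_in B)" "g - (\<Sum>\<omega>\<in>W. s \<omega> * \<omega>) \<in> Q"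
    using g by (auto simp: in_span_def)
  have "c \<in> mspan (monomials r)"
    using c mspan_mono[OF mons_in_mono[OF B]] by (auto simp: monomials_eq)
  then have "c * (g - (\<Sum>\<omega>\<in>W. s \<omega> * \<omega>)) \<in> Q"
    by (rule is_idealD(4)[OF Q s(2)])
  moreover have "c * (g - (\<Sum>\<omega>\<in>W. s \<omega> * \<omega>)) = c * g - (\<Sum>\<omega>\<in>W. (c * s \<omega>) * \<omega>)"
    by (simp add: right_diff_distrib sum_distrib_left mult.assoc)
  ultimately show ?thesis
    unfolding in_span_def using s(1) mspan_mons_in_mult[OF c]
    by (intro exI[of _ "\<lambda>\<omega>. c * s \<omega>"]) auto
qed

text \<open>
  Up to one denominator a finite module is contained in a free one: take a maximal independent set \<open>W\<close>
  of generators that contains \<open>1\<close>, and multiply the denominators of the remaining generators.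
\<close>

lemma common_denominator:
  fixes Q :: "'k::field mpol set"
  assumes Q: "is_ideal r Q" and B: "B \<subseteq> {..<r}"
    and indep: "\<And>p. p \<in> Q \<Longrightarrow> p \<in> mspan (mons_in B) \<Longrightarrow> p = 0"
    and T: "finite T"
    and gen: "\<And>f. f \<in> mspan (monomials r) \<Longrightarrow> in_span (mons_in B) Q T f"
  shows "\<exists>W d. finite W \<and> 1 \<in> W \<and> independent_mod (mons_in B) Q W \<and>
    d \<in> mspan (mons_in B) \<and> d \<noteq> 0 \<and> (\<forall>f\<in>mspan (monomials r). in_span (mons_in B) Q W (d * f))"
proof -
  let ?K = "mspan (mons_in B) :: 'k mpol set"
  define Ws where "Ws = {W. W \<subseteq> insert 1 T \<and> 1 \<in> W \<and> independent_mod (mons_in B) Q W}"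
  have "{1} \<in> Ws"
    using indep by (auto simp: Ws_def independent_mod_def)
  moreover have "\<forall>W. W \<in> Ws \<longrightarrow> card W < Suc (card (insert 1 T))"
    using T card_mono[of "insert 1 T"] by (auto simp: Ws_def less_Suc_eq_le)
  ultimately have "\<exists>W. W \<in> Ws \<and> (\<forall>W'. W' \<in> Ws \<longrightarrow> card W' \<le> card W)"
    by (rule Lattices_Big.ex_has_greatest_nat)
  then obtain W where W: "W \<in> Ws" and max: "\<And>W'. W' \<in> Ws \<Longrightarrow> card W' \<le> card W"
    by auto
  have WT: "W \<subseteq> insert 1 T" "1 \<in> W" and Wi: "independent_mod (mons_in B) Q W"
    using W by (auto simp: Ws_def)
  have finW: "finite W"
    using WT T finite_subset by blast
  have "\<exists>d\<in>?K. d \<noteq> 0 \<and> in_span (mons_in B) Q W (d * \<tau>)" if \<tau>: "\<tau> \<in> T" for \<tau>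
  proof (cases "\<tau> \<in> W")
    case True
    have "in_span (mons_in B) Q W \<tau>"
      by (rule in_span_member[OF Q finW True]) simp
    then show ?thesis
      by (intro bexI[of _ 1]) auto
  next
    case False
    have "insert \<tau> W \<notin> Ws"
      using max[of "insert \<tau> W"] False finW by auto
    then have "\<not> independent_mod (mons_in B) Q (insert \<tau> W)"
      using WT \<tau> by (auto simp: Ws_def)
    then obtain s where s: "\<forall>\<omega>\<in>insert \<tau> W. s \<omega> \<in> ?K" "(\<Sum>\<omega>\<in>insert \<tau> W. s \<omega> * \<omega>) \<in> Q"
      "\<exists>\<omega>\<in>insert \<tau> W. s \<omega> \<noteq> 0"
      by (auto simp: independent_mod_def)
    have eq: "(\<Sum>\<omega>\<in>insert \<tau> W. s \<omega> * \<omega>) = s \<tau> * \<tau> + (\<Sum>\<omega>\<in>W. s \<omega> * \<omega>)"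
      using False finW by simp
    have "s \<tau> \<noteq> 0"
    proof
      assume 0: "s \<tau> = 0"
      then have "(\<Sum>\<omega>\<in>W. s \<omega> * \<omega>) \<in> Q"
        using s(2) unfolding eq by simp
      then have "\<forall>\<omega>\<in>W. s \<omega> = 0"
        using Wi s(1) by (auto simp: independent_mod_def)
      then show False
        using s(3) 0 by auto
    qed
    moreover have "in_span (mons_in B) Q W (s \<tau> * \<tau>)"
      unfolding in_span_def using s(1,2) unfolding eq
      by (intro exI[of _ "\<lambda>\<omega>. - s \<omega>"]) (auto simp: sum_negf)
    ultimately show ?thesis
      using s(1) by blast
  qed
  then obtain d where d: "\<And>\<tau>. \<tau> \<in> T \<Longrightarrow> d \<tau> \<in> ?K" "\<And>\<tau>. \<tau> \<in> T \<Longrightarrow> d \<tau> \<noteq> 0"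
    "\<And>\<tau>. \<tau> \<in> T \<Longrightarrow> in_span (mons_in B) Q W (d \<tau> * \<tau>)"
    by metis
  have "in_span (mons_in B) Q W (prod d T * f)" if f: "f \<in> mspan (monomials r)" for f
  proof -
    obtain s where s: "\<forall>\<tau>\<in>T. s \<tau> \<in> ?K" "f - (\<Sum>\<tau>\<in>T. s \<tau> * \<tau>) \<in> Q"
      using gen[OF f] by (auto simp: in_span_def)
    have "prod d T \<in> ?K"
      by (rule mspan_mons_in_prod) (rule d)
    then have "prod d T \<in> mspan (monomials r)"
      using mspan_mono[OF mons_in_mono[OF B]] by (auto simp: monomials_eq)
    then have 1: "prod d T * (f - (\<Sum>\<tau>\<in>T. s \<tau> * \<tau>)) \<in> Q"
      by (rule is_idealD(4)[OF Q s(2)])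
    have 2: "in_span (mons_in B) Q W (prod d T * (s \<tau> * \<tau>))" if \<tau>: "\<tau> \<in> T" for \<tau>
    proof -
      have "in_span (mons_in B) Q W ((prod d (T - {\<tau>}) * s \<tau>) * (d \<tau> * \<tau>))"
        using s(1) \<tau> d(1) by (intro in_span_mult[OF Q B _ d(3)[OF \<tau>]] mspan_mons_in_mult mspan_mons_in_prod) auto
      moreover have "prod d T = d \<tau> * prod d (T - {\<tau>})"
        using T \<tau> by (rule prod.remove)
      ultimately show ?thesis
        by (simp add: ac_simps)
    qed
    have "in_span (mons_in B) Q W (prod d T * (f - (\<Sum>\<tau>\<in>T. s \<tau> * \<tau>)) + (\<Sum>\<tau>\<in>T. prod d T * (s \<tau> * \<tau>)))"
      by (rule in_span_add[OF Q in_span_ideal[OF Q 1] in_span_sum[OF Q 2]])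
    then show ?thesis
      by (simp add: right_diff_distrib flip: sum_distrib_left)
  qed
  moreover have "prod d T \<in> ?K"
    by (rule mspan_mons_in_prod) (rule d)
  moreover have "prod d T \<noteq> 0"
    using d T by simp
  ultimately show ?thesis
    using finW WT Wi by (intro exI[of _ W] exI[of _ "prod d T"]) blast
qed

text \<open>
  If \<open>w = y h\<close> modulo \<open>Q\<close> with \<open>w\<close> free of \<open>y\<close>, then \<open>d w\<^sup>n = y\<^sup>n d h\<^sup>n\<close>; comparing coefficients of \<open>1\<close>
  in the free module that contains \<open>d h\<^sup>n\<close> shows that \<open>y\<^sup>n\<close> divides \<open>d w\<^sup>n\<close>. If \<open>w\<close> were not zero,
  \<open>y\<^sup>n\<close> would divide the fixed polynomial \<open>d\<close> for all \<open>n\<close>. So the ideal generated by \<open>Q\<close> and \<open>y\<close>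
  contains no polynomial in the other variables of \<open>B\<close> except zero. This argument takes the place of integral
  equations in the usual proof of going-up.
\<close>

lemma contraction_of_adjoined_variable:
  fixes Q :: "'k::field mpol set"
  assumes Q: "is_ideal r Q" and B: "B \<subseteq> {..<r}" "y \<in> B"
    and indep: "\<And>p. p \<in> Q \<Longrightarrow> p \<in> mspan (mons_in B) \<Longrightarrow> p = 0"
    and T: "finite T"
    and gen: "\<And>f. f \<in> mspan (monomials r) \<Longrightarrow> in_span (mons_in B) Q T f"
    and w: "w \<in> mspan (mons_in (B - {y}))" and h: "h \<in> mspan (monomials r)"
    and wh: "w - var y * h \<in> Q"
  shows "w = 0"
proof (rule ccontr)
  assume w0: "w \<noteq> 0"
  obtain W d where W: "finite W" "1 \<in> W" "independent_mod (mons_in B) Q W"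
    and d: "d \<in> mspan (mons_in B)" "d \<noteq> 0" "\<And>f. f \<in> mspan (monomials r) \<Longrightarrow> in_span (mons_in B) Q W (d * f)"
    using common_denominator[OF Q B(1) indep T gen] by blast
  obtain e where e: "d \<in> mspan (box B e)"
    using poly_in_box[OF d(1)] by blast
  \<comment> \<open>An exponent larger than every exponent of \<open>y\<close> in \<open>d\<close>.\<close>
  let ?n = "Suc e" and ?R = "mspan (monomials r) :: 'k mpol set"
  have KR: "mspan (mons_in B) \<subseteq> ?R" and wB: "w \<in> mspan (mons_in B)"
    using mspan_mono[OF mons_in_mono[OF B(1)]] w mspan_mono[OF mons_in_mono[of "B - {y}" B]]
    by (auto simp: monomials_eq)
  have yR: "var y \<in> ?R"
    using B by (intro var_in_polys) auto
  have wR: "w \<in> ?R" and dR: "d \<in> ?R"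
    using KR wB d(1) by auto
  have pow: "w ^ n - (var y * h) ^ n \<in> Q" for n
  proof (induction n)
    case (Suc n)
    have "w * (w ^ n - (var y * h) ^ n) + (var y * h) ^ n * (w - var y * h) \<in> Q"
      using Suc wh wR yR h
      by (intro is_idealD(3)[OF Q] is_idealD(4)[OF Q] mspan_monomials_power mspan_monomials_mult)
    then show ?case
      by (simp add: algebra_simps)
  qed (simp add: is_idealD(2)[OF Q])
  obtain s where s: "\<forall>\<omega>\<in>W. s \<omega> \<in> mspan (mons_in B)" "d * h ^ ?n - (\<Sum>\<omega>\<in>W. s \<omega> * \<omega>) \<in> Q"
    using d(3)[OF mspan_monomials_power[OF h]] unfolding in_span_def by blast
  let ?y = "var y ^ ?n :: 'k mpol"
  have yB: "?y \<in> mspan (mons_in B)"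
    using B by (intro mspan_mons_in_power) (simp add: var_def mons_in_single)
  \<comment> \<open>The coefficients of the relation \<open>d w\<^sup>n - y\<^sup>n d h\<^sup>n = 0\<close> over the independent set \<open>W\<close>.\<close>
  define t where "t \<omega> = (if \<omega> = 1 then d * w ^ ?n else 0) - ?y * s \<omega>" for \<omega>
  have "(\<Sum>\<omega>\<in>W. t \<omega> * \<omega>) = (\<Sum>\<omega>\<in>W. (if \<omega> = 1 then d * w ^ ?n else 0) - ?y * (s \<omega> * \<omega>))"
    by (rule sum.cong) (auto simp: t_def left_diff_distrib mult.assoc)
  also have "\<dots> = d * w ^ ?n - ?y * (\<Sum>\<omega>\<in>W. s \<omega> * \<omega>)"
    using W(1,2) by (simp only: sum_subtractf sum_distrib_left) (simp add: sum.delta)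
  also have "\<dots> = d * (w ^ ?n - (var y * h) ^ ?n) + ?y * (d * h ^ ?n - (\<Sum>\<omega>\<in>W. s \<omega> * \<omega>))"
    by (simp only: right_diff_distrib power_mult_distrib ac_simps) simp
  also have "\<dots> \<in> Q"
    using pow s(2) dR yR by (intro is_idealD(3)[OF Q] is_idealD(4)[OF Q] mspan_monomials_power)
  finally have "(\<Sum>\<omega>\<in>W. t \<omega> * \<omega>) \<in> Q" .
  moreover have "\<forall>\<omega>\<in>W. t \<omega> \<in> mspan (mons_in B)"
    using s(1) yB d(1) wB
    by (auto simp: t_def simp del: power_Suc intro!: mspan_diff mspan_mons_in_mult mspan_mons_in_power)
  ultimately have "t 1 = 0"
    using W(2,3) by (auto simp: independent_mod_def)
  then have eq: "d * w ^ ?n = ?y * s 1"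
    by (simp add: t_def)
  have "d * w ^ ?n \<in> mspan {m. coef m y \<le> e}"
  proof (rule mspan_mult)
    show "w ^ ?n \<in> mspan (mons_in (B - {y}))"
      using w by (rule mspan_mons_in_power)
    fix m n :: mon assume "m \<in> box B e" "n \<in> mons_in (B - {y})"
    then have "coef m y \<le> e" "y \<notin> supp n"
      by (auto simp: box_def mons_in_def)
    then show "m + n \<in> {m. coef m y \<le> e}"
      by (simp add: lookup_add in_keys_iff)
  qed (rule e)
  moreover have "?y * s 1 \<in> mspan {m. ?n \<le> coef m y}"
  proof -
    have ypow: "var y ^ n = (single (single y n) 1 :: 'k mpol)" for n
    proof (induction n)
      case (Suc n)
      then show ?case
        by (simp add: var_def mult_single flip: single_add)
    qed simp
    show ?thesis
      unfolding ypow by (auto simp: mspan_def supp_single_mult lookup_add)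
  qed
  ultimately have "supp (d * w ^ ?n) = {}"
    unfolding eq by (fastforce simp: mspan_def)
  then show False
    using d(2) w0 by simp
qed

text \<open>
  One step of going-up: a prime above \<open>Q\<close> that contains \<open>y\<close> and leaves the variables \<open>B - {y}\<close>
  independent, so that the same hypotheses hold again with one variable less.
\<close>

lemma prime_step:
  fixes Q :: "'k::field mpol set"
  assumes Qp: "is_prime r Q" and B: "B \<subseteq> {..<r}" "y \<in> B"
    and indep: "\<And>p. p \<in> Q \<Longrightarrow> p \<in> mspan (mons_in B) \<Longrightarrow> p = 0"
    and T: "finite T" "T \<subseteq> mspan (monomials r)"
    and gen: "\<And>f. f \<in> mspan (monomials r) \<Longrightarrow> in_span (mons_in B) Q T f"
  obtains Q' where "is_prime r Q'" "Q \<subset> Q'"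
    "\<And>p. p \<in> Q' \<Longrightarrow> p \<in> mspan (mons_in (B - {y})) \<Longrightarrow> p = 0"
    "\<And>f. f \<in> mspan (monomials r) \<Longrightarrow> in_span (mons_in (B - {y})) Q' T f"
proof -
  let ?K = "mspan (mons_in (B - {y})) :: 'k mpol set" and ?R = "mspan (monomials r) :: 'k mpol set"
  note Q = is_primeD(1)[OF Qp]
  have yr: "y < r"
    using B by auto
  have yR: "var y \<in> ?R"
    using yr by (rule var_in_polys)
  have disj: "adjoin r Q (var y) \<inter> (?K - {0}) = {}"
  proof -
    have "w = 0" if "q \<in> Q" "x \<in> ?R" "w = q + x * var y" "w \<in> ?K" for w q x
      using contraction_of_adjoined_variable[OF Q B indep T(1) gen that(4,2)] that(1,3)
      by (simp add: mult.commute)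
    then show ?thesis
      unfolding adjoin_def by blast
  qed
  obtain Q' where Q': "is_prime r Q'" "adjoin r Q (var y) \<subseteq> Q'" "Q' \<inter> (?K - {0}) = {}"
    using prime_avoiding[OF adjoin(1)[OF Q yR] _ _ disj] mspan_mons_in_mult by auto
  note Q'I = is_primeD(1)[OF Q'(1)]
  have QQ': "Q \<subseteq> Q'" "var y \<in> Q'"
    using adjoin[OF Q yR] Q'(2) by auto
  have "var y \<notin> Q"
    using indep[of "var y"] B by (auto simp: var_def mons_in_single dest!: arg_cong[of _ _ supp])
  then have "Q \<subset> Q'"
    using QQ' by blast
  moreover have "in_span (mons_in (B - {y})) Q' T f" if f: "f \<in> ?R" for f
  proof -
    obtain s where s: "\<forall>\<omega>\<in>T. s \<omega> \<in> mspan (mons_in B)" "f - (\<Sum>\<omega>\<in>T. s \<omega> * \<omega>) \<in> Q"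
      using gen[OF f] by (auto simp: in_span_def)
    let ?s = "\<lambda>\<omega>. part (mons_in (B - {y})) (s \<omega>)"
    have "(s \<omega> - ?s \<omega>) * \<omega> \<in> Q'" if \<omega>: "\<omega> \<in> T" for \<omega>
    proof -
      have "s \<omega> - ?s \<omega> \<in> var_ideal r {y}"
        using s(1) \<omega> B(1) by (auto simp: var_ideal_def mspan_def supp_diff_part mons_in_def monomials_def subset_iff)
      then have "s \<omega> - ?s \<omega> \<in> Q'"
        using var_ideal_subset[OF Q'I, of "{y}"] QQ'(2) by auto
      then show ?thesis
        using is_idealD(4)[OF Q'I, of "s \<omega> - ?s \<omega>" \<omega>] \<omega> T(2) by (auto simp: mult.commute)
    qed
    then have "(\<Sum>\<omega>\<in>T. (s \<omega> - ?s \<omega>) * \<omega>) \<in> Q'"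
      by (rule is_ideal_sum[OF Q'I])
    then have "(f - (\<Sum>\<omega>\<in>T. s \<omega> * \<omega>)) + (\<Sum>\<omega>\<in>T. (s \<omega> - ?s \<omega>) * \<omega>) \<in> Q'"
      using is_idealD(3)[OF Q'I] s(2) QQ'(1) by blast
    then have "f - (\<Sum>\<omega>\<in>T. ?s \<omega> * \<omega>) \<in> Q'"
      by (simp add: left_diff_distrib sum_subtractf)
    moreover have "?s \<omega> \<in> ?K" for \<omega>
      by (auto simp: mspan_def supp_part)
    ultimately show ?thesis
      unfolding in_span_def by (intro exI[of _ ?s]) simp
  qed
  moreover have "p = 0" if "p \<in> Q'" "p \<in> ?K" for p
    using Q'(3) that by blast
  ultimately show ?thesis
    using that[OF Q'(1)] by blast
qed

lemma prime_chain_of_independent_variables: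
  fixes Q :: "'k::field mpol set"
  assumes "is_prime r Q" "B \<subseteq> {..<r}"
    and "\<And>p. p \<in> Q \<Longrightarrow> p \<in> mspan (mons_in B) \<Longrightarrow> p = 0"
    and T: "finite T" "T \<subseteq> mspan (monomials r)"
    and "\<And>f. f \<in> mspan (monomials r) \<Longrightarrow> in_span (mons_in B) Q T f"
  shows "prime_chain_above r Q (card B)"
  using assms(1-3,6)
proof (induction "card B" arbitrary: B Q)
  case 0
  then show ?case
    unfolding prime_chain_above_def by (intro exI[of _ "\<lambda>_. Q"]) simp
next
  case (Suc n)
  then have "B \<noteq> {}"
    by auto
  then obtain y where y: "y \<in> B"
    by auto
  obtain Q' where Q': "is_prime r Q'" "Q \<subset> Q'"
    "\<And>p. p \<in> Q' \<Longrightarrow> p \<in> mspan (mons_in (B - {y})) \<Longrightarrow> p = 0"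
    "\<And>f. f \<in> mspan (monomials r) \<Longrightarrow> in_span (mons_in (B - {y})) Q' T f"
    using prime_step[OF Suc.prems(1,2) y Suc.prems(3) T Suc.prems(4)] by blast
  have n: "n = card (B - {y})"
    using Suc.hyps(2) y by simp
  have "prime_chain_above r Q' (card (B - {y}))"
    by (rule Suc.hyps(1)[OF n Q'(1) _ Q'(3,4)]) (use Suc.prems(2) in auto)
  then have "prime_chain_above r Q' n"
    by (simp only: n[symmetric])
  then obtain C where "(\<forall>i\<le>n. is_prime r (C i)) \<and> Q' \<subseteq> C 0 \<and> (\<forall>i<n. C i \<subset> C (Suc i))"
    unfolding prime_chain_above_def ..
  then have "(\<forall>i\<le>Suc n. is_prime r (case_nat Q C i)) \<and> Q \<subseteq> case_nat Q C 0 \<and>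
      (\<forall>i<Suc n. case_nat Q C i \<subset> case_nat Q C (Suc i))"
    using Suc.prems(1) Q'(2) by (auto split: nat.split)
  then show ?case
    unfolding prime_chain_above_def Suc.hyps(2)[symmetric] by (rule exI[of _ "case_nat Q C"])
qed

lemma krull_dim_var_ideal:
  assumes A: "A \<subseteq> {..<r}"
  shows "krull_dim (poly_ring r Quot (var_ideal r A :: 'k::field mpol set)) = enat (r - card A)"
proof -
  let ?V = "var_ideal r A :: 'k mpol set" and ?B = "{..<r} - A"
  have "prime_chain_above r ?V (card ?B)"
  proof (rule prime_chain_of_independent_variables[where T = "{1}"])
    show "p = 0" if "p \<in> ?V" "p \<in> mspan (mons_in ?B)" for p :: "'k mpol"
    proof -
      have "supp p = {}"
        using that unfolding var_ideal_def mspan_def mons_in_def by blast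
      then show ?thesis
        by simp
    qed
    fix f :: "'k mpol" assume f: "f \<in> mspan (monomials r)"
    have "f - part (mons_in ?B) f \<in> ?V"
      using f by (auto simp: var_ideal_def mspan_def supp_diff_part mons_in_def monomials_def)
    moreover have "part (mons_in ?B) f \<in> mspan (mons_in ?B)"
      by (auto simp: mspan_def supp_part)
    ultimately show "in_span (mons_in ?B) ?V {1} f"
      unfolding in_span_def by (intro exI[of _ "\<lambda>_. part (mons_in ?B) f"]) simp
  qed (auto simp: is_prime_var_ideal)
  moreover have "card ?B = r - card A"
    using A by (simp add: card_Diff_subset finite_subset)
  ultimately have "prime_chain_above r ?V (r - card A)"
    by simp
  then show ?thesis
    unfolding krull_dim_poly_Quot[OF is_ideal_var_ideal]
    by (intro antisym Sup_least Sup_upper) (auto dest: prime_chain_above_var_ideal_le[OF A])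
qed

section \<open>Leading monomials and normal forms\<close>

lemma part_add: "part M (f + g) = part M f + part M g"
  by (rule poly_mapping_eqI) (simp add: coef_part lookup_add)

lemma part_sum: "part M (sum f X) = (\<Sum>x\<in>X. part M (f x))"
  by (rule poly_mapping_eqI) (simp add: coef_part lookup_sum)

lemma part_single_mult:
  "part M (single u c * f) = single u c * part {m. u + m \<in> M} f"
proof (cases "c = 0")
  case False
  have *: "supp (part M (single u c * f)) \<subseteq> (+) u ` supp f"
    "supp (single u c * part {m. u + m \<in> M} f) \<subseteq> (+) u ` supp f"
    using False by (auto simp: supp_part supp_single_mult)
  show ?thesis
  proof (rule poly_mapping_eqI)
    fix k
    show "coef (part M (single u c * f)) k = coef (single u c * part {m. u + m \<in> M} f) k"
    proof (cases "k \<in> (+) u ` supp f")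
      case True
      then obtain m where "k = u + m"
        by auto
      then show ?thesis
        by (simp add: coef_part)
    next
      case False
      then have "k \<notin> supp (part M (single u c * f))" "k \<notin> supp (single u c * part {m. u + m \<in> M} f)"
        using * by blast+
      then show ?thesis
        by (simp add: in_keys_iff)
    qed
  qed
qed (simp add: part_def)

text \<open>
  \<open>mspan (forms r d)\<close> consists of the forms of degree \<open>d\<close>, and
  \<open>part (forms r d)\<close> takes the homogeneous component.
\<close>

definition forms :: "nat \<Rightarrow> nat \<Rightarrow> mon set" where
  "forms r d = {m \<in> monomials r. mon_degree r m = d}"

text \<open>
  The polynomials all of whose homogeneous components lie in \<open>P\<close> form an ideal that contains the
  homogeneous generators of \<open>P\<close>.
\<close>

lemma homogeneous_ideal_part:
  assumes P: "homogeneous_ideal r P" and f: "f \<in> P"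
  shows "part (forms r d) f \<in> (P :: 'k::field mpol set)"
proof -
  interpret cring "poly_ring r :: 'k mpol ring" by (rule cring_poly_ring)
  let ?R = "mspan (monomials r) :: 'k mpol set"
  obtain S where S: "\<And>f. f \<in> S \<Longrightarrow> \<exists>d. homogeneous r d f" and PS: "P = Idl\<^bsub>poly_ring r\<^esub> S"
    using P by (auto simp: homogeneous_ideal_def)
  have SR: "S \<subseteq> carrier (poly_ring r)"
    using S by (auto simp: homogeneous_def)
  have I: "is_ideal r P"
    unfolding PS using genideal_ideal[OF SR] by (simp add: ideal_poly_ring_iff)
  have SP: "S \<subseteq> P"
    unfolding PS by (rule genideal_self[OF SR])
  define J where "J = {f \<in> ?R. \<forall>d. part (forms r d) f \<in> P}"
  have part0: "part M 0 = (0 :: 'k mpol)" for M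
    by (simp add: part_def)
  have "is_ideal r J"
    unfolding is_ideal_def
  proof (intro conjI ballI)
    show "J \<subseteq> ?R"
      by (auto simp: J_def)
    show "0 \<in> J"
      using is_idealD(2)[OF I] by (simp add: J_def part0)
    show "a + b \<in> J" if "a \<in> J" "b \<in> J" for a b
      using that is_idealD(3)[OF I] by (simp add: J_def part_add mspan_add)
    show "x * a \<in> J" if a: "a \<in> J" and x: "x \<in> ?R" for a x
    proof -
      have "part (forms r d) (x * a) \<in> P" for d
      proof -
        have "x * a = (\<Sum>m\<in>supp x. single m (coef x m) * a)"
          by (simp only: poly_sum_terms flip: sum_distrib_right)
        then have eq: "part (forms r d) (x * a) = (\<Sum>m\<in>supp x. single m (coef x m) * part {n. m + n \<in> forms r d} a)"
          by (simp add: part_sum part_single_mult)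
        have "single m (coef x m) * part {n. m + n \<in> forms r d} a \<in> P" if "m \<in> supp x" for m
        proof (rule is_idealD(4)[OF I])
          have m: "m \<in> monomials r"
            using x that by (rule mspanD)
          then show "single m (coef x m) \<in> ?R"
            by simp
          show "part {n. m + n \<in> forms r d} a \<in> P"
          proof (cases "mon_degree r m \<le> d")
            case True
            then have "{n. m + n \<in> forms r d} = forms r (d - mon_degree r m)"
              using m by (auto simp: forms_def mon_degree_add monomials_eq)
            then show ?thesis
              using a by (simp add: J_def)
          next
            case False
            then have "{n. m + n \<in> forms r d} = {}"
              by (auto simp: forms_def mon_degree_add)
            then show ?thesis
              using is_idealD(2)[OF I] by (simp add: part_def)
          qed
        qed
        then show ?thesis
          unfolding eq by (rule is_ideal_sum[OF I])
      qed
      moreover have "x * a \<in> ?R"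
        using a x by (auto simp: J_def intro: mspan_monomials_mult)
      ultimately show ?thesis
        by (simp add: J_def)
    qed
  qed
  moreover have "S \<subseteq> J"
  proof
    fix f assume f: "f \<in> S"
    then obtain e where e: "homogeneous r e f"
      using S by blast
    have "part (forms r d) f \<in> P" for d
    proof (cases "d = e")
      case True
      then have "part (forms r d) f = f"
        using e by (intro poly_mapping_eqI)
          (auto simp: coef_part forms_def homogeneous_def carrier_poly_ring mspan_def in_keys_iff subset_iff)
      then show ?thesis
        using f SP by auto
    next
      case False
      then have "supp (part (forms r d) f) = {}"
        using e by (auto simp: supp_part forms_def homogeneous_def)
      then show ?thesis
        using is_idealD(2)[OF I] by simp
    qed
    then show "f \<in> J"
      using e by (simp add: J_def homogeneous_def carrier_poly_ring)
  qed
  ultimately have "P \<subseteq> J"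
    unfolding PS by (intro genideal_minimal) (simp_all add: ideal_poly_ring_iff)
  then show ?thesis
    using f by (auto simp: J_def)
qed

context
  fixes r :: nat and ord :: "mon rel"
  assumes ord: "monomial_order r ord"
begin

lemma ord_refl: "m \<in> monomials r \<Longrightarrow> (m, m) \<in> ord"
  using ord by (auto simp: monomial_order_def order_on_defs refl_on_def)

lemma ord_trans: "(a, b) \<in> ord \<Longrightarrow> (b, c) \<in> ord \<Longrightarrow> (a, c) \<in> ord"
  using ord by (auto simp: monomial_order_def order_on_defs dest: transD)

lemma ord_antisym: "(a, b) \<in> ord \<Longrightarrow> (b, a) \<in> ord \<Longrightarrow> a = b"
  using ord by (auto simp: monomial_order_def order_on_defs dest: antisymD)

lemma ord_total: "a \<in> monomials r \<Longrightarrow> b \<in> monomials r \<Longrightarrow> (a, b) \<in> ord \<or> (b, a) \<in> ord"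
  using ord_refl[of a] ord
  by (cases "a = b") (simp_all add: monomial_order_def linear_order_on_def total_on_def)

lemma ord_add:
  "a \<in> monomials r \<Longrightarrow> b \<in> monomials r \<Longrightarrow> n \<in> monomials r \<Longrightarrow> (a, b) \<in> ord \<Longrightarrow> (n + a, n + b) \<in> ord"
  using ord by (auto simp: monomial_order_def)

lemma ord_multiple: "m \<in> monomials r \<Longrightarrow> n \<in> monomials r \<Longrightarrow> (m, m + n) \<in> ord"
  using ord_add[of 0 n m] ord by (auto simp: monomial_order_def)

definition mon_less :: "mon rel" where
  "mon_less = {(m, n). m \<in> monomials r \<and> n \<in> monomials r \<and> (m, n) \<in> ord \<and> m \<noteq> n}"

text \<open>
  In an infinite descending sequence Dickson's lemma provides an earlier member that divides a later
  one, but a divisor is never larger in a monomial order.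
\<close>

lemma wf_mon_less: "wf mon_less"
  unfolding wf_iff_no_infinite_down_chain
proof
  assume "\<exists>s. \<forall>i. (s (Suc i), s i) \<in> mon_less"
  then obtain s where s: "\<And>i. (s (Suc i), s i) \<in> mon_less"
    by blast
  have sm: "s i \<in> monomials r" for i
    using s[of i] by (simp add: mon_less_def)
  have le: "(s (i + n), s i) \<in> ord" for i n
  proof (induction n)
    case (Suc n)
    have "(s (Suc (i + n)), s (i + n)) \<in> ord"
      using s[of "i + n"] by (simp add: mon_less_def)
    then show ?case
      using ord_trans[OF _ Suc] by simp
  qed (simp add: ord_refl sm)
  obtain \<phi> where \<phi>: "strict_mono \<phi>" "\<And>i. i < r \<Longrightarrow> incseq (\<lambda>n. coef (s (\<phi> n)) i)"
    using monotone_subsequence[of r s] by auto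
  let ?a = "s (\<phi> 0)" and ?b = "s (\<phi> 1)"
  have "coef ?a i \<le> coef ?b i" for i
  proof (cases "i < r")
    case False
    then have "i \<notin> supp ?a"
      using sm[of "\<phi> 0"] by (auto simp: monomials_def)
    then show ?thesis
      by (simp add: in_keys_iff)
  qed (use \<phi>(2) in \<open>simp add: incseq_def\<close>)
  then have "?b = ?a + (?b - ?a)"
    using mon_diff_add[of ?a ?b] by (simp add: add.commute)
  then have up: "(?a, ?b) \<in> ord"
    using ord_multiple[of ?a "?b - ?a"] sm monomials_diff by metis
  have lt: "\<phi> 0 < \<phi> 1"
    using \<phi>(1) by (simp add: strict_mono_def)
  then have "(?b, s (Suc (\<phi> 0))) \<in> ord"
    using le[of "Suc (\<phi> 0)" "\<phi> 1 - Suc (\<phi> 0)"] by simp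
  then have "(?a, s (Suc (\<phi> 0))) \<in> ord"
    using ord_trans[OF up] by blast
  then show False
    using s[of "\<phi> 0"] ord_antisym by (auto simp: mon_less_def)
qed

lemma ex_maximal_monomial:
  assumes "finite X" "X \<noteq> {}" "X \<subseteq> monomials r"
  shows "\<exists>m\<in>X. \<forall>m'\<in>X. (m', m) \<in> ord"
  using assms
proof (induction X rule: finite_ne_induct)
  case (insert x X)
  then obtain m where m: "m \<in> X" "\<forall>m'\<in>X. (m', m) \<in> ord"
    by auto
  show ?case
    using ord_total[of x m] insert.prems m ord_refl[of x] ord_trans by blast
qed (simp add: ord_refl)

abbreviation lead :: "'k::field mpol \<Rightarrow> mon" where
  "lead \<equiv> initial_monomial ord"

lemma lead_eqI:
  assumes "m \<in> supp f" "\<And>m'. m' \<in> supp f \<Longrightarrow> (m', m) \<in> ord"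
  shows "lead f = m"
  unfolding initial_monomial_def using assms by (intro the_equality) (auto intro: ord_antisym)

lemma lead:
  assumes "f \<in> mspan (monomials r)" "f \<noteq> 0"
  shows "lead f \<in> supp f" "\<And>m. m \<in> supp f \<Longrightarrow> (m, lead f) \<in> ord"
proof -
  obtain m where m: "m \<in> supp f" "\<forall>m'\<in>supp f. (m', m) \<in> ord"
    using ex_maximal_monomial[of "supp f"] assms by (auto simp: mspan_def)
  then show "lead f \<in> supp f" "\<And>m. m \<in> supp f \<Longrightarrow> (m, lead f) \<in> ord"
    using lead_eqI[of m f] by auto
qed

lemma lead_in_monomials: "f \<in> mspan (monomials r) \<Longrightarrow> f \<noteq> 0 \<Longrightarrow> lead f \<in> monomials r"
  using lead(1) by (auto simp: mspan_def)

lemma lead_single_mult: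
  fixes f :: "'k::field mpol"
  assumes "f \<in> mspan (monomials r)" "f \<noteq> 0" "u \<in> monomials r" "c \<noteq> 0"
  shows "lead (single u c * f) = u + lead f"
  using lead[OF assms(1,2)] assms
  by (intro lead_eqI) (auto simp: supp_single_mult mspan_def intro!: ord_add)

lemma lead_cancel:
  fixes f q :: "'k::field mpol"
  assumes f: "f \<in> mspan (monomials r)" and q: "q \<in> mspan (monomials r)"
    and m: "m \<in> monomials r" "\<And>m'. m' \<in> supp f \<union> supp q \<Longrightarrow> (m', m) \<in> ord"
    and c: "coef f m = coef q m" and ne: "f - q \<noteq> 0"
  shows "(lead (f - q), m) \<in> mon_less"
proof -
  have R: "f - q \<in> mspan (monomials r)"
    using f q by (rule mspan_diff)
  have l: "lead (f - q) \<in> supp (f - q)"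
    using lead(1)[OF R ne] .
  then have "lead (f - q) \<in> supp f \<union> supp q" "lead (f - q) \<noteq> m"
    using c by (auto simp: in_keys_iff lookup_minus)
  then show ?thesis
    using m l R by (auto simp: mon_less_def mspan_def)
qed

definition lead_set :: "'k::field mpol set \<Rightarrow> mon set" where
  "lead_set P = {lead f |f. f \<in> P \<and> f \<noteq> 0}"

lemma lead_setI: "f \<in> P \<Longrightarrow> f \<noteq> 0 \<Longrightarrow> lead f \<in> lead_set P"
  by (auto simp: lead_set_def)

lemma upclosed_lead_set:
  fixes P :: "'k::field mpol set"
  assumes P: "is_ideal r P"
  shows "upclosed r (lead_set P)"
  unfolding upclosed_def
proof (intro conjI ballI subsetI)
  fix u assume "u \<in> lead_set P"
  then obtain f where f: "f \<in> P" "f \<noteq> 0" "u = lead f"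
    by (auto simp: lead_set_def)
  note fR = is_idealD(1)[OF P f(1)]
  show "u \<in> monomials r"
    using lead_in_monomials[OF fR f(2)] f(3) by simp
  fix m assume m: "m \<in> monomials r"
  have "single m 1 * f \<in> P"
    using m by (intro is_idealD(4)[OF P f(1)]) simp
  moreover have "supp (single m 1 * f) \<noteq> {}"
    using f(2) by (simp add: supp_single_mult)
  then have "single m 1 * f \<noteq> 0"
    by auto
  ultimately show "m + u \<in> lead_set P"
    using lead_setI[of "single m 1 * f" P] lead_single_mult[OF fR f(2) m, of 1] f(3) by simp
qed

lemma initial_ideal_eq:
  fixes P :: "'k::field mpol set"
  assumes P: "is_ideal r P"
  shows "initial_ideal r ord P = mspan (lead_set P)"
proof
  interpret cring "poly_ring r :: 'k mpol ring" by (rule cring_poly_ring)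
  let ?G = "{initial_term ord f |f. f \<in> P \<and> f \<noteq> 0}"
  note I = is_ideal_mspan[OF upclosed_lead_set[OF P], where 'k = 'k]
  have G: "?G \<subseteq> mspan (lead_set P)"
    by (auto simp: initial_term_def intro: lead_setI)
  show "initial_ideal r ord P \<subseteq> mspan (lead_set P)"
    unfolding initial_ideal_def using I G by (intro genideal_minimal) (simp_all add: ideal_poly_ring_iff)
  have GR: "?G \<subseteq> carrier (poly_ring r)"
    using G is_idealD(1)[OF I] by (auto simp: carrier_poly_ring)
  let ?I = "initial_ideal r ord P"
  have II: "is_ideal r ?I"
    unfolding initial_ideal_def using genideal_ideal[OF GR] by (simp add: ideal_poly_ring_iff)
  have GI: "?G \<subseteq> ?I"
    unfolding initial_ideal_def by (rule genideal_self[OF GR])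
  show "mspan (lead_set P) \<subseteq> ?I"
  proof
    fix g :: "'k mpol" assume g: "g \<in> mspan (lead_set P)"
    have "(\<Sum>m\<in>supp g. single m (coef g m)) \<in> ?I"
    proof (rule is_ideal_sum[OF II])
      fix m assume "m \<in> supp g"
      then have "m \<in> lead_set P"
        using g by (rule mspanD[rotated])
      then obtain f where f: "f \<in> P" "f \<noteq> 0" "m = lead f"
        by (auto simp: lead_set_def)
      have c: "coef f m \<noteq> 0"
        using lead(1)[OF is_idealD(1)[OF P f(1)] f(2)] f(3) by (simp add: in_keys_iff)
      have "initial_term ord f \<in> ?I"
        using GI f by blast
      then have "single 0 (coef g m / coef f m) * initial_term ord f \<in> ?I"
        by (rule is_idealD(4)[OF II]) simp
      then show "single m (coef g m) \<in> ?I"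
        using c f(3) by (simp add: initial_term_def mult_single)
    qed
    then show "g \<in> ?I"
      by (simp add: poly_sum_terms)
  qed
qed

text \<open>
  Division with remainder. The set \<open>K\<close> restricts the monomials that may occur during the reduction;
  it is used for all monomials and for the monomials of a fixed degree.
\<close>

lemma normal_form_exists:
  fixes P :: "'k::field mpol set"
  assumes P: "is_ideal r P" and K: "K \<subseteq> monomials r"
    and red: "\<And>u. u \<in> lead_set P \<Longrightarrow> u \<in> K \<Longrightarrow> \<exists>p\<in>P. p \<noteq> 0 \<and> lead p = u \<and> p \<in> mspan K"
    and f: "f \<in> mspan K"
  shows "\<exists>s\<in>mspan (K - lead_set P). f - s \<in> P"
  using f
proof (induction "lead f" arbitrary: f rule: wf_induct_rule[OF wf_mon_less])
  case (1 f)
  show ?case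
  proof (cases "f = 0")
    case True
    then show ?thesis
      using is_idealD(2)[OF P] by (intro bexI[of _ 0]) auto
  next
    case False
    have fR: "f \<in> mspan (monomials r)"
      using 1(2) mspan_mono[OF K] by blast
    let ?m = "lead f"
    have m: "?m \<in> K" "?m \<in> monomials r"
      using lead(1)[OF fR False] 1(2) K by (auto simp: mspan_def)
    \<comment> \<open>Subtracting any \<open>q\<close> with the same leading term lets the induction hypothesis apply.\<close>
    have step: "\<exists>s\<in>mspan (K - lead_set P). f - q - s \<in> P"
      if q: "q \<in> mspan K" "coef q ?m = coef f ?m" "\<And>m'. m' \<in> supp q \<Longrightarrow> (m', ?m) \<in> ord" for q
    proof (cases "f - q = 0")
      case True
      then show ?thesis
        using is_idealD(2)[OF P] by (intro bexI[of _ 0]) auto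
    next
      case ne: False
      have qR: "q \<in> mspan (monomials r)"
        using q(1) mspan_mono[OF K] by blast
      have "(lead (f - q), ?m) \<in> mon_less"
        using lead(2)[OF fR False] q by (intro lead_cancel[OF fR qR m(2) _ _ ne]) auto
      then show ?thesis
        using 1(1) mspan_diff[OF 1(2) q(1)] by blast
    qed
    show ?thesis
    proof (cases "?m \<in> lead_set P")
      case True
      then obtain p where p: "p \<in> P" "p \<noteq> 0" "lead p = ?m" "p \<in> mspan K"
        using red m by blast
      note pR = is_idealD(1)[OF P p(1)]
      have pm: "coef p ?m \<noteq> 0"
        using lead(1)[OF pR p(2)] p(3) by (simp add: in_keys_iff)
      let ?a = "coef f ?m / coef p ?m"
      let ?q = "single 0 ?a * p"
      have a: "?a \<noteq> 0"
        using pm lead(1)[OF fR False] by (simp add: in_keys_iff)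
      have sq: "supp ?q = supp p"
        using a by (simp add: supp_single_mult)
      have "?q \<in> P"
        by (rule is_idealD(4)[OF P p(1)]) simp
      moreover have "\<exists>s\<in>mspan (K - lead_set P). f - ?q - s \<in> P"
      proof (rule step)
        show "?q \<in> mspan K"
          using p(4) sq by (simp add: mspan_def)
        show "coef ?q ?m = coef f ?m"
          using coef_single_mult[of 0 ?a p ?m] pm by simp
        show "(m', ?m) \<in> ord" if "m' \<in> supp ?q" for m'
          using lead(2)[OF pR p(2)] p(3) that sq by auto
      qed
      then obtain s where s: "s \<in> mspan (K - lead_set P)" "f - ?q - s \<in> P"
        by blast
      ultimately have "(f - ?q - s) + ?q \<in> P"
        using is_idealD(3)[OF P] by blast
      then show ?thesis
        using s(1) by (intro bexI[of _ s]) (simp_all add: algebra_simps)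
    next
      case notin: False
      let ?q = "single ?m (coef f ?m)"
      have "\<exists>s\<in>mspan (K - lead_set P). f - ?q - s \<in> P"
        by (rule step) (use m ord_refl in \<open>auto split: if_splits\<close>)
      then obtain s where s: "s \<in> mspan (K - lead_set P)" "f - ?q - s \<in> P"
        by blast
      have "?q + s \<in> mspan (K - lead_set P)"
        using m(1) notin s(1) by (intro mspan_add) simp_all
      then show ?thesis
        using s(2) by (intro bexI[of _ "?q + s"]) (simp_all add: algebra_simps)
    qed
  qed
qed

lemma normal_form:
  fixes P :: "'k::field mpol set"
  assumes "is_ideal r P" "f \<in> mspan (monomials r)"
  shows "\<exists>s\<in>mspan (monomials r - lead_set P). f - s \<in> P"
proof (rule normal_form_exists[OF assms(1) order_refl _ assms(2)])
  fix u assume "u \<in> lead_set P"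
  then show "\<exists>p\<in>P. p \<noteq> 0 \<and> lead p = u \<and> p \<in> mspan (monomials r)"
    using is_idealD(1)[OF assms(1)] by (auto simp: lead_set_def)
qed

lemma homogeneous_normal_form:
  fixes P :: "'k::field mpol set"
  assumes P: "is_ideal r P" "homogeneous_ideal r P" and f: "f \<in> mspan (forms r d)"
  shows "\<exists>s\<in>mspan (forms r d - lead_set P). f - s \<in> P"
proof (rule normal_form_exists[OF P(1) _ _ f])
  show "forms r d \<subseteq> monomials r"
    by (auto simp: forms_def)
  fix u assume u: "u \<in> lead_set P" "u \<in> forms r d"
  then obtain p where p: "p \<in> P" "p \<noteq> 0" "u = lead p"
    by (auto simp: lead_set_def)
  note l = lead[OF is_idealD(1)[OF P(1) p(1)] p(2)]
  let ?q = "part (forms r d) p"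
  have uq: "u \<in> supp ?q"
    using l(1) p(3) u(2) by (simp add: supp_part)
  have "lead ?q = u"
    using l(2) p(3) by (intro lead_eqI[OF uq]) (auto simp: supp_part)
  moreover have "?q \<in> P"
    by (rule homogeneous_ideal_part[OF P(2) p(1)])
  moreover have "?q \<in> mspan (forms r d)"
    by (auto simp: mspan_def supp_part)
  ultimately show "\<exists>p\<in>P. p \<noteq> 0 \<and> lead p = u \<and> p \<in> mspan (forms r d)"
    using uq by (intro bexI[of _ ?q]) auto
qed

text \<open>
  The larger of the two leading monomials would survive in the difference, and so be the leading
  monomial of an element of \<open>P\<close>.
\<close>

lemma lead_unique_mod:
  fixes P :: "'k::field mpol set"
  assumes P: "is_ideal r P"
    and f: "f \<in> mspan (monomials r)" "f \<noteq> 0" "lead f \<notin> lead_set P"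
    and g: "g \<in> mspan (monomials r)" "g \<noteq> 0" "lead g \<notin> lead_set P"
    and fg: "f - g \<in> P"
  shows "lead f = lead g"
proof -
  have *: "lead a = lead b" if a: "a \<in> mspan (monomials r)" "a \<noteq> 0" "lead a \<notin> lead_set P"
    and b: "b \<in> mspan (monomials r)" "b \<noteq> 0"
    and ab: "a - b \<in> P" "(lead b, lead a) \<in> ord" for a b :: "'k mpol"
  proof (rule ccontr)
    assume ne: "lead a \<noteq> lead b"
    then have "lead a \<notin> supp b"
      using lead(2)[OF b] ab(2) ord_antisym by blast
    then have la: "lead a \<in> supp (a - b)"
      using lead(1)[OF a(1,2)] by (simp add: in_keys_iff lookup_minus)
    have "(m', lead a) \<in> ord" if "m' \<in> supp (a - b)" for m'
    proof -
      have "m' \<in> supp a \<or> m' \<in> supp b"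
        using that by (auto simp: in_keys_iff lookup_minus)
      then show ?thesis
        using lead(2)[OF a(1,2)] lead(2)[OF b] ab(2) ord_trans by blast
    qed
    then have "lead (a - b) = lead a"
      by (rule lead_eqI[OF la])
    moreover have "a - b \<noteq> 0"
      using la by (metis keys_zero empty_iff)
    ultimately show False
      using lead_setI[OF ab(1)] a(3) by simp
  qed
  have "g - f \<in> P"
    using is_idealD(5)[OF P is_idealD(2)[OF P] fg] by simp
  then show ?thesis
    using *[OF f g(1,2) fg] *[OF g f(1,2)] ord_total[OF lead_in_monomials[OF f(1,2)] lead_in_monomials[OF g(1,2)]]
    by metis
qed

section \<open>The saturation of the initial ideal\<close>

text \<open>
  In a degree where \<open>y\<close> and \<open>z\<close> act without torsion on the quotient by the initial ideal, comparing
  the normal forms of \<open>z\<^sup>n g\<close> and \<open>y\<^sup>n g\<close> forces the leading monomial of the first one to be a multiple of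
  \<open>z\<^sup>n\<close>. If \<open>w\<close> were torsion, it could therefore be rewritten again and again by monomials outside the
  saturation, with ever smaller leading monomials. The number \<open>n\<close> serves both as the degree from which
  torsion is excluded and as the exponent of the multipliers.
\<close>

lemma saturated_if_saturated_in_large_degree:
  fixes P :: "'k::field mpol set"
  assumes Pp: "is_prime r P" and hom: "homogeneous_ideal r P"
    and yz: "y < r" "z < r" "y \<noteq> z"
    and free: "\<And>m. m \<in> mons_in {y, z} \<Longrightarrow> m \<notin> lead_set P"
    and large: "\<And>m v. m \<in> mons_in {y, z} \<Longrightarrow> v \<in> monomials r \<Longrightarrow> v \<notin> lead_set P \<Longrightarrow>
      n \<le> mon_degree r v \<Longrightarrow> m + v \<notin> lead_set P"
    and w: "w \<in> monomials r" "w \<notin> lead_set P" and m0: "m0 \<in> mons_in {y, z}"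
  shows "m0 + w \<notin> lead_set P"
proof
  assume m0w: "m0 + w \<in> lead_set P"
  note P = is_primeD(1)[OF Pp]
  let ?R = "mspan (monomials r) :: 'k mpol set" and ?U = "lead_set P"
  define d where "d = mon_degree r w"
  \<comment> \<open>\<open>J\<close> is the saturation and \<open>M\<close> its complement in degree \<open>d\<close>. The set \<open>X\<close> consists of the
    normal forms of \<open>z\<^sup>n g\<close> for all \<open>g\<close> that differ from \<open>w\<close> by a combination of \<open>M\<close>.\<close>
  define J where "J = {u. \<exists>m\<in>mons_in {y, z}. m + u \<in> ?U}"
  define M where "M = forms r d - J"
  define X where "X = {s. s \<in> mspan (forms r (d + n) - ?U) \<and>
    (\<exists>g. g - single w 1 \<in> mspan M \<and> single (single z n) 1 * g - s \<in> P)}"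
  have UJ: "?U \<subseteq> J"
  proof
    fix u assume "u \<in> ?U"
    then have "0 + u \<in> ?U"
      by simp
    then show "u \<in> J"
      unfolding J_def using zero_in_mons_in by blast
  qed
  have wJ: "w \<in> J"
    using m0 m0w by (auto simp: J_def)
  have power_mon: "single y n \<in> mons_in {y, z}" "single z n \<in> mons_in {y, z}"
    "single y n \<in> monomials r" "single z n \<in> monomials r"
    using yz by (simp_all add: mons_in_single monomials_eq)
  have deg_single: "mon_degree r (single i n) = n" if "i < r" for i
  proof -
    have "mon_degree r (single i n) = (\<Sum>l\<in>{..<r}. if l = i then n else 0)"
      unfolding mon_degree_def by (rule sum.cong) (auto simp: lookup_single when_def)
    then show ?thesis
      using that by simp
  qed
  have power_notin: "single u 1 \<notin> P" if "u \<in> mons_in {y, z}" for u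
  proof
    assume "single u 1 \<in> P"
    then have "lead (single u 1 :: 'k mpol) \<in> ?U"
      by (rule lead_setI) (metis single_zero inj_single keys_single keys_zero insert_not_empty zero_neq_one)
    moreover have "u \<in> monomials r"
      using that yz mons_in_mono[of "{y, z}" "{..<r}"] by (auto simp: monomials_eq)
    then have "lead (single u 1 :: 'k mpol) = u"
      using ord_refl by (intro lead_eqI) auto
    ultimately show False
      using free[OF that] by simp
  qed
  have g_form: "g \<in> mspan (forms r d)" "g \<in> ?R" "g \<notin> P" if g: "g - single w 1 \<in> mspan M" for g
  proof -
    have "single w 1 + (g - single w 1) \<in> mspan (forms r d)"
      using g w(1) mspan_mono[of M "forms r d"] by (intro mspan_add) (auto simp: M_def forms_def d_def)
    then show gd: "g \<in> mspan (forms r d)"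
      by simp
    then show gR: "g \<in> ?R"
      using mspan_mono[of "forms r d" "monomials r"] by (auto simp: forms_def)
    have "coef (g - single w 1) w = 0"
      using g wJ by (auto simp: M_def mspan_def in_keys_iff)
    then have "w \<in> supp g"
      by (simp add: in_keys_iff lookup_minus)
    then have g0: "g \<noteq> 0"
      by auto
    have "supp g \<subseteq> insert w M"
    proof
      fix m assume m: "m \<in> supp g"
      show "m \<in> insert w M"
      proof (cases "m = w")
        case False
        then have "m \<in> supp (g - single w 1)"
          using m by (simp add: in_keys_iff lookup_minus lookup_single when_def)
        then show ?thesis
          using g by (auto simp: mspan_def)
      qed simp
    qed
    then have "lead g \<notin> ?U"
      using lead(1)[OF gR g0] w(2) UJ by (auto simp: M_def)
    then show "g \<notin> P"
      using lead_setI g0 by blast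
  qed
  have nf_nonzero: "s \<noteq> 0" if "g - single w 1 \<in> mspan M" "u \<in> mons_in {y, z}" "u \<in> monomials r"
    "single u 1 * g - s \<in> P" for g s u
  proof
    assume "s = 0"
    then have "single u 1 * g \<in> P"
      using that(4) by simp
    then show False
      using is_primeD(3)[OF Pp _ g_form(2)[OF that(1)], of "single u 1"] power_notin[OF that(2)]
        g_form(3)[OF that(1)] that(3) by simp
  qed
  have nf: "\<exists>s\<in>mspan (forms r (d + n) - ?U). single (single i n) 1 * g - s \<in> P"
    if g: "g \<in> mspan (forms r d)" and i: "i < r" for g :: "'k mpol" and i
  proof (rule homogeneous_normal_form[OF P hom])
    show "single (single i n) 1 * g \<in> mspan (forms r (d + n))"
    proof (rule mspan_mult[OF _ g])
      show "single (single i n) 1 \<in> mspan {single i n}"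
        by simp
      fix m k :: mon assume "m \<in> {single i n}" "k \<in> forms r d"
      then show "m + k \<in> forms r (d + n)"
        using i deg_single[OF i] by (simp add: forms_def mon_degree_add monomials_eq mons_in_single)
    qed
  qed
  have lower: "\<exists>s2\<in>X. (lead s2, lead s) \<in> mon_less" if "s \<in> X" for s
  proof -
    obtain g where s: "s \<in> mspan (forms r (d + n) - ?U)" and g: "g - single w 1 \<in> mspan M"
      and Zg: "single (single z n) 1 * g - s \<in> P"
      using \<open>s \<in> X\<close> by (auto simp: X_def)
    obtain s' where s': "s' \<in> mspan (forms r (d + n) - ?U)" and Yg: "single (single y n) 1 * g - s' \<in> P"
      using nf[OF g_form(1)[OF g] yz(1)] by blast
    have sR: "s \<in> ?R" and s'R: "s' \<in> ?R"
      using s s' mspan_mono[of "forms r (d + n) - ?U" "monomials r"] by (auto simp: forms_def)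
    have s0: "s \<noteq> 0" and s'0: "s' \<noteq> 0"
      using nf_nonzero[OF g power_mon(2,4) Zg] nf_nonzero[OF g power_mon(1,3) Yg] by auto
    let ?v = "lead s" and ?v' = "lead s'"
    let ?Y = "single (single y n) 1 :: 'k mpol" and ?Z = "single (single z n) 1 :: 'k mpol"
    have v: "?v \<in> forms r (d + n)" "?v \<notin> ?U" and v': "?v' \<in> forms r (d + n)" "?v' \<notin> ?U"
      using lead(1)[OF sR s0] lead(1)[OF s'R s'0] s s' by (auto simp: mspan_def)
    have vm: "?v \<in> monomials r" "?v' \<in> monomials r" "n \<le> mon_degree r ?v" "n \<le> mon_degree r ?v'"
      using v v' by (auto simp: forms_def)
    have lY: "lead (?Y * s) = single y n + ?v" and lZ: "lead (?Z * s') = single z n + ?v'"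
      using lead_single_mult[OF sR s0 power_mon(3), of 1] lead_single_mult[OF s'R s'0 power_mon(4), of 1] by simp_all
    \<comment> \<open>Both sides are leading monomials of representatives of the class of \<open>y\<^sup>n z\<^sup>n g\<close>.\<close>
    have "single y n + ?v = single z n + ?v'"
      unfolding lY[symmetric] lZ[symmetric]
    proof (rule lead_unique_mod[OF P])
      show "lead (?Y * s) \<notin> ?U" "lead (?Z * s') \<notin> ?U"
        unfolding lY lZ using large power_mon vm v v' by blast+
      show "?Y * s \<in> ?R" "?Z * s' \<in> ?R"
        using sR s'R power_mon by (auto intro!: mspan_monomials_mult)
      have "supp (?Y * s) \<noteq> {}" "supp (?Z * s') \<noteq> {}"
        using s0 s'0 by (simp_all add: supp_single_mult)
      then show "?Y * s \<noteq> 0" "?Z * s' \<noteq> 0"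
        by auto
      have "?Z * (?Y * g - s') - ?Y * (?Z * g - s) \<in> P"
        using power_mon(3,4)
        by (intro is_idealD(5)[OF P is_idealD(4)[OF P Yg] is_idealD(4)[OF P Zg]]) simp_all
      then show "?Y * s - ?Z * s' \<in> P"
        by (simp add: algebra_simps)
    qed
    then have "coef (single y n + ?v) z = coef (single z n + ?v') z"
      by simp
    then have nz: "n \<le> coef ?v z"
      using yz(3) by (simp add: lookup_add lookup_single when_def)
    define w' where "w' = ?v - single z n"
    have "?v - single z n + single z n = ?v"
      using nz by (intro mon_diff_add) (auto simp: lookup_single when_def)
    then have vw': "?v = single z n + w'"
      by (simp add: w'_def add.commute)
    \<comment> \<open>So the leading term of the normal form of \<open>z\<^sup>n g\<close> is a multiple of \<open>z\<^sup>n w'\<close> with \<open>w' \<in> M\<close>.\<close>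
    have "mon_degree r w' = d" "w' \<in> monomials r"
      using v(1) deg_single[OF yz(2)] unfolding vw' by (auto simp: forms_def mon_degree_add monomials_eq)
    moreover have "w' \<notin> J"
    proof
      assume "w' \<in> J"
      then obtain m where m: "m \<in> mons_in {y, z}" "m + w' \<in> ?U"
        by (auto simp: J_def)
      have "single z n + (m + w') \<in> ?U"
        using upclosedD(2)[OF upclosed_lead_set[OF P] m(2) power_mon(4)] .
      then have "m + ?v \<in> ?U"
        unfolding vw' by (simp add: ac_simps)
      then show False
        using large[OF m(1) vm(1) v(2) vm(3)] by simp
    qed
    ultimately have w'M: "w' \<in> M"
      by (simp add: M_def forms_def)
    let ?c = "coef s ?v"
    let ?s2 = "s - single ?v ?c" and ?g2 = "g - single w' ?c"
    have g2: "?g2 - single w 1 \<in> mspan M"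
      using mspan_diff[OF g, of "single w' ?c"] w'M by (simp add: algebra_simps)
    have "?Z * single w' ?c = single ?v ?c"
      by (simp add: mult_single flip: vw')
    then have Zg2: "?Z * ?g2 - ?s2 \<in> P"
      using Zg by (simp add: right_diff_distrib)
    have "single ?v ?c \<in> mspan (forms r (d + n) - ?U)"
      using v by simp
    then have "?s2 \<in> mspan (forms r (d + n) - ?U)"
      using s mspan_diff by blast
    then have "?s2 \<in> X"
      unfolding X_def using g2 Zg2 by blast
    moreover have "(lead ?s2, ?v) \<in> mon_less"
      using lead(2)[OF sR s0] vm(1) ord_refl nf_nonzero[OF g2 power_mon(2,4) Zg2]
      by (intro lead_cancel[OF sR]) (auto split: if_splits)
    ultimately show ?thesis
      by blast
  qed
  have "single w 1 - single w 1 \<in> (mspan M :: 'k mpol set)"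
    by simp
  from nf[OF g_form(1)[OF this] yz(2)] this obtain s0 where "s0 \<in> X"
    unfolding X_def by blast
  then have "lead s0 \<in> lead ` X"
    by simp
  then obtain v where v: "v \<in> lead ` X" "\<And>v'. (v', v) \<in> mon_less \<Longrightarrow> v' \<notin> lead ` X"
    using wfE_min[OF wf_mon_less, of "lead s0" "lead ` X"] by blast
  then show False
    using lower by blast
qed

end

section \<open>The saturated chain property\<close>

lemma pure_power_or_ann_witness:
  assumes U: "upclosed r U" and v: "v \<in> monomials r" and i: "i < r"
    and no: "\<And>n. single i n + v \<notin> U"
  shows "\<exists>B t. i \<in> B \<and> B \<subseteq> {..<r} \<and> t \<in> monomials r \<and> ann_witness r U ({..<r} - B) (t + v)"
proof -
  have "m + v \<notin> U" if "m \<in> mons_in {i}" for m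
  proof -
    have "m = single i (coef m i)"
      using that by (intro poly_mapping_eqI) (auto simp: mons_in_def lookup_single when_def in_keys_iff)
    then show ?thesis
      using no by metis
  qed
  then show ?thesis
    using exists_ann_witness[OF U v, of "{i}"] i by auto
qed

text \<open>
  The variables outside \<open>A\<close> are independent modulo \<open>P\<close> because no monomial in them is a leading
  monomial. The pure powers bound the exponents of the variables in \<open>A\<close> in a normal form, so the
  finitely many remaining monomials in these variables generate \<open>R/P\<close> as a module over the polynomial
  ring in the other variables.
\<close>

lemma prime_chain_above_of_pure_powers:
  fixes P :: "'k::field mpol set"
  assumes ord: "monomial_order r ord" and Pp: "is_prime r P" and A: "A \<subseteq> {..<r}"
    and powers: "\<And>i. i \<in> A \<Longrightarrow> \<exists>n. single i n \<in> lead_set ord P"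
    and free: "\<And>m. m \<in> mons_in ({..<r} - A) \<Longrightarrow> m \<notin> lead_set ord P"
  shows "prime_chain_above r P (card ({..<r} - A))"
proof -
  note P = is_primeD(1)[OF Pp]
  let ?U = "lead_set ord P" and ?B = "{..<r} - A"
  note U = upclosed_lead_set[OF ord P]
  have finA: "finite A"
    using A finite_subset by blast
  obtain e where e: "\<And>i. i \<in> A \<Longrightarrow> single i (e i) \<in> ?U"
    using powers by metis
  define N where "N = (\<Sum>i\<in>A. e i)"
  let ?T = "(\<lambda>m. single m 1 :: 'k mpol) ` box A N"
  show ?thesis
  proof (rule prime_chain_of_independent_variables[OF Pp])
    show "?B \<subseteq> {..<r}"
      by auto
    show fin: "finite ?T"
      using card_box(1)[OF finA] by (rule finite_imageI)
    show "?T \<subseteq> mspan (monomials r)"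
      using mons_in_mono[OF A] by (auto simp: box_def monomials_eq)
    show "p = 0" if "p \<in> P" "p \<in> mspan (mons_in ?B)" for p
    proof (rule ccontr)
      assume "p \<noteq> 0"
      then have "initial_monomial ord p \<in> ?U" "initial_monomial ord p \<in> supp p"
        using that(1) lead_setI[OF ord] lead(1)[OF ord is_idealD(1)[OF P]] by blast+
      then show False
        using free that(2) by (auto simp: mspan_def)
    qed
    fix f :: "'k mpol" assume "f \<in> mspan (monomials r)"
    then obtain s where s: "s \<in> mspan (monomials r - ?U)" "f - s \<in> P"
      using normal_form[OF ord P] by blast
    have "in_span (mons_in ?B) P ?T (single m (coef s m))" if "m \<in> supp s" for m
    proof -
      have m: "m \<in> monomials r" "m \<notin> ?U"
        using s(1) that by (auto simp: mspan_def)
      obtain m1 m2 where split: "m = m1 + m2" "supp m1 \<subseteq> A" "supp m2 \<subseteq> supp m - A"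
        using mon_split[of m A] by blast
      have "coef m1 i \<le> N" for i
      proof (cases "i \<in> A")
        case True
        show ?thesis
        proof (rule ccontr)
          assume "\<not> coef m1 i \<le> N"
          moreover have "e i \<le> N"
            unfolding N_def using True finA by (intro member_le_sum) auto
          moreover have "coef m1 i \<le> coef m i"
            by (simp add: split(1) lookup_add)
          ultimately have "m \<in> ?U"
            by (intro upclosed_le[OF U e[OF True] m(1)]) (auto simp: lookup_single when_def)
          then show False
            using m(2) by simp
        qed
      next
        case False
        then have "i \<notin> supp m1"
          using split(2) by auto
        then show ?thesis
          by (simp add: in_keys_iff)
      qed
      then have "in_span (mons_in ?B) P ?T (single m1 1)"
        using split(2) by (intro in_span_member[OF P fin]) (auto simp: box_def mons_in_def)
      moreover have "single m2 (coef s m) \<in> mspan (mons_in ?B)"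
        using m(1) split(3) by (auto simp: mons_in_def monomials_def)
      ultimately have "in_span (mons_in ?B) P ?T (single m2 (coef s m) * single m1 1)"
        by (intro in_span_mult[OF P]) auto
      then show ?thesis
        by (simp add: split(1) mult_single add.commute)
    qed
    then have "in_span (mons_in ?B) P ?T (\<Sum>m\<in>supp s. single m (coef s m))"
      by (rule in_span_sum[OF P])
    then have "in_span (mons_in ?B) P ?T ((f - s) + s)"
      using in_span_add[OF P in_span_ideal[OF P s(2)]] by (simp only: poly_sum_terms)
    then show "in_span (mons_in ?B) P ?T f"
      by simp
  qed
qed

text \<open>
  A large exponent of a variable in \<open>v\<close> already does the work of the power of this variable that
  carries \<open>v\<close> into \<open>U\<close>. So the exponents of a torsion monomial outside \<open>U\<close> are bounded.
\<close>

lemma torsion_degree_bounded: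
  assumes U: "upclosed r U"
    and torsion: "\<And>v m i. v \<in> monomials r \<Longrightarrow> m \<in> M \<Longrightarrow> m + v \<in> U \<Longrightarrow> i < r \<Longrightarrow>
      \<exists>n. single i n + v \<in> U"
  shows "\<exists>n. \<forall>m\<in>M. \<forall>v\<in>monomials r. v \<notin> U \<longrightarrow> n \<le> mon_degree r v \<longrightarrow> m + v \<notin> U"
proof -
  obtain N where N: "\<And>u v. u \<in> U \<Longrightarrow> v \<in> monomials r \<Longrightarrow> (\<And>i. min N (coef u i) \<le> coef v i) \<Longrightarrow> v \<in> U"
    using upclosed_truncation[OF U] by blast
  have "m + v \<notin> U" if m: "m \<in> M" and v: "v \<in> monomials r" "v \<notin> U"
    and deg: "Suc (r * N) \<le> mon_degree r v" for m v
  proof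
    assume mv: "m + v \<in> U"
    have "\<exists>i<r. N \<le> coef v i"
    proof (rule ccontr)
      assume "\<not> ?thesis"
      then have "mon_degree r v \<le> (\<Sum>i<r. N)"
        unfolding mon_degree_def by (intro sum_mono) auto
      then show False
        using deg by simp
    qed
    then obtain i where i: "i < r" "N \<le> coef v i"
      by blast
    obtain n where "single i n + v \<in> U"
      using torsion[OF v(1) m mv i(1)] by blast
    then have "v \<in> U"
      by (rule N[OF _ v(1)]) (use i in \<open>auto simp: lookup_add lookup_single when_def\<close>)
    then show False
      using v(2) by simp
  qed
  then show ?thesis
    by blast
qed

lemma downward_closed_nat_set:
  assumes "finite A" "\<And>p q. p \<in> A \<Longrightarrow> q < p \<Longrightarrow> q \<in> A"
  shows "\<exists>j. A = {..<j::nat}"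
proof
  obtain n where "n \<notin> A"
    using assms(1) ex_new_if_finite infinite_UNIV_nat by blast
  let ?j = "LEAST n. n \<notin> A"
  have "?j \<notin> A"
    using \<open>n \<notin> A\<close> by (rule LeastI)
  then have "p < ?j" if "p \<in> A" for p
    using assms(2)[OF that, of ?j] that by (metis linorder_neqE_nat)
  then show "A = {..<?j}"
    using not_less_Least by blast
qed

theorem theorem5:
  fixes r :: nat and P :: "'k::field mpol set" and ord :: "mon rel"
  assumes "primeideal P (poly_ring r)"
    and "homogeneous_ideal r P"
    and "krull_dim (poly_ring r Quot P) = 2"
    and "monomial_order r ord"
    and "borel_fixed r (initial_ideal r ord P)"
  shows "saturated_chain_property (poly_ring r) (initial_ideal r ord P)"
proof -
  note ord = assms(4)
  have Pp: "is_prime r P"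
    using assms(1) by (simp add: primeideal_poly_ring_iff)
  note PI = is_primeD(1)[OF Pp]
  define U where "U = lead_set ord P"
  have I: "initial_ideal r ord P = mspan U"
    unfolding U_def by (rule initial_ideal_eq[OF ord PI])
  have U: "upclosed r U"
    unfolding U_def by (rule upclosed_lead_set[OF ord PI])
  let ?I = "mspan U :: 'k mpol set"
  let ?ass = "associated_primes (poly_ring r) ?I"
  let ?Q = "\<lambda>j. var_ideal r {..<j} :: 'k mpol set"
  define S where "S = {j. j \<le> r \<and> (\<exists>w. ann_witness r U {..<j} w)}"
  have initial_segment: "\<exists>j\<in>S. A = {..<j}" if A: "A \<subseteq> {..<r}" and w: "ann_witness r U A w" for A w
  proof -
    have "(var_ideal r A :: 'k mpol set) \<in> ?ass"
      by (rule associated_of_ann_witness[OF U w])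
    then have "q \<in> A" if "p \<in> A" "q < p" for p q
      using borel_fixed_associated_initial_segment[OF U, of A p q] assms(5) that A by (auto simp: I)
    moreover have "finite A"
      using A finite_subset by blast
    ultimately obtain j where j: "A = {..<j}"
      using downward_closed_nat_set[of A] by blast
    have "j \<le> r"
      using A unfolding j by (simp add: lessThan_subset_iff)
    then show ?thesis
      using w unfolding j S_def by blast
  qed
  have ass_S: "?Q j \<in> ?ass" if "j \<in> S" for j
    using that associated_of_ann_witness[OF U] by (auto simp: S_def)
  have S_ass: "\<exists>j\<in>S. Q = ?Q j" if "Q \<in> ?ass" for Q
    using associated_prime_of_monomial_ideal[OF U that] initial_segment by blast
  have avoid_S: "\<exists>l\<in>S. \<exists>t\<in>monomials r. l \<le> i \<and> ann_witness r U {..<l} (t + v)"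
    if no: "v \<in> monomials r" "i < r" "\<And>n. single i n + v \<notin> U" for i v
  proof -
    obtain B t where B: "i \<in> B" "B \<subseteq> {..<r}" "t \<in> monomials r" "ann_witness r U ({..<r} - B) (t + v)"
      using pure_power_or_ann_witness[OF U no] by blast
    then obtain l where l: "l \<in> S" "{..<r} - B = {..<l}"
      using initial_segment[of "{..<r} - B"] by blast
    moreover have "i \<notin> {..<l}"
      using B(1) unfolding l(2)[symmetric] by simp
    ultimately show ?thesis
      using B(3,4) by auto
  qed
  have dim: "krull_dim (poly_ring r Quot ?Q j) = enat (r - j)" if "j \<le> r" for j
    using krull_dim_var_ideal[of "{..<j}" r] that by simp
  have finS: "finite S"
    by (rule finite_subset[of _ "{..r}"]) (auto simp: S_def)
  have main: "\<exists>P'\<in>?ass. P' \<subseteq> Q \<and> krull_dim (poly_ring r Quot P') = krull_dim (poly_ring r Quot Q) + 1"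
    if Q: "Q \<in> ?ass" "\<not> minimal_prime (poly_ring r) ?I Q" for Q
  proof -
    obtain j where j: "j \<in> S" and Qj: "Q = ?Q j"
      using S_ass[OF Q(1)] by blast
    have jr: "j \<le> r"
      using j by (simp add: S_def)
    define j0 where "j0 = Min S"
    have j0: "j0 \<in> S" and j0_le: "\<And>i. i \<in> S \<Longrightarrow> j0 \<le> i"
      using j finS by (auto simp: j0_def intro: Min_in)
    have j0r: "j0 \<le> r"
      using j0 by (simp add: S_def)
    obtain w0 where w0: "ann_witness r U {..<j0} w0"
      using j0 by (auto simp: S_def)
    have meets: "supp u \<inter> {..<j0} \<noteq> {}" if "u \<in> U" for u
      using w0 upclosedD[OF U that] that unfolding ann_witness_def by (metis add.commute)
    have free: "m \<notin> U" if "m \<in> mons_in ({..<r} - {..<j0})" for m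
      using meets[of m] that unfolding mons_in_def by blast
    have powers: "\<exists>n. single i n \<in> U" if i: "i < j0" for i
    proof (rule ccontr)
      assume "\<nexists>n. single i n \<in> U"
      then obtain l where "l \<in> S" "l \<le> i"
        using avoid_S[of 0 i] i j0r by auto
      then show False
        using j0_le i by fastforce
    qed
    have IQ: "?I \<subseteq> ?Q j0"
      unfolding var_ideal_def using meets upclosedD(1)[OF U] by (intro mspan_mono) blast
    \<comment> \<open>\<open>?Q j0\<close> is the only minimal prime, since it is the radical.\<close>
    have minimal: "?Q j0 \<subseteq> Q'" if Q': "is_prime r Q'" "?I \<subseteq> Q'" for Q'
    proof (rule var_ideal_subset[OF is_primeD(1)[OF Q'(1)]])
      fix i assume i: "i \<in> {..<j0}" "i < r"
      then obtain n where n: "single i n \<in> U"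
        using powers by auto
      then have "single (single i n) 1 \<in> Q'"
        using Q'(2) by auto
      moreover have "single i n \<in> monomials r"
        using upclosedD(1)[OF U n] .
      ultimately obtain l where "l \<in> supp (single i n)" "var l \<in> Q'"
        using prime_monomial[OF Q'(1)] by blast
      then show "var i \<in> Q'"
        by (auto split: if_splits)
    qed
    have "j \<noteq> j0"
    proof
      assume "j = j0"
      then have "minimal_prime (poly_ring r) ?I Q"
        unfolding minimal_prime_def primeideal_poly_ring_iff Qj
        using IQ minimal is_prime_var_ideal by blast
      then show False
        using Q(2) by blast
    qed
    then have j0j: "j0 < j"
      using j0_le[OF j] by simp
    have "card ({..<r} - {..<j0}) = r - j0"
      using j0r by (simp add: card_Diff_subset)
    then have "prime_chain_above r P (r - j0)"
      using prime_chain_above_of_pure_powers[OF ord Pp, of "{..<j0}"] powers free j0r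
      unfolding U_def by simp
    then have "enat (r - j0) \<le> krull_dim (poly_ring r Quot P)"
      unfolding krull_dim_poly_Quot[OF PI] by (intro Sup_upper) auto
    then have r_j0: "r - j0 \<le> 2"
      unfolding assms(3) by (simp add: numeral_eq_enat)
    have "j - 1 \<in> S"
    proof (rule ccontr)
      assume notS: "j - 1 \<notin> S"
      then have "j \<noteq> j0 + 1"
        using j0 by auto
      then have j_eq: "j = r" and j0_eq: "j0 + 2 = r"
        using r_j0 j0j jr by auto
      define y z where "y = j0" and "z = j0 + 1"
      have yz: "y < r" "z < r" "y \<noteq> z" "{..<r} - {..<j0} = {y, z}"
        using j0_eq by (auto simp: y_def z_def)
      have S_eq: "l = j0 \<or> l = r" if "l \<in> S" for l
      proof -
        have "l \<noteq> j0 + 1"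
          using notS that j_eq j0_eq by auto
        moreover have "l \<le> r"
          using that by (simp add: S_def)
        ultimately show ?thesis
          using j0_le[OF that] j0_eq by auto
      qed
      \<comment> \<open>Torsion with respect to \<open>y z\<close> can only come from the maximal ideal: if no power of the variable
        \<open>i\<close> killed \<open>v\<close>, then a multiple of \<open>v\<close> would witness the other prime, which contains neither
        \<open>y\<close> nor \<open>z\<close>.\<close>
      have torsion: "\<exists>n. single i n + v \<in> U"
        if v: "v \<in> monomials r" and m: "m \<in> mons_in {y, z}" "m + v \<in> U" and i: "i < r" for v m i
      proof (rule ccontr)
        assume "\<nexists>n. single i n + v \<in> U"
        then obtain l t where l: "l \<in> S" "t \<in> monomials r" "l \<le> i" "ann_witness r U {..<l} (t + v)"
          using avoid_S[OF v i] by metis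
        then have wit: "ann_witness r U {..<j0} (t + v)"
          using S_eq[OF l(1)] i by auto
        have "m + (t + v) \<in> U"
          using upclosedD(2)[OF U m(2) l(2)] by (simp add: ac_simps)
        moreover have "m \<in> monomials r"
          using m(1) yz(1,2) by (auto simp: mons_in_def monomials_def)
        ultimately have "supp m \<inter> {..<j0} \<noteq> {}"
          using wit by (simp add: ann_witness_def)
        then show False
          using m(1) unfolding yz(4)[symmetric] mons_in_def by blast
      qed
      obtain n where large: "\<And>m v. m \<in> mons_in {y, z} \<Longrightarrow> v \<in> monomials r \<Longrightarrow> v \<notin> U \<Longrightarrow>
          n \<le> mon_degree r v \<Longrightarrow> m + v \<notin> U"
      proof -
        have "\<exists>n. \<forall>m\<in>mons_in {y, z}. \<forall>v\<in>monomials r. v \<notin> U \<longrightarrow> n \<le> mon_degree r v \<longrightarrow> m + v \<notin> U"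
          by (rule torsion_degree_bounded[OF U torsion])
        then show ?thesis
          using that by metis
      qed
      \<comment> \<open>An element of the socle: it lies in the saturation and not in the ideal.\<close>
      obtain w where w: "ann_witness r U {..<r} w"
        using j unfolding j_eq S_def by blast
      have wm: "w \<in> monomials r" and ann: "\<forall>m\<in>monomials r. m + w \<in> U \<longleftrightarrow> supp m \<inter> {..<r} \<noteq> {}"
        using w by (simp_all add: ann_witness_def)
      have "w \<notin> U"
        using bspec[OF ann zero_in_monomials] by simp
      with wm have "single z 1 + w \<notin> U"
        using saturated_if_saturated_in_large_degree[OF ord Pp assms(2) yz(1-3), of n w "single z 1"]
          free large yz(4) unfolding U_def[symmetric] by (auto simp: mons_in_single)
      moreover have "single z 1 + w \<in> U"
        using w yz(2) by (simp add: ann_witness_def monomials_eq mons_in_single)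
      ultimately show False
        by simp
    qed
    moreover have "?Q (j - 1) \<subseteq> ?Q j"
      unfolding var_ideal_def by (intro mspan_mono) auto
    moreover have "krull_dim (poly_ring r Quot ?Q (j - 1)) = krull_dim (poly_ring r Quot ?Q j) + 1"
      using dim[of j] dim[of "j - 1"] jr j0j by (simp add: one_enat_def Suc_diff_le)
    ultimately show ?thesis
      using ass_S Qj by blast
  qed
  show ?thesis
    unfolding saturated_chain_property_def I using main by blast
qed

end
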